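(* Let $\Pi\in\mathcal M(G)$ have nonsingular infinitesimal character $\xi\in\mathbb C\setminus\{0\}$, and let $\{\Pi_\lambda:\lambda\in\Lambda(\xi)\}\subset\mathcal M(G)$ be the reduced coherent family passing through $\Pi=\Pi_\xi$. Consider the characters $\mathbb C_\nu$ of $G'$ with $\nu\in\mathbb Z$, and set $\Xi:=\Lambda(\xi)\times\mathbb Z$. (1) Suppose $\xi\notin\mathbb Z$. Then the multiplicity $[\Pi_\lambda:\mathbb C_\nu]$, $(\lambda,\nu)\in\Xi$, depends only on the parity of $\lambda-\xi-\nu\in\mathbb Z$. (2) Suppose $\xi\in\mathbb N_+$. Then $\Xi=\mathbb N_+\times\mathbb Z$ decomposes as a disjoint union $\Xi=\Xi_{\rm even}\amalg\Xi_{\rm odd}$ according to $\lambda\equiv\nu \pmod 2$ and $\lambda\equiv\nu+1\pmod 2$, respectively; and $\Xi_{\rm odd}$ decomposes further as $$\Xi_{\rm odd}=\Xi_{\rm odd}^{\uparrow}\amalg\Xi_{\rm odd}^{\rightarrow}\amalg\Xi_{\rm odd}^{\downarrow}$$ according to the conditions $\nu\ge\lambda+1$, $\lambda\ge|\nu|+1$, and $\nu\le-\lambda-1$, respectively. Then the multiplicity $[\Pi_\lambda:\mathbb C_\nu]$ is constant on each of the four regions $\Xi_{\rm even}$, $\Xi_{\rm odd}^{\uparrow}$, $\Xi_{\rm odd}^{\rightarrow}$, $\Xi_{\rm odd}^{\downarrow}$.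
   Context: $G\supset G'$ is a pair of real Lie groups with complexified Lie algebras $(\mathfrak{sl}(2,\mathbb C),\mathfrak{gl}(1,\mathbb C))$, where $G$ is a real form of $SL(2,\mathbb C)$ (so that $\mathbb C^2$ is a $G$-module) and $G'$ is connected. $\{H,X,Y\}\subset\mathfrak g_{\mathbb C}$ is an $\mathfrak{sl}_2$-triple with $\mathfrak g'_{\mathbb C}=\mathbb CH$. $\mathbb C_\nu$ is the character of $G'$ whose differential sends $tH\mapsto\nu t$. $\mathbb N_+=\{1,2,\dots\}$, $\mathbb N_-=\{-1,-2,\dots\}$. $\mathcal M(G)$ is the category of admissible smooth Fréchet representations of $G$ of finite length and moderate growth. The multiplicity $[\Pi:\mathbb C_\nu]$ is the dimension of $\operatorname{Hom}_{G'}(\Pi|_{G'},\mathbb C_\nu)$, the space of continuous $G'$-homomorphisms. Infinitesimal character $\lambda\in\mathbb C/\{\pm1\}$ means that the Casimir element $\Omega=H^2+2(XY+YX)$ acts by $\lambda^2-1$; $P_\tau(V)$ denotes the generalized eigenspace ($\tau$-primary component) of $\mathfrak Z(\mathfrak g_{\mathbb C})=\mathbb C[\Omega]$ for infinitesimal character $\tau$. For $\xi\ne0$ set $\Lambda(\xi)=\mathbb Z+\xi$ if $\xi\notin\mathbb Z$; $\Lambda(\xi)=\mathbb N_+$ if $\xi\in\mathbb N_+$; $\Lambda(\xi)=\mathbb N_-$ if $\xi\in\mathbb N_-$. A family $\{\Pi_\lambda\in\mathcal M(G):\lambda\in\Lambda(\xi)\}$ is a reduced coherent family through $\Pi$ (of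 infinitesimal character $\xi$) if: $\Pi_\xi=\Pi$; $\Pi_\lambda$ has infinitesimal character $\lambda$; and for every $\delta\in\{1,-1\}$, whenever $\lambda$ and $\lambda+\delta$ both lie in $\Lambda(\xi)$, $P_{\lambda+\delta}(\Pi_\lambda\otimes\mathbb C^2)\simeq\Pi_{\lambda+\delta}$ and $P_\lambda(\Pi_{\lambda+\delta}\otimes\mathbb C^2)\simeq\Pi_\lambda$, where $\mathbb C^2$ is the natural representation. *)

theory Defs
  imports "HOL-Analysis.Analysis" "HOL-Library.Function_Algebras" "HOL-Library.Extended_Nat"
begin

section \<open>Complex vector spaces\<close>

class complex_vector = ab_group_add +
  fixes scaleC :: "complex \<Rightarrow> 'a \<Rightarrow> 'a"  (infixr \<open>*\<^sub>C\<close> 75)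
  assumes scaleC_add_right: "c *\<^sub>C (x + y) = c *\<^sub>C x + c *\<^sub>C y"
    and scaleC_add_left: "(c + d) *\<^sub>C x = c *\<^sub>C x + d *\<^sub>C x"
    and scaleC_scaleC: "c *\<^sub>C d *\<^sub>C x = (c * d) *\<^sub>C x"
    and scaleC_one: "1 *\<^sub>C x = x"

interpretation complex_vector: vector_space "scaleC :: complex \<Rightarrow> 'a \<Rightarrow> 'a::complex_vector"
  by unfold_locales (simp_all add: scaleC_add_right scaleC_add_left scaleC_scaleC scaleC_one)

instantiation complex :: complex_vector
begin
definition scaleC_complex :: "complex \<Rightarrow> complex \<Rightarrow> complex" where
  "scaleC_complex c z = c * z"
instance
  by standard (simp_all add: scaleC_complex_def algebra_simps)
end

instantiation "fun" :: (type, complex_vector) complex_vector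
begin
definition scaleC_fun :: "complex \<Rightarrow> ('a \<Rightarrow> 'b) \<Rightarrow> 'a \<Rightarrow> 'b" where
  "scaleC_fun c f = (\<lambda>x. c *\<^sub>C f x)"
instance
  by standard
    (simp_all add: fun_eq_iff scaleC_fun_def scaleC_add_right scaleC_add_left scaleC_scaleC scaleC_one)
end

instantiation prod :: (complex_vector, complex_vector) complex_vector
begin
definition scaleC_prod :: "complex \<Rightarrow> 'a \<times> 'b \<Rightarrow> 'a \<times> 'b" where
  "scaleC_prod c p = (c *\<^sub>C fst p, c *\<^sub>C snd p)"
instance
  by standard
    (simp_all add: prod_eq_iff scaleC_prod_def scaleC_add_right scaleC_add_left scaleC_scaleC scaleC_one)
end

instantiation vec :: (complex_vector, finite) complex_vector
begin
definition scaleC_vec :: "complex \<Rightarrow> ('a, 'b) vec \<Rightarrow> ('a, 'b) vec" where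
  "scaleC_vec c x = (\<chi> i. c *\<^sub>C x $ i)"
instance
  by standard
    (simp_all add: vec_eq_iff scaleC_vec_def scaleC_add_right scaleC_add_left scaleC_scaleC scaleC_one)
end

definition cdim :: "'a::complex_vector set \<Rightarrow> enat" where
  "cdim V = (if \<exists>B. finite B \<and> V \<subseteq> complex_vector.span B then enat (complex_vector.dim V) else \<infinity>)"

definition clinear_on :: "'a::complex_vector set \<Rightarrow> ('a \<Rightarrow> 'b::complex_vector) \<Rightarrow> bool" where
  "clinear_on V f \<longleftrightarrow>
     (\<forall>x\<in>V. \<forall>y\<in>V. f (x + y) = f x + f y) \<and> (\<forall>c. \<forall>x\<in>V. f (c *\<^sub>C x) = c *\<^sub>C f x)"


section \<open>Real forms of $SL(2,\mathbb{C})$ and closed subgroups\<close>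

type_synonym cmat = "complex ^ 2 ^ 2"

definition matrix_exp :: "cmat \<Rightarrow> cmat" where
  "matrix_exp A = (\<Sum>k. (1 / fact k) *\<^sub>R (((**) A ^^ k) (mat 1)))"

definition SL2C :: "cmat set" where "SL2C = {g. det g = 1}"

definition sl2C :: "cmat set" where "sl2C = {A. trace A = 0}"

definition lie_bracket :: "cmat \<Rightarrow> cmat \<Rightarrow> cmat" where
  "lie_bracket A B = A ** B - B ** A"

definition subgroup_of :: "cmat set \<Rightarrow> cmat set \<Rightarrow> bool" where
  "subgroup_of K G \<longleftrightarrow> K \<subseteq> G \<and> mat 1 \<in> K \<and> (\<forall>g\<in>K. \<forall>h\<in>K. g ** h \<in> K) \<and> (\<forall>g\<in>K. matrix_inv g \<in> K)"

text \<open>The (real) Lie algebra of a closed matrix group.\<close>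

definition lie_algebra :: "cmat set \<Rightarrow> cmat set" where
  "lie_algebra G = {A. \<forall>t::real. matrix_exp (t *\<^sub>R A) \<in> G}"

definition complexification :: "cmat set \<Rightarrow> cmat set" where
  "complexification g = {A + \<i> *\<^sub>C B | A B. A \<in> g \<and> B \<in> g}"

text \<open>
  A real form of the complex Lie group is the fixed point group of an antiholomorphic involutive
  automorphism \<open>\<sigma>\<close>; antiholomorphic means that its differential \<open>s\<close> is conjugate-linear.
\<close>

definition real_form_SL2C :: "cmat set \<Rightarrow> bool" where
  "real_form_SL2C G \<longleftrightarrow> (\<exists>\<sigma> s.
     (\<forall>g\<in>SL2C. \<sigma> g \<in> SL2C \<and> \<sigma> (\<sigma> g) = g) \<and>
     (\<forall>g\<in>SL2C. \<forall>h\<in>SL2C. \<sigma> (g ** h) = \<sigma> g ** \<sigma> h) \<and>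
     continuous_on SL2C \<sigma> \<and>
     (\<forall>A\<in>sl2C. s A \<in> sl2C \<and> \<sigma> (matrix_exp A) = matrix_exp (s A)) \<and>
     (\<forall>A\<in>sl2C. \<forall>B\<in>sl2C. s (A + B) = s A + s B) \<and>
     (\<forall>c. \<forall>A\<in>sl2C. s (c *\<^sub>C A) = cnj c *\<^sub>C s A) \<and>
     G = {g \<in> SL2C. \<sigma> g = g})"

definition sl2_triple :: "cmat \<Rightarrow> cmat \<Rightarrow> cmat \<Rightarrow> bool" where
  "sl2_triple H X Y \<longleftrightarrow> H \<in> sl2C \<and> X \<in> sl2C \<and> Y \<in> sl2C \<and> H \<noteq> 0 \<and>
     lie_bracket H X = 2 *\<^sub>C X \<and> lie_bracket H Y = (-2) *\<^sub>C Y \<and> lie_bracket X Y = H"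


section \<open>Continuous and smooth Frechet representations\<close>

definition seminorm_on :: "'v::complex_vector set \<Rightarrow> ('v \<Rightarrow> real) \<Rightarrow> bool" where
  "seminorm_on V p \<longleftrightarrow> (\<forall>x\<in>V. 0 \<le> p x) \<and> (\<forall>x\<in>V. \<forall>y\<in>V. p (x + y) \<le> p x + p y) \<and>
     (\<forall>c. \<forall>x\<in>V. p (c *\<^sub>C x) = cmod c * p x)"

text \<open>
  The topology lives on a linear subspace \<open>topspace T\<close> of the ambient type, so that one type can
  carry a whole family of different Frechet spaces. The conditions say that it is defined by a
  separating sequence of seminorms \<open>p n\<close> for which the space is complete.
\<close>

definition frechet_space :: "'v::complex_vector topology \<Rightarrow> bool" where
  "frechet_space T \<longleftrightarrow> complex_vector.subspace (topspace T) \<and>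
     (\<exists>p :: nat \<Rightarrow> 'v \<Rightarrow> real.
        (\<forall>n. seminorm_on (topspace T) (p n)) \<and>
        (\<forall>x\<in>topspace T. (\<forall>n. p n x = 0) \<longrightarrow> x = 0) \<and>
        (\<forall>U. openin T U \<longleftrightarrow> U \<subseteq> topspace T \<and>
           (\<forall>x\<in>U. \<exists>N. \<exists>e>0. \<forall>y\<in>topspace T. (\<forall>n\<le>N. p n (y - x) < e) \<longrightarrow> y \<in> U)) \<and>
        (\<forall>x :: nat \<Rightarrow> 'v. range x \<subseteq> topspace T \<longrightarrow>
           (\<forall>n. \<forall>e>0. \<exists>M. \<forall>i\<ge>M. \<forall>j\<ge>M. p n (x i - x j) < e) \<longrightarrow>
           (\<exists>l\<in>topspace T. \<forall>n. (\<lambda>i. p n (x i - l)) \<longlonglongrightarrow> 0)))"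

record 'v rep =
  rep_top :: "'v topology"
  rep_act :: "cmat \<Rightarrow> 'v \<Rightarrow> 'v"

abbreviation rep_space :: "'v rep \<Rightarrow> 'v set" where
  "rep_space R \<equiv> topspace (rep_top R)"

definition frechet_rep :: "cmat set \<Rightarrow> 'v::complex_vector rep \<Rightarrow> bool" where
  "frechet_rep G R \<longleftrightarrow> frechet_space (rep_top R) \<and>
     (\<forall>g\<in>G. rep_act R g \<in> rep_space R \<rightarrow> rep_space R \<and> clinear_on (rep_space R) (rep_act R g)) \<and>
     (\<forall>v\<in>rep_space R. rep_act R (mat 1) v = v) \<and>
     (\<forall>g\<in>G. \<forall>h\<in>G. \<forall>v\<in>rep_space R. rep_act R (g ** h) v = rep_act R g (rep_act R h v)) \<and>
     continuous_map (prod_topology (top_of_set G) (rep_top R)) (rep_top R) (\<lambda>(g, v). rep_act R g v)"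

text \<open>
  Smoothness of a map \<open>F\<close> from \<open>G\<close> to the topological vector space \<open>T\<close>, in the trivialization of
  the tangent bundle by left-invariant vector fields: \<open>D A g\<close> is the derivative at \<open>g\<close> in the
  direction \<open>A\<close>. A map is \<open>C\<^sup>1\<close> if these derivatives exist and are jointly continuous in \<open>(g, A)\<close>;
  the set \<open>S\<close>, closed under derivatives, expresses that this can be iterated indefinitely.
\<close>

definition smooth_group_map ::
  "cmat set \<Rightarrow> 'v::complex_vector topology \<Rightarrow> (cmat \<Rightarrow> 'v) \<Rightarrow> bool" where
  "smooth_group_map G T F \<longleftrightarrow> (\<exists>S. F \<in> S \<and>
     (\<forall>f\<in>S. continuous_map (top_of_set G) T f \<and>
        (\<exists>D. (\<forall>A\<in>lie_algebra G. D A \<in> S) \<and>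
           (\<forall>A\<in>lie_algebra G. \<forall>g\<in>G.
              limitin T (\<lambda>t::real. complex_of_real (1 / t) *\<^sub>C (f (g ** matrix_exp (t *\<^sub>R A)) - f g))
                (D A g) (at 0)) \<and>
           continuous_map (prod_topology (top_of_set G) (top_of_set (lie_algebra G))) T
             (\<lambda>(g, A). D A g))))"

definition deriv_act :: "'v::complex_vector rep \<Rightarrow> cmat \<Rightarrow> 'v \<Rightarrow> 'v" where
  "deriv_act R A v = (THE w.
     limitin (rep_top R) (\<lambda>t::real. complex_of_real (1 / t) *\<^sub>C (rep_act R (matrix_exp (t *\<^sub>R A)) v - v))
       w (at 0))"

text \<open>
  A smooth representation is one that coincides with its space of smooth vectors, both as a vector
  space (first condition) and topologically. The topology of the space of smooth vectors is
  generated by the seminorms \<open>v \<mapsto> p (d\<pi>(u) v)\<close>, \<open>u\<close> in the enveloping algebra, so the second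
  condition amounts to continuity of the operators \<open>d\<pi>(A)\<close>.
\<close>

definition smooth_rep :: "cmat set \<Rightarrow> 'v::complex_vector rep \<Rightarrow> bool" where
  "smooth_rep G R \<longleftrightarrow> frechet_rep G R \<and>
     (\<forall>v\<in>rep_space R. smooth_group_map G (rep_top R) (\<lambda>g. rep_act R g v)) \<and>
     (\<forall>A\<in>lie_algebra G. continuous_map (rep_top R) (rep_top R) (deriv_act R A))"

definition intertwiners ::
  "cmat set \<Rightarrow> 'v::complex_vector rep \<Rightarrow> 'w::complex_vector rep \<Rightarrow> ('v \<Rightarrow> 'w) set" where
  "intertwiners G R S = {f. clinear_on (rep_space R) f \<and> continuous_map (rep_top R) (rep_top S) f \<and>
     (\<forall>g\<in>G. \<forall>v\<in>rep_space R. f (rep_act R g v) = rep_act S g (f v)) \<and>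
     (\<forall>v. v \<notin> rep_space R \<longrightarrow> f v = 0)}"

definition rep_iso :: "cmat set \<Rightarrow> 'v::complex_vector rep \<Rightarrow> 'w::complex_vector rep \<Rightarrow> bool" where
  "rep_iso G R S \<longleftrightarrow> (\<exists>f\<in>intertwiners G R S. homeomorphic_map (rep_top R) (rep_top S) f)"

definition subrep :: "'v rep \<Rightarrow> 'v set \<Rightarrow> 'v rep" where
  "subrep R W = R\<lparr>rep_top := subtopology (rep_top R) W\<rparr>"


section \<open>The category $\mathcal{M}(G)$\<close>

definition closed_invariant :: "cmat set \<Rightarrow> 'v::complex_vector rep \<Rightarrow> 'v set \<Rightarrow> bool" where
  "closed_invariant G R W \<longleftrightarrow> complex_vector.subspace W \<and> closedin (rep_top R) W \<and>
     (\<forall>g\<in>G. \<forall>w\<in>W. rep_act R g w \<in> W)"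

definition irreducible_rep :: "cmat set \<Rightarrow> 'v::complex_vector rep \<Rightarrow> bool" where
  "irreducible_rep G R \<longleftrightarrow> rep_space R \<noteq> {0} \<and>
     (\<forall>W. closed_invariant G R W \<longrightarrow> W = {0} \<or> W = rep_space R)"

text \<open>
  Composition series: \<open>W (Suc i)\<close> modulo \<open>W i\<close> is irreducible iff there is no closed invariant
  subspace strictly in between.
\<close>

definition finite_length :: "cmat set \<Rightarrow> 'v::complex_vector rep \<Rightarrow> bool" where
  "finite_length G R \<longleftrightarrow> (\<exists>n W. W 0 = {0} \<and> W n = rep_space R \<and>
     (\<forall>i\<le>n. closed_invariant G R (W i)) \<and>
     (\<forall>i<n. W i \<subset> W (Suc i) \<and> \<not> (\<exists>U. closed_invariant G R U \<and> W i \<subset> U \<and> U \<subset> W (Suc i))))"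

definition maximal_compact :: "cmat set \<Rightarrow> cmat set \<Rightarrow> bool" where
  "maximal_compact G K \<longleftrightarrow> subgroup_of K G \<and> compact K \<and>
     (\<forall>L. subgroup_of L G \<and> compact L \<and> K \<subseteq> L \<longrightarrow> L = K)"

text \<open>
  The \<open>K\<close>-types are taken inside the type \<open>nat \<Rightarrow> complex\<close>, which contains a copy of every
  finite-dimensional complex vector space.
\<close>

definition admissible :: "cmat set \<Rightarrow> 'v::complex_vector rep \<Rightarrow> bool" where
  "admissible G R \<longleftrightarrow> (\<forall>K. maximal_compact G K \<longrightarrow>
     (\<forall>\<tau> :: (nat \<Rightarrow> complex) rep.
        frechet_rep K \<tau> \<and> cdim (rep_space \<tau>) \<noteq> \<infinity> \<and> irreducible_rep K \<tau> \<longrightarrow>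
        cdim (intertwiners K \<tau> R) \<noteq> \<infinity>))"

definition moderate_growth :: "cmat set \<Rightarrow> 'v::complex_vector rep \<Rightarrow> bool" where
  "moderate_growth G R \<longleftrightarrow>
     (\<forall>p. seminorm_on (rep_space R) p \<and> continuous_map (rep_top R) euclideanreal p \<longrightarrow>
        (\<exists>q N. seminorm_on (rep_space R) q \<and> continuous_map (rep_top R) euclideanreal q \<and>
           (\<forall>g\<in>G. \<forall>v\<in>rep_space R.
              p (rep_act R g v) \<le> max (norm g) (norm (matrix_inv g)) ^ N * q v)))"

definition category_M :: "cmat set \<Rightarrow> 'v::complex_vector rep set" where
  "category_M G = {R. smooth_rep G R \<and> admissible G R \<and> finite_length G R \<and> moderate_growth G R}"


section \<open>Infinitesimal characters and reduced coherent families\<close>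

definition complex_deriv_act :: "cmat set \<Rightarrow> 'v::complex_vector rep \<Rightarrow> cmat \<Rightarrow> 'v \<Rightarrow> 'v" where
  "complex_deriv_act G R Z v = (THE w. \<exists>A\<in>lie_algebra G. \<exists>B\<in>lie_algebra G.
     Z = A + \<i> *\<^sub>C B \<and> w = deriv_act R A v + \<i> *\<^sub>C deriv_act R B v)"

definition casimir_act ::
  "cmat set \<Rightarrow> cmat \<Rightarrow> cmat \<Rightarrow> cmat \<Rightarrow> 'v::complex_vector rep \<Rightarrow> 'v \<Rightarrow> 'v" where
  "casimir_act G H X Y R v = (let d = complex_deriv_act G R in
     d H (d H v) + 2 *\<^sub>C (d X (d Y v) + d Y (d X v)))"

definition has_infinitesimal_character ::
  "cmat set \<Rightarrow> cmat \<Rightarrow> cmat \<Rightarrow> cmat \<Rightarrow> 'v::complex_vector rep \<Rightarrow> complex \<Rightarrow> bool" where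
  "has_infinitesimal_character G H X Y R \<tau> \<longleftrightarrow>
     (\<forall>v\<in>rep_space R. casimir_act G H X Y R v = (\<tau>\<^sup>2 - 1) *\<^sub>C v)"

definition primary_component ::
  "cmat set \<Rightarrow> cmat \<Rightarrow> cmat \<Rightarrow> cmat \<Rightarrow> complex \<Rightarrow> 'v::complex_vector rep \<Rightarrow> 'v rep" where
  "primary_component G H X Y \<tau> R = subrep R
     {v \<in> rep_space R. \<exists>n. ((\<lambda>w. casimir_act G H X Y R w - (\<tau>\<^sup>2 - 1) *\<^sub>C w) ^^ n) v = 0}"

text \<open>
  The tensor product with the natural representation on \<open>\<complex>\<^sup>2\<close>, realized on pairs:
  \<open>(v, w)\<close> stands for \<open>v \<otimes> e\<^sub>1 + w \<otimes> e\<^sub>2\<close> with the standard basis \<open>e\<^sub>1, e\<^sub>2\<close>.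
\<close>

definition tensor_C2 :: "'v::complex_vector rep \<Rightarrow> ('v \<times> 'v) rep" where
  "tensor_C2 R = \<lparr>rep_top = prod_topology (rep_top R) (rep_top R),
     rep_act = (\<lambda>g (v, w).
       (g $ 1 $ 1 *\<^sub>C rep_act R g v + g $ 1 $ 2 *\<^sub>C rep_act R g w,
        g $ 2 $ 1 *\<^sub>C rep_act R g v + g $ 2 $ 2 *\<^sub>C rep_act R g w))\<rparr>"

definition N_plus :: "complex set" where "N_plus = {of_int n | n. n \<ge> 1}"

definition N_minus :: "complex set" where "N_minus = {of_int n | n. n \<le> -1}"

text \<open>Only meant for nonzero \<open>\<xi>\<close>.\<close>

definition Lambda :: "complex \<Rightarrow> complex set" where
  "Lambda \<xi> = (if \<xi> \<notin> \<int> then {of_int n + \<xi> | n. True} else if \<xi> \<in> N_plus then N_plus else N_minus)"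

definition reduced_coherent_family ::
  "cmat set \<Rightarrow> cmat \<Rightarrow> cmat \<Rightarrow> cmat \<Rightarrow> complex \<Rightarrow> 'v::complex_vector rep \<Rightarrow> (complex \<Rightarrow> 'v rep) \<Rightarrow> bool"
  where
  "reduced_coherent_family G H X Y \<xi> R P \<longleftrightarrow>
     P \<xi> = R \<and>
     (\<forall>l\<in>Lambda \<xi>. P l \<in> category_M G \<and> has_infinitesimal_character G H X Y (P l) l) \<and>
     (\<forall>\<delta>\<in>{1, -1}. \<forall>l\<in>Lambda \<xi>. l + \<delta> \<in> Lambda \<xi> \<longrightarrow>
        rep_iso G (primary_component G H X Y (l + \<delta>) (tensor_C2 (P l))) (P (l + \<delta>)) \<and>
        rep_iso G (primary_component G H X Y l (tensor_C2 (P (l + \<delta>)))) (P l))"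


section \<open>Characters of the subgroup and multiplicities\<close>

definition is_character ::
  "cmat set \<Rightarrow> cmat \<Rightarrow> complex \<Rightarrow> (cmat \<Rightarrow> complex) \<Rightarrow> bool" where
  "is_character G' H \<nu> \<psi> \<longleftrightarrow> continuous_on G' \<psi> \<and> (\<forall>g\<in>G'. \<psi> g \<noteq> 0) \<and>
     (\<forall>g\<in>G'. \<forall>h\<in>G'. \<psi> (g ** h) = \<psi> g * \<psi> h) \<and>
     (\<forall>c. c *\<^sub>C H \<in> lie_algebra G' \<longrightarrow>
        ((\<lambda>t. \<psi> (matrix_exp (t *\<^sub>R (c *\<^sub>C H)))) has_vector_derivative \<nu> * c) (at 0))"

definition character_rep :: "(cmat \<Rightarrow> complex) \<Rightarrow> complex rep" where
  "character_rep \<psi> = \<lparr>rep_top = euclidean, rep_act = (\<lambda>g z. \<psi> g * z)\<rparr>"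

definition multiplicity_of :: "cmat set \<Rightarrow> 'v::complex_vector rep \<Rightarrow> (cmat \<Rightarrow> complex) \<Rightarrow> enat" where
  "multiplicity_of G' R \<psi> = cdim (intertwiners G' R (character_rep \<psi>))"


section \<open>The regions for positive integral $\xi$\<close>

definition Xi_even :: "(complex \<times> int) set" where
  "Xi_even = {(of_int l, \<nu>) | l \<nu>. l \<ge> 1 \<and> l mod 2 = \<nu> mod 2}"

definition Xi_odd :: "(complex \<times> int) set" where
  "Xi_odd = {(of_int l, \<nu>) | l \<nu>. l \<ge> 1 \<and> l mod 2 = (\<nu> + 1) mod 2}"

definition Xi_odd_up :: "(complex \<times> int) set" where
  "Xi_odd_up = {(of_int l, \<nu>) | l \<nu>. (of_int l, \<nu>) \<in> Xi_odd \<and> \<nu> \<ge> l + 1}"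

definition Xi_odd_right :: "(complex \<times> int) set" where
  "Xi_odd_right = {(of_int l, \<nu>) | l \<nu>. (of_int l, \<nu>) \<in> Xi_odd \<and> l \<ge> \<bar>\<nu>\<bar> + 1}"

definition Xi_odd_down :: "(complex \<times> int) set" where
  "Xi_odd_down = {(of_int l, \<nu>) | l \<nu>. (of_int l, \<nu>) \<in> Xi_odd \<and> \<nu> \<le> - l - 1}"

end

theory Submission
  imports Defs
begin

text \<open>
  The proof translates symmetry breaking operators, that is, \<open>G'\<close>-homomorphisms to a character. Let
  \<open>V = \<Pi>\<^sub>\<lambda>\<close> and let \<open>f : V \<rightarrow> \<complex>\<^sub>\<nu>\<close> be one. Restricted to \<open>G'\<close> the natural representation \<open>\<complex>\<^sup>2\<close> is
  the sum of two weight lines of weight \<open>\<plusminus>1\<close>, so a weight coordinate \<open>\<alpha>\<close> of weight \<open>\<plusminus>1\<close> on \<open>\<complex>\<^sup>2\<close>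
  gives \<open>f \<otimes> \<alpha> : V \<otimes> \<complex>\<^sup>2 \<rightarrow> \<complex>\<^bsub>\<nu> \<plusminus> 1\<^esub>\<close>, which can be restricted to a primary component of
  \<open>V \<otimes> \<complex>\<^sup>2\<close>, a copy of \<open>\<Pi>\<^bsub>\<lambda> + 1\<^esub>\<close> or \<open>\<Pi>\<^bsub>\<lambda> - 1\<^esub>\<close>. The point is to see when this map is injective.

  Write \<open>\<mu> = \<plusminus>\<lambda>\<close> for the component of infinitesimal character \<open>\<mu> + 1\<close> up to sign. In weight
  coordinates the Casimir operator of \<open>V \<otimes> \<complex>\<^sup>2\<close> is \<open>\<Omega> + 3 + 2M\<close> with
  \<open>M (a, b) = (Ha + 2Yb, 2Xa - Hb)\<close>, and \<open>(M + 1)\<^sup>2 = \<mu>\<^sup>2\<close> because \<open>\<Omega> = \<mu>\<^sup>2 - 1\<close> on \<open>V\<close>. Hence the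
  component contains the image of \<open>M + 1 + \<mu>\<close>, in particular vectors whose first coordinate is
  \<open>Hv + (1 + \<mu>) v\<close> and vectors whose second coordinate is \<open>(1 + \<mu>) v - Hv\<close>, for every \<open>v\<close>. On these
  the translated functional has the values \<open>(\<mu> + 1 + \<nu>) f v\<close> and \<open>(\<mu> + 1 - \<nu>) f v\<close>. So
  translation is injective unless this scalar vanishes (\<open>translation_multiplicity_le\<close>). Translating
  forth and back involves the same scalar up to sign, which gives the equality of the multiplicities
  at \<open>(\<lambda>, \<nu>)\<close> and \<open>(\<lambda> + 1, \<nu> \<plusminus> 1)\<close> whenever \<open>\<lambda> + 1 \<plusminus> \<nu> \<noteq> 0\<close> (\<open>coherent_family_moves\<close>). For
  nonintegral \<open>\<xi>\<close> no move is excluded, and for \<open>\<xi> \<in> \<nat>\<^sub>+\<close> the excluded moves are exactly those that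
  cross the walls between the three odd regions (\<open>half_plane_moves\<close>).

  Two analytic facts are needed to make this algebra available. First, the derivatives of a smooth
  representation form a Lie algebra representation: additivity follows from the Trotter product
  formula (\<open>deriv_add_left\<close>), and the bracket relation from the adjoint action (\<open>deriv_bracket\<close>).
  Second, \<open>G'\<close> is the one-parameter group \<open>exp (\<real>cH)\<close> (\<open>connected_subgroup_one_parameter\<close>), so that its
  characters are determined by their differentials and equivariance can be tested on \<open>H\<close>.
\<close>

section \<open>The exponential of two-by-two matrices\<close>

lemma cmat_mult_entry [simp]:
  "((A :: cmat) ** B) $ i $ j = A $ i $ 1 * B $ 1 $ j + A $ i $ 2 * B $ 2 $ j"
  by (simp add: matrix_matrix_mult_def sum_2)

lemma cmat_eqI:
  assumes "(A :: cmat) $ 1 $ 1 = B $ 1 $ 1" "A $ 1 $ 2 = B $ 1 $ 2"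
    and "A $ 2 $ 1 = B $ 2 $ 1" "A $ 2 $ 2 = B $ 2 $ 2"
  shows "A = B"
  using assms by (simp add: vec_eq_iff forall_2)

text \<open>
  A copy of the matrix type that carries the operator norm. It is a unital Banach algebra, so the
  general theory of the exponential series applies to it.
\<close>

typedef mat2 = "UNIV :: cmat set" morphisms of_mat2 Mat2
  by simp

lemmas mat2_simps [simp] = Mat2_inverse [OF UNIV_I] of_mat2_inverse of_mat2_inject

lemma mat2_eqI: "of_mat2 a = of_mat2 b \<Longrightarrow> a = b"
  by simp

instantiation mat2 :: real_vector
begin
definition "0 = Mat2 0"
definition "a + b = Mat2 (of_mat2 a + of_mat2 b)"
definition "a - b = Mat2 (of_mat2 a - of_mat2 b)"
definition "- a = Mat2 (- of_mat2 a)"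
definition "r *\<^sub>R a = Mat2 (r *\<^sub>R of_mat2 a)"
instance
  by standard
    (simp_all add: zero_mat2_def plus_mat2_def minus_mat2_def uminus_mat2_def scaleR_mat2_def
      algebra_simps)
end

lemma of_mat2_simps [simp]:
  "of_mat2 0 = 0" "of_mat2 (a + b) = of_mat2 a + of_mat2 b"
  "of_mat2 (a - b) = of_mat2 a - of_mat2 b" "of_mat2 (- a) = - of_mat2 a"
  "of_mat2 (r *\<^sub>R a) = r *\<^sub>R of_mat2 a"
  by (simp_all add: zero_mat2_def plus_mat2_def minus_mat2_def uminus_mat2_def scaleR_mat2_def)

lemma matrix_vector_bounded_linear: "bounded_linear (\<lambda>v. (A :: cmat) *v v)"
proof (rule linear_conv_bounded_linear[THEN iffD1])
  show "linear (\<lambda>v. A *v v)"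
    by (rule linearI)
      (simp_all add: matrix_vector_right_distrib vec_eq_iff matrix_vector_mult_def scaleR_sum_right
        distrib_left sum.distrib)
qed

instantiation mat2 :: real_algebra_1
begin
definition "1 = Mat2 (mat 1)"
definition "a * b = Mat2 (of_mat2 a ** of_mat2 b)"
instance
proof
  fix a b c :: mat2 and r :: real
  show "a * b * c = a * (b * c)"
    by (simp add: times_mat2_def matrix_mul_assoc)
  show "(a + b) * c = a * c + b * c" "a * (b + c) = a * b + a * c"
    by (rule mat2_eqI, rule cmat_eqI; simp add: times_mat2_def algebra_simps)+
  show "r *\<^sub>R a * b = r *\<^sub>R (a * b)" "a * r *\<^sub>R b = r *\<^sub>R (a * b)"
    by (rule mat2_eqI, rule cmat_eqI; simp add: times_mat2_def algebra_simps)+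
  show "1 * a = a" "a * 1 = a"
    by (simp_all add: one_mat2_def times_mat2_def)
  have "(mat 1 :: cmat) $ 1 $ 1 \<noteq> 0 $ 1 $ 1"
    by (simp add: mat_def)
  then show "(0::mat2) \<noteq> 1"
    by (metis of_mat2_simps(1) one_mat2_def mat2_simps(1))
qed
end

lemma of_mat2_mult [simp]: "of_mat2 (a * b) = of_mat2 a ** of_mat2 b"
  and of_mat2_one [simp]: "of_mat2 1 = mat 1"
  by (simp_all add: times_mat2_def one_mat2_def)

instantiation mat2 :: real_normed_algebra_1
begin
definition "norm a = onorm (\<lambda>v. of_mat2 a *v v)"
definition "dist (a::mat2) b = norm (a - b)"
definition "(uniformity :: (mat2 \<times> mat2) filter) = (INF e\<in>{0<..}. principal {(x, y). dist x y < e})"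
definition "open (U :: mat2 set) = (\<forall>x\<in>U. \<forall>\<^sub>F (x', y) in uniformity. x' = x \<longrightarrow> y \<in> U)"
definition "sgn (a::mat2) = a /\<^sub>R norm a"
instance
proof
  fix a b :: mat2 and r :: real
  show "dist a b = norm (a - b)" by (rule dist_mat2_def)
  show "sgn a = a /\<^sub>R norm a" by (rule sgn_mat2_def)
  show "(uniformity :: (mat2 \<times> mat2) filter) = (INF e\<in>{0<..}. principal {(x, y). dist x y < e})"
    by (rule uniformity_mat2_def)
  show "open U = (\<forall>x\<in>U. \<forall>\<^sub>F (x', y) in uniformity. x' = x \<longrightarrow> y \<in> U)" for U :: "mat2 set"
    by (rule open_mat2_def)
  show "(norm a = 0) = (a = 0)"
  proof
    assume "norm a = 0"
    then have "of_mat2 a *v v = 0" for v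
      by (simp add: norm_mat2_def onorm_eq_0[OF matrix_vector_bounded_linear])
    then have "of_mat2 a = 0"
      by (metis matrix_eq matrix_vector_mult_0)
    then show "a = 0"
      by (simp add: mat2_eqI)
  next
    assume "a = 0"
    then show "norm a = 0"
      by (simp add: norm_mat2_def onorm_zero)
  qed
  have "onorm (\<lambda>v. of_mat2 a *v v + of_mat2 b *v v)
      \<le> onorm (\<lambda>v. of_mat2 a *v v) + onorm (\<lambda>v. of_mat2 b *v v)"
    by (intro onorm_triangle matrix_vector_bounded_linear)
  then show "norm (a + b) \<le> norm a + norm b"
    by (simp add: norm_mat2_def matrix_vector_mult_add_rdistrib)
  have "(r *\<^sub>R A) *v v = r *\<^sub>R (A *v v)" for A :: cmat and v
    by (simp add: vec_eq_iff matrix_vector_mult_def scaleR_sum_right)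
  then show "norm (r *\<^sub>R a) = \<bar>r\<bar> * norm a"
    by (simp add: norm_mat2_def onorm_scaleR[OF matrix_vector_bounded_linear])
  have "onorm ((\<lambda>v. of_mat2 a *v v) \<circ> (\<lambda>v. of_mat2 b *v v))
      \<le> onorm (\<lambda>v. of_mat2 a *v v) * onorm (\<lambda>v. of_mat2 b *v v)"
    by (intro onorm_compose matrix_vector_bounded_linear)
  then show "norm (a * b) \<le> norm a * norm b"
    by (simp add: norm_mat2_def o_def matrix_vector_mul_assoc)
  have "onorm (\<lambda>v::complex^2. v) = 1"
  proof (rule antisym)
    show "onorm (\<lambda>v::complex^2. v) \<le> 1"
      by (rule onorm_bound) simp_all
    have "norm (axis 1 1 :: complex^2) \<le> onorm (\<lambda>v::complex^2. v) * norm (axis 1 1 :: complex^2)"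
      by (rule onorm[of "\<lambda>v::complex^2. v"]) (rule bounded_linear_ident)
    then show "1 \<le> onorm (\<lambda>v::complex^2. v)"
      by (simp add: norm_axis_1)
  qed
  then show "norm (1::mat2) = 1"
    by (simp add: norm_mat2_def)
qed
end

lemma norm_le_sum_components: "norm x \<le> (\<Sum>i\<in>UNIV. norm (x $ i))"
  unfolding norm_vec_def by (rule L2_set_le_sum) simp

lemma norm_entry_le: "norm ((of_mat2 a) $ i $ j) \<le> norm a"
proof -
  have "norm (of_mat2 a $ i $ j) = norm ((of_mat2 a *v axis j 1) $ i)"
    by (simp add: matrix_vector_mult_def axis_def if_distrib cong: if_cong)
  also have "\<dots> \<le> norm (of_mat2 a *v axis j 1)"
    by (rule Finite_Cartesian_Product.norm_nth_le)
  also have "\<dots> \<le> norm a * norm (axis j 1 :: complex^2)"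
    unfolding norm_mat2_def by (rule onorm[OF matrix_vector_bounded_linear])
  finally show ?thesis
    by (simp add: norm_axis_1)
qed

lemma bounded_linear_of_mat2: "bounded_linear of_mat2"
proof (rule bounded_linear_intro[where K = 4])
  fix a :: mat2
  have "norm (of_mat2 a) \<le> (\<Sum>i\<in>UNIV. norm (of_mat2 a $ i))"
    by (rule norm_le_sum_components)
  also have "\<dots> \<le> (\<Sum>i\<in>UNIV. \<Sum>j\<in>UNIV. norm (of_mat2 a $ i $ j))"
    by (intro sum_mono norm_le_sum_components)
  also have "\<dots> \<le> (\<Sum>i\<in>(UNIV::2 set). \<Sum>j\<in>(UNIV::2 set). norm a)"
    by (intro sum_mono norm_entry_le)
  finally show "norm (of_mat2 a) \<le> norm a * 4"
    by simp
qed simp_all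

lemma bounded_linear_Mat2: "bounded_linear Mat2"
proof (rule bounded_linear_intro[where K = 4])
  fix A :: cmat
  have "norm (A *v v) \<le> 4 * norm A * norm v" for v
  proof -
    have "norm (A *v v) \<le> (\<Sum>i\<in>UNIV. norm ((A *v v) $ i))"
      by (rule norm_le_sum_components)
    also have "\<dots> \<le> (\<Sum>i\<in>(UNIV::2 set). \<Sum>j\<in>(UNIV::2 set). norm A * norm v)"
    proof (rule sum_mono)
      fix i :: 2
      have "norm ((A *v v) $ i) \<le> (\<Sum>j\<in>UNIV. norm (A $ i $ j * v $ j))"
        unfolding matrix_vector_mult_def by (simp add: norm_sum)
      also have "\<dots> \<le> (\<Sum>j\<in>(UNIV::2 set). norm A * norm v)"
      proof (rule sum_mono)
        fix j :: 2
        have "norm (A $ i $ j) \<le> norm A"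
          using Finite_Cartesian_Product.norm_nth_le[of "A $ i" j] Finite_Cartesian_Product.norm_nth_le[of A i] by linarith
        then show "norm (A $ i $ j * v $ j) \<le> norm A * norm v"
          unfolding norm_mult by (intro mult_mono Finite_Cartesian_Product.norm_nth_le) auto
      qed
      finally show "norm ((A *v v) $ i) \<le> (\<Sum>j\<in>(UNIV::2 set). norm A * norm v)" .
    qed
    finally show ?thesis by simp
  qed
  then show "norm (Mat2 A) \<le> norm A * 4"
    unfolding norm_mat2_def by (intro onorm_bound) (auto simp: mult.commute)
qed (simp_all add: mat2_eqI)

instance mat2 :: banach
proof
  fix X :: "nat \<Rightarrow> mat2"
  assume "Cauchy X"
  then have "Cauchy (\<lambda>n. of_mat2 (X n))"
    by (rule bounded_linear.Cauchy[OF bounded_linear_of_mat2])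
  then obtain L where "(\<lambda>n. of_mat2 (X n)) \<longlonglongrightarrow> L"
    using Cauchy_convergent_iff convergent_def by blast
  then have "(\<lambda>n. Mat2 (of_mat2 (X n))) \<longlonglongrightarrow> Mat2 L"
    by (rule bounded_linear.tendsto[OF bounded_linear_Mat2])
  then show "convergent X"
    unfolding convergent_def by auto
qed

definition mpow :: "cmat \<Rightarrow> nat \<Rightarrow> cmat" where
  "mpow A k = ((**) A ^^ k) (mat 1)"

lemma of_mat2_power: "of_mat2 (a ^ k) = mpow (of_mat2 a) k"
  by (induction k) (simp_all add: mpow_def)

lemma mpow_0 [simp]: "mpow A 0 = mat 1"
  by (simp add: mpow_def)

lemma mpow_Suc: "mpow A (Suc k) = mpow A k ** A"
  using of_mat2_power[of "Mat2 A" "Suc k"] of_mat2_power[of "Mat2 A" k]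
  by (simp add: power_Suc2 del: power_Suc)

text \<open>
  Transports the functional equation, the derivative and the product formula to matrices.
\<close>

lemma matrix_exp_conv: "matrix_exp A = of_mat2 (exp (Mat2 A))"
proof -
  have "of_mat2 (exp (Mat2 A)) = (\<Sum>k. of_mat2 (Mat2 A ^ k /\<^sub>R fact k))"
    unfolding exp_def
    by (rule bounded_linear.suminf[OF bounded_linear_of_mat2])
      (rule summable_exp_generic)
  moreover have "of_mat2 (Mat2 A ^ k /\<^sub>R fact k) = (1 / fact k) *\<^sub>R (((**) A ^^ k) (mat 1))" for k
    by (simp add: of_mat2_power mpow_def inverse_eq_divide)
  ultimately show ?thesis
    by (simp add: matrix_exp_def)
qed

lemma norm_power_minus_power_le:
  fixes x y :: "'a::real_normed_algebra_1"
  assumes "norm x \<le> K" "norm y \<le> K" "1 \<le> K"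
  shows "norm (x ^ n - y ^ n) \<le> n * K ^ n * norm (x - y)"
proof (induction n)
  case (Suc n)
  have "x ^ Suc n - y ^ Suc n = x * (x ^ n - y ^ n) + (x - y) * y ^ n"
    by (simp add: algebra_simps)
  then have "norm (x ^ Suc n - y ^ Suc n) \<le> norm x * norm (x ^ n - y ^ n) + norm (x - y) * norm (y ^ n)"
    by (metis norm_triangle_le add_mono norm_mult_ineq)
  also have "\<dots> \<le> K * (n * K ^ n * norm (x - y)) + norm (x - y) * K ^ Suc n"
  proof (intro add_mono mult_mono)
    have "norm (y ^ n) \<le> norm y ^ n"
      by (rule norm_power_ineq)
    also have "\<dots> \<le> K ^ n"
      using assms by (intro power_mono) auto
    also have "\<dots> \<le> K ^ Suc n"
      using assms by (intro power_increasing) auto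
    finally show "norm (y ^ n) \<le> K ^ Suc n" .
  qed (use assms Suc in auto)
  also have "\<dots> = Suc n * K ^ Suc n * norm (x - y)"
    by (simp add: algebra_simps)
  finally show ?case .
qed simp

lemma exp_power_eq_exp_scaleR:
  fixes x :: "'a::{real_normed_algebra_1,banach}"
  shows "exp x ^ n = exp (real n *\<^sub>R x)"
proof (induction n)
  case (Suc n)
  have "exp (x + real n *\<^sub>R x) = exp x * exp (real n *\<^sub>R x)"
    by (rule exp_add_commuting) simp
  with Suc show ?case
    by (simp add: scaleR_add_left)
qed simp

text \<open>
  The two factors agree with the exponential of the sum to first order, so the error of one step
  is \<open>o(1/n)\<close>, and \<open>n\<close> steps accumulate only \<open>o(1)\<close>.
\<close>

lemma trotter_product_formula:
  fixes a b :: "'a::{real_normed_algebra_1,banach}"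
  shows "(\<lambda>n. (exp (a /\<^sub>R real n) * exp (b /\<^sub>R real n)) ^ n) \<longlonglongrightarrow> exp (a + b)"
proof -
  define c where "c = norm a + norm b"
  define x where "x n = exp (a /\<^sub>R real n) * exp (b /\<^sub>R real n)" for n
  define y where "y n = exp ((a + b) /\<^sub>R real n)" for n
  have c0: "c \<ge> 0" by (simp add: c_def)
  have yn: "y n ^ n = exp (a + b)" if "n > 0" for n
  proof -
    have "exp ((a + b) /\<^sub>R real n) ^ n = exp (real n *\<^sub>R ((a + b) /\<^sub>R real n))"
      by (rule exp_power_eq_exp_scaleR)
    then show ?thesis using that by (simp add: y_def)
  qed
  have "((\<lambda>h. exp (h *\<^sub>R a) * exp (h *\<^sub>R b) - exp (h *\<^sub>R (a + b))) has_vector_derivative 0) (at 0)"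
    by (auto intro!: derivative_eq_intros exp_scaleR_has_vector_derivative_right)
  then have "((\<lambda>h. norm (exp (h *\<^sub>R a) * exp (h *\<^sub>R b) - exp (h *\<^sub>R (a + b))) / norm h) \<longlongrightarrow> 0) (at 0)"
    unfolding has_vector_derivative_def has_derivative_at by simp
  moreover have "filterlim (\<lambda>n. inverse (real n)) (at 0) sequentially"
    unfolding filterlim_at
    by (auto intro!: tendsto_inverse_0_at_top filterlim_real_sequentially eventually_sequentiallyI[of 1])
  ultimately have "(\<lambda>n. norm (x n - y n) / norm (inverse (real n))) \<longlonglongrightarrow> 0"
    unfolding x_def y_def by (rule filterlim_compose)
  then have lim: "(\<lambda>n. exp c * (norm (x n - y n) / norm (inverse (real n)))) \<longlonglongrightarrow> 0"
    by (rule tendsto_mult_right_zero)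
  have "norm (x n ^ n - y n ^ n) \<le> exp c * (norm (x n - y n) / norm (inverse (real n)))" if "n > 0" for n
  proof -
    have "norm (x n) \<le> norm (exp (a /\<^sub>R real n)) * norm (exp (b /\<^sub>R real n))"
      unfolding x_def by (rule norm_mult_ineq)
    also have "\<dots> \<le> exp (norm (a /\<^sub>R real n)) * exp (norm (b /\<^sub>R real n))"
      by (intro mult_mono norm_exp) auto
    also have "\<dots> = exp (c / n)"
      by (simp add: c_def inverse_eq_divide add_divide_distrib flip: exp_add)
    finally have 1: "norm (x n) \<le> exp (c / n)" .
    have "norm ((a + b) /\<^sub>R real n) \<le> c / n"
      using norm_triangle_ineq[of a b] by (simp add: c_def divide_simps)
    then have 2: "norm (y n) \<le> exp (c / n)"
      unfolding y_def by (meson exp_le_cancel_iff norm_exp order_trans)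
    have "norm (x n ^ n - y n ^ n) \<le> n * exp (c / n) ^ n * norm (x n - y n)"
      by (rule norm_power_minus_power_le[OF 1 2]) (use c0 in simp)
    also have "exp (c / n) ^ n = exp c"
      using that by (simp flip: exp_of_nat_mult)
    finally show ?thesis
      by (simp add: field_simps)
  qed
  then have "(\<lambda>n. x n ^ n - y n ^ n) \<longlonglongrightarrow> 0"
    by (intro Lim_null_comparison[OF _ lim] eventually_sequentiallyI[of 1]) auto
  then have "(\<lambda>n. x n ^ n - exp (a + b)) \<longlonglongrightarrow> 0"
    by (rule Lim_transform_eventually) (use yn in \<open>auto intro!: eventually_sequentiallyI[of 1]\<close>)
  then show ?thesis
    unfolding x_def by (rule Lim_null[THEN iffD2])
qed

lemma norm_exp_minus_one_le:
  fixes x :: "'a::{real_normed_algebra_1,banach}"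
  shows "norm (exp x - 1) \<le> exp (norm x) - 1"
proof -
  have le: "norm (inverse (fact (Suc n)) *\<^sub>R x ^ Suc n) \<le> inverse (fact (Suc n)) *\<^sub>R norm x ^ Suc n" for n
    using norm_power_ineq[of x "Suc n"] by (simp add: mult_left_mono)
  have s: "summable (\<lambda>n. inverse (fact (Suc n)) *\<^sub>R norm x ^ Suc n)"
    using summable_exp_generic[of "norm x"] by (subst summable_Suc_iff) simp
  have "norm (\<Sum>n. inverse (fact (Suc n)) *\<^sub>R x ^ Suc n) \<le> (\<Sum>n. inverse (fact (Suc n)) *\<^sub>R norm x ^ Suc n)"
    by (rule norm_suminf_le[OF le s])
  then show ?thesis
    using exp_first_term[of x] exp_first_term[of "norm x"] by simp
qed

text \<open>
  An estimate of this form passes to products, with the exponents adding up. Therefore it controls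
  all powers that occur in the product formula uniformly.
\<close>

lemma norm_mult_minus_one_le:
  fixes x y :: "'a::real_normed_algebra_1"
  assumes "norm (x - 1) \<le> exp s - 1" "norm (y - 1) \<le> exp t - 1"
  shows "norm (x * y - 1) \<le> exp (s + t) - 1"
proof -
  have "x * y - 1 = (x - 1) * (y - 1) + ((x - 1) + (y - 1))"
    by (simp add: algebra_simps)
  then have "norm (x * y - 1) \<le> norm (x - 1) * norm (y - 1) + (norm (x - 1) + norm (y - 1))"
    by (metis norm_triangle_le add_mono norm_mult_ineq norm_triangle_ineq)
  also have "\<dots> \<le> (exp s - 1) * (exp t - 1) + ((exp s - 1) + (exp t - 1))"
    using assms norm_ge_zero[of "x - 1"] order_trans[OF norm_ge_zero assms(1)]
    by (intro add_mono mult_mono) auto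
  also have "\<dots> = exp (s + t) - 1"
    by (simp add: exp_add algebra_simps)
  finally show ?thesis .
qed

lemma norm_power_minus_one_le:
  fixes x :: "'a::real_normed_algebra_1"
  assumes "norm (x - 1) \<le> exp s - 1"
  shows "norm (x ^ k - 1) \<le> exp (k * s) - 1"
proof (induction k)
  case (Suc k)
  then show ?case
    using norm_mult_minus_one_le[OF assms Suc] by (simp add: algebra_simps)
qed simp

lemma scaleC_cmat_entry [simp]: "(c *\<^sub>C (A :: cmat)) $ i $ j = c * A $ i $ j"
  by (simp add: scaleC_vec_def scaleC_complex_def)

lemma scaleR_cmat_conv: "r *\<^sub>R (A :: cmat) = complex_of_real r *\<^sub>C A"
  by (rule cmat_eqI) (simp_all add: scaleR_conv_of_real[where 'a = complex])

lemma cmat_mult_linear: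
  "(A :: cmat) ** (c *\<^sub>C B) = c *\<^sub>C (A ** B)" "(c *\<^sub>C B) ** (A :: cmat) = c *\<^sub>C (B ** A)"
  "A ** (B + C) = A ** B + A ** C" "(B + C) ** A = B ** A + C ** A"
  "A ** (B - C) = A ** B - A ** C" "(B - C) ** A = B ** A - C ** A"
  by (rule cmat_eqI; simp add: algebra_simps)+

lemma mat_entry: "(mat c :: cmat) $ i $ j = (if i = j then c else 0)"
  by (simp add: mat_def)

lemma mat2_scaleR: "Mat2 (r *\<^sub>R A) = r *\<^sub>R Mat2 A" and mat2_add: "Mat2 (A + B) = Mat2 A + Mat2 B"
  and mat2_mult: "Mat2 (A ** B) = Mat2 A * Mat2 B"
  by (simp_all add: mat2_eqI)

lemma matrix_exp_0 [simp]: "matrix_exp 0 = mat 1"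
  by (simp add: matrix_exp_conv flip: zero_mat2_def)

lemma matrix_exp_add_scaleR:
  "matrix_exp ((s + t) *\<^sub>R A) = matrix_exp (s *\<^sub>R A) ** matrix_exp (t *\<^sub>R A)"
proof -
  have "exp ((s + t) *\<^sub>R Mat2 A) = exp (s *\<^sub>R Mat2 A) * exp (t *\<^sub>R Mat2 A)"
    unfolding scaleR_add_left by (rule exp_add_commuting) (simp add: mult.commute)
  then show ?thesis
    by (simp add: matrix_exp_conv mat2_scaleR)
qed

lemma matrix_exp_has_vector_derivative:
  "((\<lambda>t. matrix_exp (t *\<^sub>R A)) has_vector_derivative matrix_exp (t *\<^sub>R A) ** A) (at t)"
proof -
  have "((\<lambda>t. of_mat2 (exp (t *\<^sub>R Mat2 A))) has_vector_derivative of_mat2 (exp (t *\<^sub>R Mat2 A) * Mat2 A)) (at t)"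
    by (intro bounded_linear.has_vector_derivative[OF bounded_linear_of_mat2]
        exp_scaleR_has_vector_derivative_right)
  then show ?thesis
    by (simp add: matrix_exp_conv mat2_scaleR)
qed

lemma matrix_exp_derivative_0:
  "((\<lambda>t. matrix_exp (t *\<^sub>R A)) has_vector_derivative A) (at 0)"
  using matrix_exp_has_vector_derivative[of A 0] by simp

lemma continuous_matrix_exp: "continuous_on UNIV (\<lambda>t. matrix_exp (t *\<^sub>R A))"
  by (intro continuous_at_imp_continuous_on ballI has_vector_derivative_continuous[OF
      matrix_exp_has_vector_derivative])

lemma matrix_exp_scaleR_inj:
  assumes "\<And>t. matrix_exp (t *\<^sub>R A) = matrix_exp (t *\<^sub>R B)"
  shows "A = B"
  using matrix_exp_derivative_0[of A] matrix_exp_derivative_0[of B]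
  unfolding assms by (rule vector_derivative_unique_at)

lemma matrix_exp_conjugate:
  assumes "g' ** g = mat 1"
  shows "g ** matrix_exp A ** g' = matrix_exp (g ** A ** g')"
proof -
  define u v a where "u = Mat2 g" and "v = Mat2 g'" and "a = Mat2 A"
  have vu: "v * u = 1"
    by (simp add: u_def v_def assms mat2_eqI)
  have uv: "u * v = 1"
    by (rule mat2_eqI) (use assms matrix_left_right_inverse in \<open>auto simp: u_def v_def\<close>)
  have pow: "(u * a * v) ^ k = u * a ^ k * v" for k
  proof (induction k)
    case (Suc k)
    have "v * (u * w) = w" for w
      by (simp add: vu flip: mult.assoc)
    with Suc show ?case
      by (simp add: mult.assoc)
  qed (simp add: uv)
  have "(\<lambda>k. u * (a ^ k /\<^sub>R fact k) * v) sums (u * exp a * v)"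
    by (intro sums_mult sums_mult2 exp_converges)
  then have "(\<lambda>k. (u * a * v) ^ k /\<^sub>R fact k) sums (u * exp a * v)"
    by (simp add: pow)
  then have "u * exp a * v = exp (u * a * v)"
    using exp_converges sums_unique2 by blast
  then have "of_mat2 (u * exp a * v) = of_mat2 (exp (u * a * v))"
    by simp
  then show ?thesis
    by (simp add: matrix_exp_conv mat2_mult u_def v_def a_def)
qed

text \<open>
  The elements \<open>(1 \<plusminus> H) / 2\<close> are complementary idempotents, on which \<open>H\<close> acts as \<open>\<plusminus>1\<close>.
\<close>

lemma matrix_exp_involution:
  assumes "H ** H = mat 1"
  shows "matrix_exp (z *\<^sub>C H)
    = exp z *\<^sub>C (1/2) *\<^sub>C (mat 1 + H) + exp (- z) *\<^sub>C (1/2) *\<^sub>C (mat 1 - H)"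
proof -
  define P Q where "P = (1/2) *\<^sub>C (mat 1 + H)" and "Q = (1/2) *\<^sub>C (mat 1 - H)"
  have H: "H ** mat 1 = H" "mat 1 ** H = H" by simp_all
  have e: "(z *\<^sub>C H) ** (c *\<^sub>C P + d *\<^sub>C Q) = (z * c) *\<^sub>C P + (- z * d) *\<^sub>C Q" for c d
  proof -
    have "H ** P = P" "H ** Q = - Q"
      using assms by (auto intro!: cmat_eqI simp: P_def Q_def cmat_mult_linear field_simps)
    moreover have "(z *\<^sub>C H) ** (c *\<^sub>C P + d *\<^sub>C Q) = (z * c) *\<^sub>C (H ** P) + (z * d) *\<^sub>C (H ** Q)"
      by (rule cmat_eqI) (simp_all add: algebra_simps)
    ultimately show ?thesis
      by (auto intro!: cmat_eqI)
  qed
  have pow: "Mat2 (z *\<^sub>C H) ^ k = Mat2 (z ^ k *\<^sub>C P) + Mat2 ((- z) ^ k *\<^sub>C Q)" for k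
  proof (induction k)
    case 0
    show ?case
      by (rule mat2_eqI) (auto intro!: cmat_eqI simp: P_def Q_def mat_entry field_simps)
  next
    case (Suc k)
    show ?case
      by (rule mat2_eqI) (simp add: Suc e)
  qed
  have bl: "bounded_linear (\<lambda>c. Mat2 (c *\<^sub>C R))" for R
  proof (rule linear_conv_bounded_linear[THEN iffD1], rule linearI)
    show "Mat2 ((b1 + b2) *\<^sub>C R) = Mat2 (b1 *\<^sub>C R) + Mat2 (b2 *\<^sub>C R)" for b1 b2
      by (simp add: mat2_eqI scaleC_add_left)
    show "Mat2 ((r *\<^sub>R b) *\<^sub>C R) = r *\<^sub>R Mat2 (b *\<^sub>C R)" for r b
      by (rule mat2_eqI) (auto intro!: cmat_eqI simp: scaleR_conv_of_real[where 'a = complex])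
  qed
  have "(\<lambda>k. Mat2 ((z ^ k /\<^sub>R fact k) *\<^sub>C P) + Mat2 (((- z) ^ k /\<^sub>R fact k) *\<^sub>C Q))
      sums (Mat2 (exp z *\<^sub>C P) + Mat2 (exp (- z) *\<^sub>C Q))"
    by (intro sums_add bounded_linear.sums[OF bl] exp_converges)
  moreover have "Mat2 ((z ^ k /\<^sub>R fact k) *\<^sub>C P) + Mat2 (((- z) ^ k /\<^sub>R fact k) *\<^sub>C Q)
      = Mat2 (z *\<^sub>C H) ^ k /\<^sub>R fact k" for k
    unfolding pow by (rule mat2_eqI) (auto intro!: cmat_eqI simp: scaleR_conv_of_real[where 'a = complex] algebra_simps)
  ultimately have "(\<lambda>k. Mat2 (z *\<^sub>C H) ^ k /\<^sub>R fact k) sums (Mat2 (exp z *\<^sub>C P) + Mat2 (exp (- z) *\<^sub>C Q))"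
    by simp
  then have "exp (Mat2 (z *\<^sub>C H)) = Mat2 (exp z *\<^sub>C P) + Mat2 (exp (- z) *\<^sub>C Q)"
    using exp_converges sums_unique2 by blast
  then show ?thesis
    by (simp add: matrix_exp_conv P_def Q_def)
qed

lemma matrix_exp_trotter:
  "(\<lambda>n. mpow (matrix_exp (A /\<^sub>R real n) ** matrix_exp (B /\<^sub>R real n)) n) \<longlonglongrightarrow> matrix_exp (A + B)"
  using bounded_linear.tendsto[OF bounded_linear_of_mat2 trotter_product_formula[of "Mat2 A" "Mat2 B"]]
  by (simp add: matrix_exp_conv of_mat2_power mat2_add mat2_scaleR)

text \<open>
  A product of at most \<open>n\<close> factors, each within \<open>exp (c\<bar>t\<bar> / n) - 1\<close> of the identity, is within
  \<open>exp (c\<bar>t\<bar>) - 1\<close> of it.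
\<close>

lemma trotter_partial_products_near_one:
  assumes "0 < e"
  obtains d where "0 < d" and "\<And>t n k. \<bar>t\<bar> < d \<Longrightarrow> k \<le> n \<Longrightarrow>
    dist (mpow (matrix_exp ((t / real n) *\<^sub>R A) ** matrix_exp ((t / real n) *\<^sub>R B)) k) (mat 1) < e"
proof -
  define c where "c = norm (Mat2 A) + norm (Mat2 B)"
  obtain K where "K > 0" and K: "\<And>x. norm (of_mat2 x) \<le> norm x * K"
    using bounded_linear.pos_bounded[OF bounded_linear_of_mat2] by blast
  have "((\<lambda>t. (exp (\<bar>t\<bar> * c) - 1) * K) \<longlongrightarrow> (exp (\<bar>0\<bar> * c) - 1) * K) (at 0)"
    by (intro tendsto_intros)
  then have "\<forall>\<^sub>F t in at 0. (exp (\<bar>t\<bar> * c) - 1) * K < e"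
    using assms by (intro order_tendstoD(2)) simp_all
  then obtain d where "d > 0" and d: "\<And>t. t \<noteq> 0 \<Longrightarrow> \<bar>t\<bar> < d \<Longrightarrow> (exp (\<bar>t\<bar> * c) - 1) * K < e"
    unfolding eventually_at by auto
  have "dist (mpow (matrix_exp ((t / real n) *\<^sub>R A) ** matrix_exp ((t / real n) *\<^sub>R B)) k) (mat 1) < e"
    if "\<bar>t\<bar> < d" "k \<le> n" for t n k
  proof -
    define x where "x = exp ((t / real n) *\<^sub>R Mat2 A) * exp ((t / real n) *\<^sub>R Mat2 B)"
    have "norm (x - 1) \<le> exp (norm ((t / real n) *\<^sub>R Mat2 A) + norm ((t / real n) *\<^sub>R Mat2 B)) - 1"
      unfolding x_def by (intro norm_mult_minus_one_le norm_exp_minus_one_le)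
    also have "norm ((t / real n) *\<^sub>R Mat2 A) + norm ((t / real n) *\<^sub>R Mat2 B) = \<bar>t\<bar> / n * c"
      by (simp add: c_def algebra_simps)
    finally have "norm (x ^ k - 1) \<le> exp (k * (\<bar>t\<bar> / n * c)) - 1"
      by (rule norm_power_minus_one_le)
    also have "k * (\<bar>t\<bar> / n * c) \<le> \<bar>t\<bar> * c"
    proof (cases "n = 0")
      case False
      have "real k * (\<bar>t\<bar> * c) \<le> real n * (\<bar>t\<bar> * c)"
        using that by (intro mult_right_mono) (auto simp: c_def)
      with False show ?thesis by (simp add: field_simps)
    qed (simp add: c_def)
    finally have "norm (x ^ k - 1) \<le> exp (\<bar>t\<bar> * c) - 1" by simp
    then have "norm (of_mat2 (x ^ k - 1)) \<le> (exp (\<bar>t\<bar> * c) - 1) * K"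
      using K[of "x ^ k - 1"] \<open>K > 0\<close> by (meson less_imp_le mult_right_mono order_trans)
    also have "\<dots> < e"
      using d[of t] that assms by (cases "t = 0") auto
    finally show ?thesis
      by (simp add: dist_norm x_def of_mat2_power matrix_exp_conv mat2_scaleR)
  qed
  with \<open>d > 0\<close> show thesis by (rule that)
qed

text \<open>
  Both directions of the correspondence between trace and determinant come from this equation.
\<close>

lemma det_matrix_exp_derivative:
  "((\<lambda>t. det (matrix_exp (t *\<^sub>R A))) has_vector_derivative trace A * det (matrix_exp (t *\<^sub>R A))) (at t)"
proof -
  have e: "((\<lambda>t. matrix_exp (t *\<^sub>R A) $ i $ j) has_vector_derivative (matrix_exp (t *\<^sub>R A) ** A) $ i $ j) (at t)" for i j
    by (intro bounded_linear.has_vector_derivative[OF bounded_linear_vec_nth]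
       matrix_exp_has_vector_derivative)
  show ?thesis
    unfolding det_2
    by (rule derivative_eq_intros e refl)+ (simp add: trace_def sum_2 algebra_simps)
qed

lemma det_matrix_exp:
  assumes "trace A = 0"
  shows "det (matrix_exp A) = 1"
proof -
  obtain c where c: "\<And>t::real. det (matrix_exp (t *\<^sub>R A)) = c"
    by (rule has_vector_derivative_zero_constant[of UNIV])
      (use det_matrix_exp_derivative[of A] assms in auto)
  show ?thesis
    using c[of 1] c[of 0] by simp
qed

lemma trace_eq_0_if_det_matrix_exp:
  assumes "\<And>t. det (matrix_exp (t *\<^sub>R A)) = 1"
  shows "trace A = 0"
  using det_matrix_exp_derivative[of A 0] has_vector_derivative_const[of 1 "at (0::real)"]
  unfolding assms by (metis mult_cancel_left2 mult.right_neutral vector_derivative_unique_at)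

text \<open>
  By the Cayley-Hamilton theorem; in this form inversion is visibly continuous on the group.
\<close>

lemma SL2C_inverse:
  assumes "det (g :: cmat) = 1"
  shows "g ** (mat (trace g) - g) = mat 1" "(mat (trace g) - g) ** g = mat 1"
    "matrix_inv g = mat (trace g) - g"
proof -
  have "g $ 1 $ 1 * g $ 2 $ 2 - g $ 1 $ 2 * g $ 2 $ 1 = 1"
    using assms by (simp add: det_2)
  then show 1: "g ** (mat (trace g) - g) = mat 1" and 2: "(mat (trace g) - g) ** g = mat 1"
    by (auto intro!: cmat_eqI simp: mat_entry trace_def sum_2 algebra_simps)
  have "matrix_inv g ** g = mat 1"
    unfolding matrix_inv_def by (rule someI2[of _ "mat (trace g) - g"]) (use 1 2 in auto)
  then show "matrix_inv g = mat (trace g) - g"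
    by (metis 1 matrix_mul_assoc matrix_mul_lid matrix_mul_rid)
qed

section \<open>Triples of matrices\<close>

text \<open>The standard triple.\<close>

definition D2 :: cmat where "D2 = (\<chi> i j. if i = j then (if i = 1 then 1 else -1) else 0)"
definition X2 :: cmat where "X2 = (\<chi> i j. if i = 1 \<and> j = 2 then 1 else 0)"
definition Y2 :: cmat where "Y2 = (\<chi> i j. if i = 2 \<and> j = 1 then 1 else 0)"

lemma standard_entries [simp]:
  "D2 $ 1 $ 1 = 1" "D2 $ 1 $ 2 = 0" "D2 $ 2 $ 1 = 0" "D2 $ 2 $ 2 = -1"
  "X2 $ 1 $ 1 = 0" "X2 $ 1 $ 2 = 1" "X2 $ 2 $ 1 = 0" "X2 $ 2 $ 2 = 0"
  "Y2 $ 1 $ 1 = 0" "Y2 $ 1 $ 2 = 0" "Y2 $ 2 $ 1 = 1" "Y2 $ 2 $ 2 = 0"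
  by (simp_all add: D2_def X2_def Y2_def)

lemma cmat_mult_neg: "(- A) ** B = - (A ** B)" "A ** (- B) = - (A ** B)" for A B :: cmat
  by (rule cmat_eqI; simp)+

lemma cmat_scaleC_cancel: "c \<noteq> 0 \<Longrightarrow> c *\<^sub>C (A :: cmat) = c *\<^sub>C B \<Longrightarrow> A = B"
  by (simp add: vec_eq_iff)

lemma cmat_eq_neg_self: "A = - A \<Longrightarrow> A = (0 :: cmat)"
  by (simp add: vec_eq_iff eq_neg_iff_add_eq_0 flip: mult_2)

lemma scaleC_2_cmat: "A + A = 2 *\<^sub>C (A :: cmat)"
  by (simp add: vec_eq_iff)

text \<open>
  The bracket relations determine the associative products. As \<open>H\<close> has trace zero, \<open>H\<^sup>2\<close> is a scalar,
  so \<open>H\<close> anticommutes with \<open>X\<close> and \<open>Y\<close>, its eigenvectors under the bracket; the rest follows.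
\<close>

lemma sl2_triple_relations:
  assumes "sl2_triple H X Y"
  shows "H ** H = mat 1" "H ** X = X" "X ** H = - X" "H ** Y = - Y" "Y ** H = Y"
    "X ** X = 0" "2 *\<^sub>C (X ** Y) = mat 1 + H"
proof -
  have br: "H ** X - X ** H = 2 *\<^sub>C X" "H ** Y - Y ** H = (-2) *\<^sub>C Y" "X ** Y - Y ** X = H"
    and H0: "H \<noteq> 0" and tr: "trace H = 0"
    using assms by (auto simp: sl2_triple_def lie_bracket_def sl2C_def)
  define h where "h = H $ 1 $ 1 * H $ 1 $ 1 + H $ 1 $ 2 * H $ 2 $ 1"
  have HH: "H ** H = h *\<^sub>C mat 1"
    using tr by (auto intro!: cmat_eqI simp: trace_def sum_2 h_def mat_entry add_eq_0_iff algebra_simps)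
  have comm: "H ** H ** A = A ** H ** H" for A :: cmat
  proof -
    have "A ** H ** H = A ** (H ** H)"
      by (simp only: matrix_mul_assoc)
    then show ?thesis
      by (simp only: HH cmat_mult_linear matrix_mul_lid matrix_mul_rid)
  qed
  have anti: "H ** A = - (A ** H)" if "H ** A - A ** H = c *\<^sub>C A" "c \<noteq> 0" for A c
  proof -
    have "c *\<^sub>C (H ** A + A ** H) = H ** (c *\<^sub>C A) + (c *\<^sub>C A) ** H"
      by (simp add: cmat_mult_linear scaleC_add_right)
    also have "\<dots> = 0"
      unfolding that(1)[symmetric] by (simp add: cmat_mult_linear comm matrix_mul_assoc)
    finally have "c *\<^sub>C (H ** A + A ** H) = c *\<^sub>C 0"
      by simp
    then have "H ** A + A ** H = 0"
      by (rule cmat_scaleC_cancel[OF that(2)])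
    then show ?thesis
      by (simp add: eq_neg_iff_add_eq_0)
  qed
  show HX: "H ** X = X"
  proof (rule cmat_scaleC_cancel[of 2])
    show "2 *\<^sub>C (H ** X) = 2 *\<^sub>C X"
      using anti[OF br(1)] br(1) by (simp flip: scaleC_2_cmat)
  qed simp
  then show XH: "X ** H = - X"
    using anti[OF br(1)] by (metis add.inverse_inverse zero_neq_numeral)
  show HY: "H ** Y = - Y"
  proof (rule cmat_scaleC_cancel[of 2])
    show "2 *\<^sub>C (H ** Y) = 2 *\<^sub>C (- Y)"
      using anti[OF br(2)] br(2) by (simp flip: scaleC_2_cmat)
  qed simp
  then show YH: "Y ** H = Y"
    using anti[OF br(2)] by simp
  have "X \<noteq> 0"
  proof
    assume "X = 0"
    then have "H = 0"
      using br(3) by (simp add: vec_eq_iff forall_2)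
    with H0 show False ..
  qed
  have "h *\<^sub>C X = (H ** H) ** X"
    by (simp add: HH cmat_mult_linear)
  also have "\<dots> = X"
    by (simp add: HX flip: matrix_mul_assoc)
  finally have "h *\<^sub>C X = X" .
  then have "h = 1"
    using \<open>X \<noteq> 0\<close> by (auto simp: vec_eq_iff)
  then show HH1: "H ** H = mat 1"
    by (simp add: HH vec_eq_iff)
  have "X ** (H ** X) = X ** H ** X"
    by (simp add: matrix_mul_assoc)
  then have "X ** X = - (X ** X)"
    unfolding HX XH cmat_mult_neg .
  then show XX: "X ** X = 0"
    by (rule cmat_eq_neg_self)
  have "(mat 1 + H) ** (X ** Y - Y ** X) = mat 1 + H"
    unfolding br(3) by (simp add: cmat_mult_linear HH1)
  moreover have "(mat 1 + H) ** (X ** Y) = 2 *\<^sub>C (X ** Y)" "(mat 1 + H) ** (Y ** X) = 0"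
    using HX HY by (simp_all add: cmat_mult_linear matrix_mul_assoc scaleC_2_cmat cmat_mult_neg)
  ultimately show "2 *\<^sub>C (X ** Y) = mat 1 + H"
    by (simp only: cmat_mult_linear) simp
qed

text \<open>
  Every triple is conjugate to the standard one: the rows of \<open>P\<close> are a left eigenvector of \<open>H\<close> for
  the eigenvalue \<open>1\<close>, which \<open>1 + H\<close> provides, and its image under \<open>X\<close>.
\<close>

lemma sl2_triple_diagonalize:
  assumes "sl2_triple H X Y"
  obtains P Q where "P ** Q = mat 1" "Q ** P = mat 1"
    "P ** H = D2 ** P" "P ** X = X2 ** P" "P ** Y = Y2 ** P"
proof -
  note rel = sl2_triple_relations[OF assms]
  have "mat 1 + H \<noteq> 0"
  proof
    assume "mat 1 + H = 0"
    then have "trace (mat 1 + H) = 0"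
      by (simp add: trace_def)
    then show False
      using assms by (simp add: sl2_triple_def sl2C_def trace_def sum_2 mat_entry)
  qed
  then obtain i where i: "(mat 1 + H) $ i \<noteq> 0"
    by (auto simp: vec_eq_iff)
  define U V :: cmat where "U = (\<chi> k j. if k = 1 \<and> j = i then 1 else 0)"
    and "V = (\<chi> k j. if k = 2 \<and> j = i then 1 else 0)"
  have UV: "D2 ** U = U" "D2 ** V = - V" "X2 ** U = 0" "X2 ** V = U" "Y2 ** U = V" "Y2 ** V = 0"
    by (auto intro!: cmat_eqI simp: U_def V_def)
  define P where "P = U ** (mat 1 + H) + V ** (2 *\<^sub>C X)"
  have "(mat 1 + H) ** H = mat 1 + H" "(mat 1 + H) ** X = 2 *\<^sub>C X" "(mat 1 + H) ** Y = 0"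
    by (simp_all add: cmat_mult_linear rel scaleC_2_cmat)
  note M = this
  have PA: "P ** A = U ** ((mat 1 + H) ** A) + V ** (2 *\<^sub>C (X ** A))"
    and AP: "A ** P = (A ** U) ** (mat 1 + H) + (A ** V) ** (2 *\<^sub>C X)" for A
    unfolding P_def by (simp_all only: cmat_mult_linear matrix_mul_assoc)
  have PH: "P ** H = D2 ** P"
    unfolding PA AP UV M rel(3) by (auto intro!: cmat_eqI simp: algebra_simps)
  have PX: "P ** X = X2 ** P"
    unfolding PA AP UV M rel(6) by (auto intro!: cmat_eqI)
  have PY: "P ** Y = Y2 ** P"
    unfolding PA AP UV M rel(7) by (auto intro!: cmat_eqI)
  have "det P \<noteq> 0"
  proof
    assume "det P = 0"
    then have d: "P $ 1 $ 1 * P $ 2 $ 2 = P $ 1 $ 2 * P $ 2 $ 1"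
      by (simp add: det_2)
    have "(P ** Y) $ k $ j = (Y2 ** P) $ k $ j" for k j
      by (simp add: PY)
    from this[of 1] this[of 2] have Y: "P $ 1 $ 1 * Y $ 1 $ j + P $ 1 $ 2 * Y $ 2 $ j = 0"
      "P $ 2 $ 1 * Y $ 1 $ j + P $ 2 $ 2 * Y $ 2 $ j = P $ 1 $ j" for j
      by simp_all
    have "P $ 1 $ 1 * P $ 1 $ j = 0" "P $ 1 $ 2 * P $ 1 $ j = 0" for j
      using d Y[of j] by algebra+
    then have "P $ 1 $ 1 = 0" "P $ 1 $ 2 = 0"
      by (metis mult_eq_0_iff)+
    moreover have "P $ 1 $ j = (mat 1 + H) $ i $ j" for j
      using exhaust_2[of i] by (auto simp: P_def U_def V_def)
    ultimately have "(mat 1 + H) $ i = 0"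
      unfolding vec_eq_iff forall_2 by simp
    with i show False ..
  qed
  then have "invertible P"
    by (simp add: invertible_det_nz)
  then show thesis
    using that PH PX PY unfolding invertible_def by blast
qed

section \<open>Real forms and their Lie algebras\<close>

lemma bounded_bilinear_cmat_mult: "bounded_bilinear ((**) :: cmat \<Rightarrow> cmat \<Rightarrow> cmat)"
proof -
  have "bilinear ((**) :: cmat \<Rightarrow> cmat \<Rightarrow> cmat)"
    unfolding bilinear_def
    by (auto intro!: linearI simp: cmat_mult_linear scaleR_cmat_conv)
  then show ?thesis
    by (simp add: bilinear_conv_bounded_bilinear)
qed

lemmas continuous_on_cmat_mult [continuous_intros] =
  bounded_bilinear.continuous_on[OF bounded_bilinear_cmat_mult]

lemma continuous_on_cmat_trace [continuous_intros]:
  "continuous_on S (\<lambda>x. trace (f x :: cmat))" if "continuous_on S f"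
  unfolding trace_def by (intro continuous_intros that)

lemma continuous_on_cmat_mat [continuous_intros]:
  "continuous_on S (\<lambda>x. mat (f x) :: cmat)" if "continuous_on S f"
proof -
  have "continuous_on S (\<lambda>x. if i = j then f x else 0)" for i j :: 2
    using that by (cases "i = j") simp_all
  then show ?thesis
    unfolding mat_def by (intro continuous_on_vec_lambda)
qed

lemma difference_quotient_limit:
  fixes f :: "real \<Rightarrow> 'a::real_normed_vector"
  assumes "(f has_vector_derivative d) (at 0)"
  shows "((\<lambda>t. (1 / t) *\<^sub>R (f t - f 0)) \<longlongrightarrow> d) (at 0)"
proof -
  have lim: "((\<lambda>t. norm (f t - f 0 - t *\<^sub>R d) / norm t) \<longlongrightarrow> 0) (at 0)"
    using assms by (simp add: has_vector_derivative_def has_derivative_at)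
  have eq: "norm (f t - f 0 - t *\<^sub>R d) / norm t = norm ((1 / t) *\<^sub>R (f t - f 0) - d)" if "t \<noteq> 0" for t
  proof -
    have "(1 / t) *\<^sub>R (f t - f 0) - d = (1 / t) *\<^sub>R (f t - f 0 - t *\<^sub>R d)"
      using that by (simp add: scaleR_diff_right)
    then show ?thesis by simp
  qed
  have "((\<lambda>t. norm ((1 / t) *\<^sub>R (f t - f 0) - d)) \<longlongrightarrow> 0) (at 0)"
    by (rule Lim_transform_eventually[OF lim])
      (unfold eventually_at_filter, rule always_eventually, use eq in blast)
  then show ?thesis
    by (simp add: tendsto_norm_zero_iff Lim_null[symmetric])
qed

lemma exp_tendsto: "((\<lambda>t. matrix_exp (t *\<^sub>R A)) \<longlongrightarrow> mat 1) (at 0)"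
proof -
  have "isCont (\<lambda>t. matrix_exp (t *\<^sub>R A)) 0"
    using continuous_matrix_exp[of A] by (simp add: continuous_on_eq_continuous_at)
  then show ?thesis
    by (simp add: isCont_def)
qed

lemma exp_entry_limits:
  "((\<lambda>t. matrix_exp (t *\<^sub>R A) $ i $ j) \<longlongrightarrow> mat 1 $ i $ j) (at 0)"
  "((\<lambda>t. complex_of_real (1 / t) * (matrix_exp (t *\<^sub>R A) $ i $ j - mat 1 $ i $ j)) \<longlongrightarrow> A $ i $ j) (at 0)"
proof -
  show "((\<lambda>t. matrix_exp (t *\<^sub>R A) $ i $ j) \<longlongrightarrow> mat 1 $ i $ j) (at 0)"
    by (intro tendsto_vec_nth exp_tendsto)
  have "((\<lambda>t. ((1 / t) *\<^sub>R (matrix_exp (t *\<^sub>R A) - matrix_exp (0 *\<^sub>R A))) $ i $ j) \<longlongrightarrow> A $ i $ j) (at 0)"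
    by (intro tendsto_vec_nth difference_quotient_limit matrix_exp_derivative_0)
  then show "((\<lambda>t. complex_of_real (1 / t) * (matrix_exp (t *\<^sub>R A) $ i $ j - mat 1 $ i $ j)) \<longlongrightarrow> A $ i $ j) (at 0)"
    by (simp add: scaleR_conv_of_real[where 'a = complex])
qed

lemma Ad_exp_derivative:
  "((\<lambda>t. matrix_exp (t *\<^sub>R A) ** B ** matrix_exp ((- t) *\<^sub>R A)) has_vector_derivative lie_bracket A B) (at 0)"
proof -
  have m: "((\<lambda>t. matrix_exp ((- t) *\<^sub>R A)) has_vector_derivative - A) (at 0)"
    using matrix_exp_derivative_0[of "- A"] by simp
  have "((\<lambda>t. matrix_exp (t *\<^sub>R A) ** B ** matrix_exp ((- t) *\<^sub>R A)) has_vector_derivative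
      (mat 1 ** B) ** (- A) + (mat 1 ** 0 + A ** B) ** mat 1) (at 0)"
    using bounded_bilinear.has_vector_derivative[OF bounded_bilinear_cmat_mult
        bounded_bilinear.has_vector_derivative[OF bounded_bilinear_cmat_mult
          matrix_exp_derivative_0 has_vector_derivative_const] m]
    by simp
  then show ?thesis
    by (simp add: lie_bracket_def cmat_mult_neg)
qed

lemma trace_scaleC: "trace (c *\<^sub>C A :: cmat) = c * trace A"
  by (simp add: trace_def sum_2 distrib_left)

lemma sl2C_closed: "0 \<in> sl2C" "A \<in> sl2C \<Longrightarrow> B \<in> sl2C \<Longrightarrow> A + B \<in> sl2C"
  "A \<in> sl2C \<Longrightarrow> c *\<^sub>C A \<in> sl2C" "A \<in> sl2C \<Longrightarrow> r *\<^sub>R A \<in> sl2C"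
  by (simp_all add: sl2C_def trace_add trace_scaleC scaleR_cmat_conv) (simp add: trace_def)

lemma matrix_exp_minus: "matrix_exp ((- t) *\<^sub>R A) ** matrix_exp (t *\<^sub>R A) = mat 1"
    "matrix_exp (t *\<^sub>R A) ** matrix_exp ((- t) *\<^sub>R A) = mat 1"
  using matrix_exp_add_scaleR[of t "-t" A] matrix_exp_add_scaleR[of "-t" t A] by simp_all

lemma Ad_exp_quotient_limit:
  "((\<lambda>t. (1 / t) *\<^sub>R (matrix_exp (t *\<^sub>R A) ** B ** matrix_exp ((- t) *\<^sub>R A) - B)) \<longlongrightarrow> lie_bracket A B) (at 0)"
  using difference_quotient_limit[OF Ad_exp_derivative[of A B]] by simp

locale real_form =
  fixes G :: "cmat set"
  assumes real_form: "real_form_SL2C G"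
begin

abbreviation \<gg> where "\<gg> \<equiv> lie_algebra G"

definition antiinvolution :: "(cmat \<Rightarrow> cmat) \<times> (cmat \<Rightarrow> cmat) \<Rightarrow> bool" where
  "antiinvolution = (\<lambda>(\<sigma>, s).
     (\<forall>g\<in>SL2C. \<sigma> g \<in> SL2C \<and> \<sigma> (\<sigma> g) = g) \<and>
     (\<forall>g\<in>SL2C. \<forall>h\<in>SL2C. \<sigma> (g ** h) = \<sigma> g ** \<sigma> h) \<and>
     (\<forall>A\<in>sl2C. s A \<in> sl2C \<and> \<sigma> (matrix_exp A) = matrix_exp (s A)) \<and>
     (\<forall>A\<in>sl2C. \<forall>B\<in>sl2C. s (A + B) = s A + s B) \<and>
     (\<forall>c. \<forall>A\<in>sl2C. s (c *\<^sub>C A) = cnj c *\<^sub>C s A) \<and>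
     G = {g \<in> SL2C. \<sigma> g = g})"

text \<open>
  The definition of a real form asserts the existence of an involution of the group together with
  its differential; one such pair is fixed here.
\<close>

definition "real_structure = (SOME p. antiinvolution p)"
definition "\<sigma> = fst real_structure"
definition "rconj = snd real_structure"

lemma antiinvolution: "antiinvolution (\<sigma>, rconj)"
proof -
  have "\<exists>p. antiinvolution p"
    using real_form unfolding real_form_SL2C_def antiinvolution_def by auto
  then have "antiinvolution real_structure"
    unfolding real_structure_def by (rule someI_ex)
  then show ?thesis by (simp add: \<sigma>_def rconj_def)
qed

lemma \<sigma>_SL2C: "g \<in> SL2C \<Longrightarrow> \<sigma> g \<in> SL2C" "g \<in> SL2C \<Longrightarrow> \<sigma> (\<sigma> g) = g"
    "g \<in> SL2C \<Longrightarrow> h \<in> SL2C \<Longrightarrow> \<sigma> (g ** h) = \<sigma> g ** \<sigma> h"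
  and rconj_sl2C: "A \<in> sl2C \<Longrightarrow> rconj A \<in> sl2C"
  and \<sigma>_exp: "A \<in> sl2C \<Longrightarrow> \<sigma> (matrix_exp A) = matrix_exp (rconj A)"
  and rconj_add: "A \<in> sl2C \<Longrightarrow> B \<in> sl2C \<Longrightarrow> rconj (A + B) = rconj A + rconj B"
  and rconj_scaleC: "A \<in> sl2C \<Longrightarrow> rconj (c *\<^sub>C A) = cnj c *\<^sub>C rconj A"
  and G_iff: "g \<in> G \<longleftrightarrow> g \<in> SL2C \<and> \<sigma> g = g"
  using antiinvolution unfolding antiinvolution_def by blast+

lemma rconj_0: "rconj 0 = 0"
  using rconj_scaleC[OF sl2C_closed(1), of 0] by simp

lemma exp_SL2C: "A \<in> sl2C \<Longrightarrow> matrix_exp A \<in> SL2C"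
  by (simp add: sl2C_def SL2C_def det_matrix_exp)

lemma one_in_G: "mat 1 \<in> G"
  using \<sigma>_exp[of 0] by (simp add: G_iff SL2C_def rconj_0 sl2C_closed)

lemma mult_in_G: "g \<in> G \<Longrightarrow> h \<in> G \<Longrightarrow> g ** h \<in> G"
  by (auto simp: G_iff \<sigma>_SL2C) (simp add: SL2C_def det_mul)

lemma inv_in_G: assumes "g \<in> G" shows "matrix_inv g \<in> G"
proof -
  have g: "det g = 1" "g \<in> SL2C" "\<sigma> g = g"
    using assms by (auto simp: G_iff SL2C_def)
  define h where "h = matrix_inv g"
  have gh: "g ** h = mat 1" "h ** g = mat 1"
    using SL2C_inverse[OF g(1)] by (simp_all add: h_def)
  have "det h = 1"
    using gh(1) g(1) by (metis det_I det_mul mult_1)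
  then have h: "h \<in> SL2C"
    by (simp add: SL2C_def)
  have "g ** \<sigma> h = mat 1"
    using \<sigma>_SL2C(3)[OF g(2) h] one_in_G g(3) gh(1) by (simp add: G_iff)
  then have "\<sigma> h = h"
    by (metis gh(2) matrix_mul_assoc matrix_mul_lid matrix_mul_rid)
  with h show ?thesis
    by (simp add: G_iff h_def)
qed

text \<open>
  Differentiate \<open>\<sigma> (exp (tA)) = exp (t (rconj A))\<close> at \<open>t = 0\<close>.
\<close>

lemma lie_algebra_iff: "A \<in> \<gg> \<longleftrightarrow> A \<in> sl2C \<and> rconj A = A"
proof
  assume A: "A \<in> \<gg>"
  then have G: "matrix_exp (t *\<^sub>R A) \<in> G" for t
    by (simp add: lie_algebra_def)
  then have tr: "A \<in> sl2C"
    using trace_eq_0_if_det_matrix_exp[of A] by (auto simp: G_iff SL2C_def sl2C_def)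
  have "matrix_exp (t *\<^sub>R rconj A) = matrix_exp (t *\<^sub>R A)" for t
    using G[of t] \<sigma>_exp[OF sl2C_closed(4)[OF tr], of t] rconj_scaleC[OF tr, of "of_real t"]
    by (simp add: G_iff scaleR_cmat_conv)
  with tr show "A \<in> sl2C \<and> rconj A = A"
    using matrix_exp_scaleR_inj by blast
next
  assume A: "A \<in> sl2C \<and> rconj A = A"
  have "matrix_exp (t *\<^sub>R A) \<in> G" for t
    using A \<sigma>_exp[of "t *\<^sub>R A"] rconj_scaleC[of A "of_real t"] exp_SL2C[of "t *\<^sub>R A"]
    by (simp add: G_iff scaleR_cmat_conv sl2C_closed)
  then show "A \<in> \<gg>"
    by (simp add: lie_algebra_def)
qed

lemma rconj_rconj:
  assumes "A \<in> sl2C" shows "rconj (rconj A) = A"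
proof (rule matrix_exp_scaleR_inj)
  fix t :: real
  have "rconj (rconj (t *\<^sub>R A)) = t *\<^sub>R rconj (rconj A)"
    using assms by (simp add: scaleR_cmat_conv rconj_scaleC rconj_sl2C)
  then show "matrix_exp (t *\<^sub>R rconj (rconj A)) = matrix_exp (t *\<^sub>R A)"
    using assms by (metis \<sigma>_SL2C(2) \<sigma>_exp rconj_sl2C exp_SL2C sl2C_closed(4))
qed

lemma lie_algebra_0: "0 \<in> \<gg>"
  and lie_algebra_add: "A \<in> \<gg> \<Longrightarrow> B \<in> \<gg> \<Longrightarrow> A + B \<in> \<gg>"
  and lie_algebra_scaleR: "A \<in> \<gg> \<Longrightarrow> r *\<^sub>R A \<in> \<gg>"
  by (auto simp: lie_algebra_iff sl2C_closed rconj_0 rconj_add) (simp add: scaleR_cmat_conv rconj_scaleC)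

lemma lie_algebra_diff: "A \<in> \<gg> \<Longrightarrow> B \<in> \<gg> \<Longrightarrow> A - B \<in> \<gg>"
  using lie_algebra_add[of A "(-1) *\<^sub>R B"] lie_algebra_scaleR[of B "-1"] by simp

lemma subspace_lie_algebra: "subspace \<gg>"
  by (simp add: subspace_def lie_algebra_0 lie_algebra_add lie_algebra_scaleR)

lemma exp_in_G: "A \<in> \<gg> \<Longrightarrow> matrix_exp (t *\<^sub>R A) \<in> G"
  by (simp add: lie_algebra_def)

lemma Ad_in_lie_algebra:
  assumes "g \<in> G" "h \<in> G" "h ** g = mat 1" "A \<in> \<gg>"
  shows "g ** A ** h \<in> \<gg>"
proof -
  have "matrix_exp (t *\<^sub>R (g ** A ** h)) = g ** matrix_exp (t *\<^sub>R A) ** h" for t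
    unfolding matrix_exp_conjugate[OF assms(3)]
    by (simp add: scaleR_cmat_conv cmat_mult_linear)
  then show ?thesis
    using assms by (auto simp: lie_algebra_def mult_in_G)
qed

lemma Ad_exp_in_lie_algebra:
  assumes "A \<in> \<gg>" "B \<in> \<gg>"
  shows "matrix_exp (t *\<^sub>R A) ** B ** matrix_exp ((- t) *\<^sub>R A) \<in> \<gg>"
  by (rule Ad_in_lie_algebra) (use assms exp_in_G[of A "-t"] in \<open>auto simp: matrix_exp_minus exp_in_G simp del: scaleR_minus_left\<close>)

text \<open>
  The bracket is a limit of elements of the real subspace \<open>\<gg>\<close>, which is closed.
\<close>

lemma lie_bracket_in_lie_algebra:
  assumes "A \<in> \<gg>" "B \<in> \<gg>"
  shows "lie_bracket A B \<in> \<gg>"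
proof -
  have "\<forall>\<^sub>F t in at 0. (1 / t) *\<^sub>R (matrix_exp (t *\<^sub>R A) ** B ** matrix_exp ((- t) *\<^sub>R A) - B) \<in> \<gg>"
    using assms
    by (intro always_eventually allI lie_algebra_scaleR lie_algebra_diff Ad_exp_in_lie_algebra)
  then show ?thesis
    using Lim_in_closed_set[OF closed_subspace[OF subspace_lie_algebra] _ _ Ad_exp_quotient_limit]
    by simp
qed

lemma complex_decomposition:
  assumes "Z \<in> sl2C"
  obtains A B where "A \<in> \<gg>" "B \<in> \<gg>" "Z = A + \<i> *\<^sub>C B"
proof -
  have sl: "c *\<^sub>C Z + d *\<^sub>C rconj Z \<in> sl2C" for c d
    using assms by (simp add: sl2C_closed rconj_sl2C)
  have rc: "rconj (c *\<^sub>C Z + d *\<^sub>C rconj Z) = cnj d *\<^sub>C Z + cnj c *\<^sub>C rconj Z" for c d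
    using assms by (simp add: rconj_add rconj_scaleC sl2C_closed rconj_sl2C rconj_rconj add.commute)
  define A where "A = (1/2) *\<^sub>C Z + (1/2) *\<^sub>C rconj Z"
  define B where "B = (- \<i> / 2) *\<^sub>C Z + (\<i> / 2) *\<^sub>C rconj Z"
  have "A \<in> \<gg>" "B \<in> \<gg>"
    unfolding lie_algebra_iff A_def B_def using sl by (simp_all only: rc) auto
  moreover have "Z = A + \<i> *\<^sub>C B"
    by (auto simp: A_def B_def vec_eq_iff field_simps)
  ultimately show thesis by (rule that)
qed

lemma complex_decomposition_unique:
  assumes "A \<in> \<gg>" "B \<in> \<gg>" "A' \<in> \<gg>" "B' \<in> \<gg>" "A + \<i> *\<^sub>C B = A' + \<i> *\<^sub>C B'"
  shows "A = A'" "B = B'"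
proof -
  have "rconj (A + \<i> *\<^sub>C B) = rconj (A' + \<i> *\<^sub>C B')"
    by (simp add: assms)
  then have "A + (- \<i>) *\<^sub>C B = A' + (- \<i>) *\<^sub>C B'"
    using assms(1-4) by (simp add: lie_algebra_iff rconj_add rconj_scaleC sl2C_closed)
  note minus = this
  have double: "(C + \<i> *\<^sub>C D) + (C + (- \<i>) *\<^sub>C D) = 2 *\<^sub>C C" for C D :: cmat
    by (simp add: vec_eq_iff)
  have "2 *\<^sub>C A = 2 *\<^sub>C A'"
    using double[of A B] double[of A' B'] unfolding assms(5) minus by simp
  then show A: "A = A'"
    by (rule cmat_scaleC_cancel[rotated]) simp
  show "B = B'"
    by (rule cmat_scaleC_cancel[of \<i>]) (use assms(5) A in simp_all)
qed

end

section \<open>One-parameter subgroups and their characters\<close>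

lemma D2_involution: "D2 ** D2 = mat 1"
  by (rule cmat_eqI) (simp_all add: mat_entry)

lemma exp_D2: "matrix_exp (z *\<^sub>C D2)
    = (\<chi> i j. if i = j then (if i = 1 then exp z else exp (- z)) else 0)"
  unfolding matrix_exp_involution[OF D2_involution] by (rule cmat_eqI) (simp_all add: mat_entry)

lemma exp_triple_conjugate:
  assumes "P ** Q = mat 1" "Q ** P = mat 1" "P ** H = D2 ** P"
  shows "P ** matrix_exp (z *\<^sub>C H) = matrix_exp (z *\<^sub>C D2) ** P"
proof -
  have "P ** matrix_exp (z *\<^sub>C H) ** Q = matrix_exp (P ** (z *\<^sub>C H) ** Q)"
    by (rule matrix_exp_conjugate) fact
  also have "P ** (z *\<^sub>C H) ** Q = z *\<^sub>C (D2 ** (P ** Q))"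
    using assms(3) by (simp add: cmat_mult_linear matrix_mul_assoc)
  finally show ?thesis
    using assms by (metis matrix_mul_assoc matrix_mul_rid)
qed

lemma exp_involution_trace:
  assumes "H ** H = mat 1" "trace H = 0"
  shows "trace (matrix_exp (z *\<^sub>C H) ** (mat 1 + H)) = 2 * exp z"
proof -
  have "matrix_exp (z *\<^sub>C H) ** (mat 1 + H) = exp z *\<^sub>C (mat 1 + H)"
    unfolding matrix_exp_involution[OF assms(1)]
    by (simp add: cmat_mult_linear assms(1) add.commute scaleC_2_cmat flip: scaleC_add_right)
      (simp add: vec_eq_iff)
  then show ?thesis
    using assms(2) by (simp add: trace_scaleC trace_add) (simp add: trace_def mat_entry sum_2)
qed

text \<open>
  In an eigenbasis of \<open>H\<close> the matrix \<open>g\<close> is diagonal, with entries \<open>exp z\<close> and \<open>exp (- z)\<close>.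
\<close>

lemma commutes_imp_exp:
  assumes "sl2_triple H X Y" "det g = 1" "g ** H = H ** g"
  obtains z where "g = matrix_exp (z *\<^sub>C H)"
proof -
  obtain P Q where PQ: "P ** Q = mat 1" "Q ** P = mat 1" and PH: "P ** H = D2 ** P"
    using sl2_triple_diagonalize[OF assms(1)] by metis
  define m where "m = P ** g ** Q"
  have HQ: "H ** Q = Q ** D2"
    using PQ PH by (metis matrix_mul_assoc matrix_mul_lid matrix_mul_rid)
  have "m ** D2 = P ** (g ** H) ** Q"
    unfolding m_def by (simp add: HQ flip: matrix_mul_assoc)
  also have "\<dots> = D2 ** m"
    unfolding assms(3) m_def by (simp add: PH matrix_mul_assoc)
  finally have "m ** D2 = D2 ** m" .
  then have "(m ** D2) $ 1 $ 2 = (D2 ** m) $ 1 $ 2" "(m ** D2) $ 2 $ 1 = (D2 ** m) $ 2 $ 1"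
    by simp_all
  then have off: "m $ 1 $ 2 = 0" "m $ 2 $ 1 = 0"
    by simp_all
  have "det m = det (P ** Q)"
    unfolding m_def using assms(2) by (simp add: det_mul)
  then have d: "m $ 1 $ 1 * m $ 2 $ 2 = 1"
    using off by (simp add: PQ) (simp add: det_2)
  define z where "z = Ln (m $ 1 $ 1)"
  have e: "exp z = m $ 1 $ 1"
    using d unfolding z_def by (intro exp_Ln) auto
  then have "exp (- z) = m $ 2 $ 2"
    using d e by (metis exp_minus inverse_unique)
  with e off have "m = matrix_exp (z *\<^sub>C D2)"
    unfolding exp_D2 by (intro cmat_eqI) simp_all
  then have "P ** g ** Q = P ** matrix_exp (z *\<^sub>C H) ** Q"
    unfolding m_def exp_triple_conjugate[OF PQ PH] using PQ
    by (simp flip: matrix_mul_assoc)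
  then have "g = matrix_exp (z *\<^sub>C H)"
    using PQ by (metis matrix_mul_assoc matrix_mul_lid matrix_mul_rid)
  then show thesis by (rule that)
qed

text \<open>
  The adjoint action of \<open>G'\<close> maps \<open>H\<close> to \<open>\<plusminus>H\<close>, hence to \<open>H\<close> by connectedness, so that \<open>G'\<close> lies
  in the complex torus \<open>exp (\<complex>H)\<close>. The antiholomorphic involution cuts this torus down to
  \<open>exp (\<real>cH)\<close>, possibly times \<open>\<plusminus>1\<close>, and connectedness excludes the second component.
\<close>

lemma (in real_form) connected_subgroup_one_parameter:
  assumes sub: "subgroup_of G' G" and conn: "connected G'" and tri: "sl2_triple H X Y"
    and compl: "complexification (lie_algebra G') = {c *\<^sub>C H | c. True}"
  obtains c where "c \<noteq> 0" "c *\<^sub>C H \<in> lie_algebra G'"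
    "\<forall>g\<in>G'. \<exists>t::real. g = matrix_exp ((complex_of_real t * c) *\<^sub>C H)"
proof -
  note HH = sl2_triple_relations(1)[OF tri]
  have H: "H \<in> sl2C" "H \<noteq> 0" "trace H = 0"
    using tri by (auto simp: sl2_triple_def sl2C_def)
  have G': "G' \<subseteq> G" "mat 1 \<in> G'" "\<And>g h. g \<in> G' \<Longrightarrow> h \<in> G' \<Longrightarrow> g ** h \<in> G'"
    "\<And>g. g \<in> G' \<Longrightarrow> matrix_inv g \<in> G'"
    using sub by (auto simp: subgroup_of_def)
  have lie_G': "\<exists>c. A = c *\<^sub>C H" if "A \<in> lie_algebra G'" for A
  proof -
    have "0 \<in> lie_algebra G'"
      by (simp add: lie_algebra_def G')
    moreover have "A = A + \<i> *\<^sub>C 0"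
      by simp
    ultimately have "A \<in> complexification (lie_algebra G')"
      using that unfolding complexification_def by blast
    then show ?thesis
      by (auto simp: compl)
  qed
  obtain c where c: "c \<noteq> 0" "c *\<^sub>C H \<in> lie_algebra G'"
  proof -
    have "H \<in> complexification (lie_algebra G')"
      unfolding compl using scaleC_one[of H] by (metis (mono_tags, lifting) mem_Collect_eq)
    then obtain A B where AB: "A \<in> lie_algebra G'" "B \<in> lie_algebra G'" "H = A + \<i> *\<^sub>C B"
      by (auto simp: complexification_def)
    then obtain a b where ab: "A = a *\<^sub>C H" "B = b *\<^sub>C H"
      using lie_G' by metis
    have "a \<noteq> 0 \<or> b \<noteq> 0"
      using AB(3) H(2) unfolding ab by auto
    then show thesis
      using that AB ab by metis
  qed
  have "c *\<^sub>C H \<in> \<gg>"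
    using c(2) G'(1) by (auto simp: lie_algebra_def)
  then have "cnj c *\<^sub>C rconj H = c *\<^sub>C H"
    using rconj_scaleC[OF H(1), of c] by (simp add: lie_algebra_iff)
  then have "cnj c *\<^sub>C rconj H = cnj c *\<^sub>C (c / cnj c) *\<^sub>C H"
    using c(1) by (simp add: scaleC_scaleC)
  then have rconj_H: "rconj H = (c / cnj c) *\<^sub>C H"
    by (rule cmat_scaleC_cancel[rotated]) (use c(1) in simp)
  \<comment> \<open>The factor in \<open>Ad g H = \<rho> g H\<close>, written as a polynomial in the entries of \<open>g\<close>.\<close>
  define \<rho> where "\<rho> g = trace (g ** H ** (mat (trace g) - g) ** H) / 2" for g :: cmat
  have trHH: "trace (r *\<^sub>C H ** H) = 2 * r" for r
    by (simp add: cmat_mult_linear HH trace_scaleC) (simp add: trace_def sum_2 mat_entry)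
  have Ad_H: "(\<rho> g = 1 \<or> \<rho> g = -1) \<and> g ** H ** matrix_inv g = \<rho> g *\<^sub>C H" if g: "g \<in> G'" for g
  proof -
    have "det g = 1"
      using g G'(1) by (auto simp: G_iff SL2C_def)
    note inv = SL2C_inverse[OF this]
    have ig: "matrix_inv g ** g = mat 1" "g ** matrix_inv g = mat 1"
      using inv by simp_all
    have "matrix_exp (t *\<^sub>R (g ** (c *\<^sub>C H) ** matrix_inv g))
        = g ** matrix_exp (t *\<^sub>R (c *\<^sub>C H)) ** matrix_inv g" for t
      unfolding matrix_exp_conjugate[OF ig(1)] by (simp add: scaleR_cmat_conv cmat_mult_linear)
    then have "g ** (c *\<^sub>C H) ** matrix_inv g \<in> lie_algebra G'"
      using c(2) g G' by (auto simp: lie_algebra_def)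
    then obtain r where "c *\<^sub>C (g ** H ** matrix_inv g) = r *\<^sub>C H"
      using lie_G' by (auto simp: cmat_mult_linear)
    also have "r *\<^sub>C H = c *\<^sub>C (r / c) *\<^sub>C H"
      using c(1) by (simp add: scaleC_scaleC)
    finally have Ad: "g ** H ** matrix_inv g = (r / c) *\<^sub>C H"
      by (rule cmat_scaleC_cancel[OF c(1)])
    have \<rho>: "\<rho> g = r / c"
      unfolding \<rho>_def inv(3)[symmetric] Ad trHH by simp
    have "(g ** H ** matrix_inv g) ** (g ** H ** matrix_inv g) = g ** H ** (matrix_inv g ** g) ** H ** matrix_inv g"
      by (simp only: matrix_mul_assoc)
    also have "\<dots> = g ** (H ** H) ** matrix_inv g"
      by (simp add: ig flip: matrix_mul_assoc)
    also have "\<dots> = mat 1"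
      by (simp add: HH ig)
    finally have "((r / c) * (r / c)) *\<^sub>C (mat 1 :: cmat) = mat 1"
      unfolding Ad by (simp add: cmat_mult_linear HH scaleC_scaleC)
    then have "(((r / c) * (r / c)) *\<^sub>C mat 1 :: cmat) $ 1 $ 1 = (mat 1 :: cmat) $ 1 $ 1"
      by simp
    then have "(r / c) * (r / c) = 1"
      by (simp only: scaleC_cmat_entry mat_entry) simp
    then have "\<rho> g = 1 \<or> \<rho> g = -1"
      unfolding \<rho> using square_eq_1_iff by blast
    then show ?thesis
      using Ad \<rho> by simp
  qed
  have "continuous_on G' \<rho>"
    unfolding \<rho>_def by (intro continuous_intros) auto
  moreover have "finite (\<rho> ` G')"
    by (rule finite_subset[of _ "{1, -1}"]) (use Ad_H in auto)
  ultimately have "\<rho> constant_on G'"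
    using conn by (intro continuous_finite_range_constant)
  moreover have "\<rho> (mat 1) = 1"
  proof -
    have "trace (mat 1 :: cmat) = 2"
      by (simp add: trace_def sum_2 mat_entry)
    moreover have "mat 2 - mat 1 = (mat 1 :: cmat)"
      by (rule cmat_eqI) (simp_all add: mat_entry)
    ultimately show ?thesis
      using trHH[of 1] by (simp add: \<rho>_def scaleC_one)
  qed
  ultimately have \<rho>1: "\<rho> g = 1" if "g \<in> G'" for g
    using G'(2) that by (auto simp: constant_on_def)
  have torus: "\<exists>z. g = matrix_exp (z *\<^sub>C H)" if g: "g \<in> G'" for g
  proof -
    have det: "det g = 1"
      using g G'(1) by (auto simp: G_iff SL2C_def)
    have "g ** H ** matrix_inv g = H"
      using Ad_H[OF g] \<rho>1[OF g] by (simp add: scaleC_one)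
    then have "g ** H ** (matrix_inv g ** g) = H ** g"
      by (simp add: matrix_mul_assoc)
    then have "g ** H = H ** g"
      using SL2C_inverse[OF det] by simp
    then show ?thesis
      using commutes_imp_exp[OF tri det] by metis
  qed
  \<comment> \<open>The eigenvalue of \<open>g\<close> on the \<open>1\<close>-eigenspace of \<open>H\<close>; it determines \<open>g\<close> within the torus.\<close>
  define \<phi> where "\<phi> g = trace (g ** (mat 1 + H)) / 2" for g :: cmat
  have \<phi>_exp: "\<phi> (matrix_exp (z *\<^sub>C H)) = exp z" for z
    by (simp add: \<phi>_def exp_involution_trace[OF HH H(3)])
  have eq_if: "matrix_exp (z *\<^sub>C H) = matrix_exp (w *\<^sub>C H)" if "exp z = exp w" for z w
    using that by (simp add: matrix_exp_involution[OF HH] exp_minus)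
  \<comment> \<open>Invariance under \<open>\<sigma>\<close>: \<open>exp (cnj z c / cnj c) = exp z\<close>.\<close>
  have real_point: "\<exists>n::int. c * of_real (Im (z / c)) = of_real (of_int n * pi)"
    if "matrix_exp (z *\<^sub>C H) \<in> G'" for z
  proof -
    define w where "w = z / c"
    have z: "z = c * w"
      using c(1) by (simp add: w_def)
    have "\<sigma> (matrix_exp (z *\<^sub>C H)) = matrix_exp (z *\<^sub>C H)"
      using that G'(1) by (auto simp: G_iff)
    then have "matrix_exp (cnj z *\<^sub>C (c / cnj c) *\<^sub>C H) = matrix_exp (z *\<^sub>C H)"
      using \<sigma>_exp[OF sl2C_closed(3)[OF H(1)], of z] by (simp add: rconj_scaleC H rconj_H)
    then have "exp (cnj z * (c / cnj c)) = exp z"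
      using \<phi>_exp by (metis scaleC_scaleC)
    then obtain n :: int where "z = cnj z * (c / cnj c) + of_int (2 * n) * pi * \<i>"
      by (metis exp_eq)
    then have "c * w - c * cnj w = of_int (2 * n) * pi * \<i>"
      using c(1) by (simp add: z)
    then have "c * (w - cnj w) = of_int (2 * n) * pi * \<i>"
      by (simp add: algebra_simps)
    also have "w - cnj w = 2 * \<i> * Im w"
      by (simp add: complex_eq_iff)
    finally have "c * Im w = of_int n * pi"
      by (simp add: algebra_simps)
    then show ?thesis
      unfolding w_def by (intro exI[of _ n]) simp
  qed
  have "\<exists>t::real. g = matrix_exp ((complex_of_real t * c) *\<^sub>C H)" if g: "g \<in> G'" for g
  proof (cases "Im c = 0")
    case False
    obtain z where z: "g = matrix_exp (z *\<^sub>C H)"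
      using torus[OF g] by blast
    then obtain n :: int where "c * of_real (Im (z / c)) = of_real (of_int n * pi)"
      using real_point g by metis
    then have "Im (c * of_real (Im (z / c))) = 0"
      by simp
    then have "Im (z / c) = 0"
      using False by simp
    then have "z / c = of_real (Re (z / c))"
      by (simp add: complex_eq_iff)
    then have "z = of_real (Re (z / c)) * c"
      using c(1) by (simp add: divide_eq_eq)
    then show ?thesis
      using z by metis
  next
    case True
    have real: "\<phi> h = of_real (Re (\<phi> h)) \<and> \<phi> h \<noteq> 0" if h: "h \<in> G'" for h
    proof -
      obtain z where z: "h = matrix_exp (z *\<^sub>C H)"
        using torus[OF h] by blast
      then obtain n :: int where n: "c * of_real (Im (z / c)) = of_real (of_int n * pi)"
        using real_point h by metis
      have "z = c * (of_real (Re (z / c)) + \<i> * of_real (Im (z / c)))"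
        using c(1) complex_eq[of "z / c"] by (simp add: divide_eq_eq mult.commute)
      also have "\<dots> = of_real (Re c * Re (z / c)) + \<i> * (of_int n * pi)"
        using True n by (simp add: complex_eq_iff)
      finally have "z = of_real (Re c * Re (z / c)) + \<i> * (of_int n * pi)" .
      then have "Im z = Im (of_real (Re c * Re (z / c)) + \<i> * (of_int n * pi))"
        by (rule arg_cong)
      then have "sin (Im z) = 0"
        unfolding sin_zero_iff_int2 by (intro exI[of _ n]) simp
      then have "exp z = of_real (Re (exp z))"
        by (simp add: complex_eq_iff Im_exp)
      then show ?thesis
        unfolding z \<phi>_exp using exp_not_eq_zero by blast
    qed
    have "continuous_on G' (\<lambda>h. Re (\<phi> h))"
      unfolding \<phi>_def by (intro continuous_intros) auto
    then have "connected ((\<lambda>h. Re (\<phi> h)) ` G')"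
      using conn by (rule connected_continuous_image)
    moreover have "Re (\<phi> (mat 1)) = 1"
      using \<phi>_exp[of 0] by simp
    then have "1 \<in> (\<lambda>h. Re (\<phi> h)) ` G'"
      using G'(2) by force
    moreover have "Re (\<phi> g) \<in> (\<lambda>h. Re (\<phi> h)) ` G'"
      using g by simp
    moreover have "0 \<notin> (\<lambda>h. Re (\<phi> h)) ` G'"
    proof
      assume "0 \<in> (\<lambda>h. Re (\<phi> h)) ` G'"
      then obtain h where "h \<in> G'" "Re (\<phi> h) = 0"
        by force
      then show False
        using real[of h] by simp
    qed
    ultimately have pos: "Re (\<phi> g) > 0"
      using connectedD_interval[of _ "Re (\<phi> g)" 1 0] by force
    obtain z where z: "g = matrix_exp (z *\<^sub>C H)"
      using torus[OF g] by blast
    define t where "t = ln (Re (\<phi> g)) / Re c"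
    have c_real: "c = of_real (Re c)"
      using True by (simp add: complex_eq_iff)
    then have "Re c \<noteq> 0"
      using c(1) by auto
    have "complex_of_real t * c = of_real (ln (Re (\<phi> g)))"
      using \<open>Re c \<noteq> 0\<close> by (subst c_real) (simp add: t_def)
    then have "exp (complex_of_real t * c) = exp z"
      using real[OF g] pos \<phi>_exp[of z] by (simp add: z exp_of_real)
    then have "g = matrix_exp ((complex_of_real t * c) *\<^sub>C H)"
      unfolding z by (intro eq_if) simp
    then show ?thesis ..
  qed
  then show thesis
    by (intro that[OF c]) blast
qed

text \<open>Along the one-parameter group the character solves \<open>f' = \<nu>cf\<close>.\<close>

lemma character_one_parameter:
  assumes ch: "is_character G' H \<nu> \<psi>" and cH: "c *\<^sub>C H \<in> lie_algebra G'"
  shows "\<psi> (matrix_exp ((complex_of_real t * c) *\<^sub>C H)) = exp (of_real t * (\<nu> * c))"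
proof -
  define f where "f s = \<psi> (matrix_exp (s *\<^sub>R (c *\<^sub>C H)))" for s :: real
  have mem: "matrix_exp (s *\<^sub>R (c *\<^sub>C H)) \<in> G'" for s :: real
    using cH by (simp add: lie_algebra_def)
  have add: "f (s + t) = f s * f t" for s t
    using ch mem unfolding f_def matrix_exp_add_scaleR by (simp add: is_character_def)
  have "f 0 \<noteq> 0"
    using ch mem[of 0] unfolding f_def by (simp add: is_character_def)
  then have f0: "f 0 = 1"
    using add[of 0 0] by simp
  have d0: "(f has_vector_derivative \<nu> * c) (at 0)"
    using ch cH unfolding f_def[abs_def] by (simp add: is_character_def)
  have d: "(f has_vector_derivative f s * (\<nu> * c)) (at s)" for s
  proof -
    have "((\<lambda>u. f (u - s)) has_vector_derivative \<nu> * c) (at s)"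
    proof -
      have "((\<lambda>u. u - s) has_vector_derivative 1) (at s)"
        by (auto intro!: derivative_eq_intros)
      then show ?thesis
        using vector_diff_chain_at[of "\<lambda>u. u - s" 1 s f "\<nu> * c"] d0 by (simp add: o_def)
    qed
    then have "((\<lambda>u. f s * f (u - s)) has_vector_derivative f s * (\<nu> * c)) (at s)"
      by (rule has_vector_derivative_mult_right)
    then show ?thesis
      by (simp flip: add)
  qed
  have e: "((\<lambda>u. exp (of_real u * - (\<nu> * c))) has_vector_derivative exp (of_real s * - (\<nu> * c)) * - (\<nu> * c)) (at s)" for s :: real
    by (rule has_vector_derivative_real_field) (auto intro!: derivative_eq_intros)
  obtain k where k: "\<And>s. f s * exp (of_real s * - (\<nu> * c)) = k"
  proof (rule has_vector_derivative_zero_constant[of UNIV "\<lambda>s. f s * exp (of_real s * - (\<nu> * c))"])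
    fix s :: real
    have "((\<lambda>s. f s * exp (of_real s * - (\<nu> * c))) has_vector_derivative
       f s * (exp (of_real s * - (\<nu> * c)) * - (\<nu> * c)) + f s * (\<nu> * c) * exp (of_real s * - (\<nu> * c))) (at s)"
      by (rule has_vector_derivative_mult[OF d e])
    then show "((\<lambda>s. f s * exp (of_real s * - (\<nu> * c))) has_vector_derivative 0) (at s within UNIV)"
      by (simp add: algebra_simps)
  qed auto
  have "k = 1"
    using k[of 0] by (simp add: f0)
  then have "f t = exp (of_real t * (\<nu> * c))"
    using k[of t] by (simp add: exp_minus field_simps)
  then show ?thesis
    by (simp add: f_def scaleR_cmat_conv scaleC_scaleC)
qed

section \<open>Limits in Frechet spaces\<close>

lemma limitin_filterlim:
  assumes "limitin T f l F" "filterlim h F F'"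
  shows "limitin T (\<lambda>x. f (h x)) l F'"
  using assms unfolding limitin_def filterlim_iff by blast

locale frechet =
  fixes T :: "'v::complex_vector topology"
  assumes frechet: "frechet_space T"
begin

abbreviation "V \<equiv> topspace T"

definition defining_seminorms :: "(nat \<Rightarrow> 'v \<Rightarrow> real) \<Rightarrow> bool" where
  "defining_seminorms p \<longleftrightarrow> (\<forall>n. seminorm_on V (p n)) \<and>
     (\<forall>x\<in>V. (\<forall>n. p n x = 0) \<longrightarrow> x = 0) \<and>
     (\<forall>U. openin T U \<longleftrightarrow> U \<subseteq> V \<and>
        (\<forall>x\<in>U. \<exists>N. \<exists>e>0. \<forall>y\<in>V. (\<forall>n\<le>N. p n (y - x) < e) \<longrightarrow> y \<in> U))"

text \<open>
  The topology determines the seminorms only up to equivalence; one defining sequence is fixed here.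
\<close>

definition "p = (SOME p. defining_seminorms p)"

lemma defining_seminorms: "defining_seminorms p"
proof -
  have "\<exists>p. defining_seminorms p"
    using frechet[unfolded frechet_space_def, THEN conjunct2] unfolding defining_seminorms_def
    by (rule ex_forward) (elim conjE, intro conjI; assumption)
  then show ?thesis
    unfolding p_def by (rule someI_ex)
qed

lemma subspace_V: "complex_vector.subspace V"
  using frechet by (simp add: frechet_space_def)

lemma V_simps [simp]:
  "0 \<in> V" "x \<in> V \<Longrightarrow> y \<in> V \<Longrightarrow> x + y \<in> V" "x \<in> V \<Longrightarrow> y \<in> V \<Longrightarrow> x - y \<in> V"
  "x \<in> V \<Longrightarrow> c *\<^sub>C x \<in> V" "x \<in> V \<Longrightarrow> - x \<in> V"
  using subspace_V
  by (auto simp: complex_vector.subspace_0 complex_vector.subspace_add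
      complex_vector.subspace_diff complex_vector.subspace_scale complex_vector.subspace_neg)

lemma seminorm_p: "seminorm_on V (p n)"
  and p_separating: "x \<in> V \<Longrightarrow> (\<And>n. p n x = 0) \<Longrightarrow> x = 0"
  using defining_seminorms by (simp_all add: defining_seminorms_def)

lemma openin_iff: "openin T U \<longleftrightarrow> U \<subseteq> V \<and>
    (\<forall>x\<in>U. \<exists>N. \<exists>e>0. \<forall>y\<in>V. (\<forall>n\<le>N. p n (y - x) < e) \<longrightarrow> y \<in> U)"
  by (rule defining_seminorms[unfolded defining_seminorms_def, THEN conjunct2, THEN conjunct2, THEN spec])

lemma p_nonneg [simp]: "x \<in> V \<Longrightarrow> 0 \<le> p n x"
  and p_triangle: "x \<in> V \<Longrightarrow> y \<in> V \<Longrightarrow> p n (x + y) \<le> p n x + p n y"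
  and p_scale: "x \<in> V \<Longrightarrow> p n (c *\<^sub>C x) = cmod c * p n x"
  using seminorm_p[of n] by (simp_all add: seminorm_on_def)

lemma p_0 [simp]: "p n 0 = 0"
  using p_scale[of 0 n 0] by simp

lemma p_minus_commute: "x \<in> V \<Longrightarrow> y \<in> V \<Longrightarrow> p n (x - y) = p n (y - x)"
  using p_scale[of "x - y" n "-1"] by simp

lemma openin_ball:
  assumes "l \<in> V" "0 < e"
  shows "openin T {y \<in> V. p n (y - l) < e}"
  unfolding openin_iff
proof (intro conjI ballI)
  fix x
  assume x: "x \<in> {y \<in> V. p n (y - l) < e}"
  have "y \<in> {y \<in> V. p n (y - l) < e}"
    if "y \<in> V" "\<forall>k\<le>n. p k (y - x) < e - p n (x - l)" for y
  proof -
    have "p n (y - l) \<le> p n (y - x) + p n (x - l)"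
      using p_triangle[of "y - x" "x - l" n] that x assms by simp
    also have "\<dots> < e"
      using that by fastforce
    finally show ?thesis using that by simp
  qed
  then show "\<exists>N. \<exists>d>0. \<forall>y\<in>V. (\<forall>k\<le>N. p k (y - x) < d) \<longrightarrow> y \<in> {y \<in> V. p n (y - l) < e}"
    using x by (intro exI[of _ n] exI[of _ "e - p n (x - l)"]) auto
qed auto

lemma limitin_iff:
  "limitin T f l F \<longleftrightarrow> l \<in> V \<and> (\<forall>\<^sub>F x in F. f x \<in> V) \<and> (\<forall>n. ((\<lambda>x. p n (f x - l)) \<longlongrightarrow> 0) F)"
  (is "?L \<longleftrightarrow> ?R")
proof
  assume L: ?L
  then have l: "l \<in> V" by (rule limitin_topspace)
  have V: "\<forall>\<^sub>F x in F. f x \<in> V"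
    using limitinD[OF L openin_topspace l] .
  have "((\<lambda>x. p n (f x - l)) \<longlongrightarrow> 0) F" for n
  proof (rule tendstoI)
    fix e :: real
    assume "e > 0"
    then have "\<forall>\<^sub>F x in F. f x \<in> {y \<in> V. p n (y - l) < e}"
      using L l by (intro limitinD[OF L openin_ball]) auto
    then show "\<forall>\<^sub>F x in F. dist (p n (f x - l)) 0 < e"
      by eventually_elim (use l in auto)
  qed
  with l V show ?R by blast
next
  assume R: ?R
  show ?L
    unfolding limitin_def
  proof (intro conjI allI impI)
    fix U
    assume U: "openin T U \<and> l \<in> U"
    then obtain N e where e: "e > 0" "\<And>y. y \<in> V \<Longrightarrow> (\<forall>n\<le>N. p n (y - l) < e) \<Longrightarrow> y \<in> U"
      unfolding openin_iff by blast
    have "\<forall>\<^sub>F x in F. p n (f x - l) < e" for n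
      using R e(1) by (intro order_tendstoD(2)[of _ 0]) auto
    then have "\<forall>\<^sub>F x in F. \<forall>n\<in>{..N}. p n (f x - l) < e"
      by (intro eventually_ball_finite) auto
    moreover have "\<forall>\<^sub>F x in F. f x \<in> V"
      using R by blast
    ultimately show "\<forall>\<^sub>F x in F. f x \<in> U"
      by eventually_elim (use e in auto)
  qed (use R in blast)
qed

lemma limit_unique:
  assumes "limitin T f l F" "limitin T f m F" "F \<noteq> bot"
  shows "l = m"
proof -
  have V: "l \<in> V" "m \<in> V" "\<forall>\<^sub>F x in F. f x \<in> V"
    using assms by (auto simp: limitin_iff)
  have "p n (l - m) = 0" for n
  proof -
    have "((\<lambda>x. p n (f x - l) + p n (f x - m)) \<longlongrightarrow> 0 + 0) F"
      using assms by (intro tendsto_add) (auto simp: limitin_iff)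
    moreover have "\<forall>\<^sub>F x in F. p n (l - m) \<le> p n (f x - l) + p n (f x - m)"
      using V(3)
    proof eventually_elim
      fix x assume "f x \<in> V"
      then show "p n (l - m) \<le> p n (f x - l) + p n (f x - m)"
        using V p_triangle[of "l - f x" "f x - m" n] p_minus_commute[of l "f x" n] by simp
    qed
    ultimately have "p n (l - m) \<le> 0"
      using tendsto_le[OF assms(3) _ tendsto_const] by fastforce
    then show ?thesis
      using V by (intro antisym) auto
  qed
  then have "l - m = 0"
    using V by (intro p_separating) auto
  then show ?thesis by simp
qed

lemma limit_add:
  assumes "limitin T f l F" "limitin T g m F"
  shows "limitin T (\<lambda>x. f x + g x) (l + m) F"
proof -
  have V: "l \<in> V" "m \<in> V" "\<forall>\<^sub>F x in F. f x \<in> V" "\<forall>\<^sub>F x in F. g x \<in> V"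
    using assms by (auto simp: limitin_iff)
  have "((\<lambda>x. p n (f x + g x - (l + m))) \<longlongrightarrow> 0) F" for n
  proof (rule Lim_null_comparison)
    show "((\<lambda>x. p n (f x - l) + p n (g x - m)) \<longlongrightarrow> 0) F"
      using assms by (intro tendsto_add_zero) (auto simp: limitin_iff)
    show "\<forall>\<^sub>F x in F. norm (p n (f x + g x - (l + m))) \<le> p n (f x - l) + p n (g x - m)"
      using V(3,4)
    proof eventually_elim
      fix x assume "f x \<in> V" "g x \<in> V"
      then show "norm (p n (f x + g x - (l + m))) \<le> p n (f x - l) + p n (g x - m)"
        using V p_triangle[of "f x - l" "g x - m" n] by (simp add: algebra_simps)
    qed
  qed
  moreover have "\<forall>\<^sub>F x in F. f x + g x \<in> V"
    using V(3,4) by eventually_elim simp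
  ultimately show ?thesis
    using V by (simp add: limitin_iff)
qed

lemma limit_scale:
  assumes "(c \<longlongrightarrow> k) F" "limitin T f l F"
  shows "limitin T (\<lambda>x. c x *\<^sub>C f x) (k *\<^sub>C l) F"
proof -
  have V: "l \<in> V" "\<forall>\<^sub>F x in F. f x \<in> V"
    using assms by (auto simp: limitin_iff)
  have "((\<lambda>x. p n (c x *\<^sub>C f x - k *\<^sub>C l)) \<longlongrightarrow> 0) F" for n
  proof (rule Lim_null_comparison)
    have "((\<lambda>x. cmod (c x) * p n (f x - l) + cmod (c x - k) * p n l) \<longlongrightarrow>
        cmod k * 0 + cmod (k - k) * p n l) F"
      using assms by (intro tendsto_intros) (auto simp: limitin_iff)
    then show "((\<lambda>x. cmod (c x) * p n (f x - l) + cmod (c x - k) * p n l) \<longlongrightarrow> 0) F"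
      by simp
    show "\<forall>\<^sub>F x in F. norm (p n (c x *\<^sub>C f x - k *\<^sub>C l)) \<le> cmod (c x) * p n (f x - l) + cmod (c x - k) * p n l"
      using V(2)
    proof eventually_elim
      fix x assume x: "f x \<in> V"
      have "c x *\<^sub>C f x - k *\<^sub>C l = c x *\<^sub>C (f x - l) + (c x - k) *\<^sub>C l"
        by (simp add: complex_vector.scale_right_diff_distrib complex_vector.scale_left_diff_distrib)
      then show "norm (p n (c x *\<^sub>C f x - k *\<^sub>C l)) \<le> cmod (c x) * p n (f x - l) + cmod (c x - k) * p n l"
        using V x p_triangle[of "c x *\<^sub>C (f x - l)" "(c x - k) *\<^sub>C l" n] by (simp add: p_scale)
    qed
  qed
  moreover have "\<forall>\<^sub>F x in F. c x *\<^sub>C f x \<in> V"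
    using V(2) by eventually_elim simp
  ultimately show ?thesis
    using V by (simp add: limitin_iff)
qed

lemma limit_diff:
  assumes "limitin T f l F" "limitin T g m F"
  shows "limitin T (\<lambda>x. f x - g x) (l - m) F"
  using limit_add[OF assms(1) limit_scale[OF tendsto_const assms(2), of "-1"]] by simp

lemma limit_cong:
  assumes "limitin T f l F" "\<forall>\<^sub>F x in F. f x = g x"
  shows "limitin T g l F"
  using limitin_transform_eventually[OF _ assms(1)] assms(2) by auto

end

section \<open>The derived representation\<close>

locale smooth_representation = real_form G for G +
  fixes R :: "'v::complex_vector rep"
  assumes smooth: "smooth_rep G R"
begin

lemma frechet_rep: "frechet_rep G R"
  using smooth by (simp add: smooth_rep_def)

sublocale frechet "rep_top R"
  using frechet_rep by unfold_locales (simp add: frechet_rep_def)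

abbreviation "T \<equiv> rep_top R"
abbreviation "\<pi> \<equiv> rep_act R"
abbreviation "d\<pi> \<equiv> deriv_act R"

lemma act_in [simp]: "g \<in> G \<Longrightarrow> v \<in> V \<Longrightarrow> \<pi> g v \<in> V"
  and act_add: "g \<in> G \<Longrightarrow> v \<in> V \<Longrightarrow> w \<in> V \<Longrightarrow> \<pi> g (v + w) = \<pi> g v + \<pi> g w"
  and act_scale: "g \<in> G \<Longrightarrow> v \<in> V \<Longrightarrow> \<pi> g (c *\<^sub>C v) = c *\<^sub>C \<pi> g v"
  and act_1 [simp]: "v \<in> V \<Longrightarrow> \<pi> (mat 1) v = v"
  and act_mult: "g \<in> G \<Longrightarrow> h \<in> G \<Longrightarrow> v \<in> V \<Longrightarrow> \<pi> (g ** h) v = \<pi> g (\<pi> h v)"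
  and act_continuous: "continuous_map (prod_topology (top_of_set G) T) T (\<lambda>(g, v). \<pi> g v)"
  using frechet_rep unfolding frechet_rep_def clinear_on_def by (auto simp: Pi_iff)

lemma act_diff: "g \<in> G \<Longrightarrow> v \<in> V \<Longrightarrow> w \<in> V \<Longrightarrow> \<pi> g (v - w) = \<pi> g v - \<pi> g w"
  using act_add[of g v "- w"] act_scale[of g w "-1"] by simp

lemma act_0: "g \<in> G \<Longrightarrow> \<pi> g 0 = 0"
  using act_scale[of g 0 0] by simp

lemma act_limit:
  assumes "(g \<longlongrightarrow> h) F" "h \<in> G" "\<forall>\<^sub>F x in F. g x \<in> G" "limitin T f v F"
  shows "limitin T (\<lambda>x. \<pi> (g x) (f x)) (\<pi> h v) F"
proof -
  have "limitin (prod_topology (top_of_set G) T) (\<lambda>x. (g x, f x)) (h, v) F"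
    using assms by (simp add: limitin_pairwise limitin_subtopology o_def)
  from continuous_map_limit[OF act_continuous this] show ?thesis
    by (simp add: o_def)
qed

text \<open>
  The derivatives of an orbit map, with their joint continuity in the group element and the direction.
  This joint continuity is what the bracket relation rests on.
\<close>

lemma orbit_derivative:
  assumes "v \<in> V"
  obtains D where "\<forall>A\<in>\<gg>. \<forall>g\<in>G. limitin T (\<lambda>t::real. complex_of_real (1 / t) *\<^sub>C
      (\<pi> (g ** matrix_exp (t *\<^sub>R A)) v - \<pi> g v)) (D A g) (at 0)"
    and "continuous_map (prod_topology (top_of_set G) (top_of_set \<gg>)) T (\<lambda>(g, A). D A g)"
proof -
  have "smooth_group_map G T (\<lambda>g. \<pi> g v)"
    using smooth assms by (simp add: smooth_rep_def)
  then obtain S where S: "(\<lambda>g. \<pi> g v) \<in> S" and der: "\<forall>f\<in>S. continuous_map (top_of_set G) T f \<and>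
      (\<exists>D. (\<forall>A\<in>\<gg>. D A \<in> S) \<and>
         (\<forall>A\<in>\<gg>. \<forall>g\<in>G. limitin T (\<lambda>t::real. complex_of_real (1 / t) *\<^sub>C
           (f (g ** matrix_exp (t *\<^sub>R A)) - f g)) (D A g) (at 0)) \<and>
         continuous_map (prod_topology (top_of_set G) (top_of_set \<gg>)) T (\<lambda>(g, A). D A g))"
    unfolding smooth_group_map_def by (elim exE conjE)
  from bspec[OF der S, THEN conjunct2] show thesis
  proof (elim exE conjE)
    fix D
    assume D: "\<forall>A\<in>\<gg>. \<forall>g\<in>G. limitin T (\<lambda>t::real. complex_of_real (1 / t) *\<^sub>C
        (\<pi> (g ** matrix_exp (t *\<^sub>R A)) v - \<pi> g v)) (D A g) (at 0)"
      and c: "continuous_map (prod_topology (top_of_set G) (top_of_set \<gg>)) T (\<lambda>(g, A). D A g)"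
    show thesis
      by (rule that[OF D c])
  qed
qed

lemma deriv_limit:
  assumes "A \<in> \<gg>" "v \<in> V"
  shows "limitin T (\<lambda>t. complex_of_real (1 / t) *\<^sub>C (\<pi> (matrix_exp (t *\<^sub>R A)) v - v)) (d\<pi> A v) (at 0)"
proof -
  obtain D where D: "\<forall>A\<in>\<gg>. \<forall>g\<in>G. limitin T (\<lambda>t::real. complex_of_real (1 / t) *\<^sub>C
      (\<pi> (g ** matrix_exp (t *\<^sub>R A)) v - \<pi> g v)) (D A g) (at 0)"
    by (rule orbit_derivative[OF assms(2)]) (rule that)
  have lim: "limitin T (\<lambda>t. complex_of_real (1 / t) *\<^sub>C (\<pi> (matrix_exp (t *\<^sub>R A)) v - v)) (D A (mat 1)) (at 0)"
    using bspec[OF bspec[OF D assms(1)] one_in_G] assms(2) by (simp only: matrix_mul_lid act_1)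
  moreover have "d\<pi> A v = D A (mat 1)"
    unfolding deriv_act_def using lim by (rule the_equality) (rule limit_unique[OF _ lim], auto)
  ultimately show ?thesis by simp
qed

lemma deriv_eqI:
  assumes "A \<in> \<gg>" "v \<in> V"
    and "limitin T (\<lambda>t. complex_of_real (1 / t) *\<^sub>C (\<pi> (matrix_exp (t *\<^sub>R A)) v - v)) w (at 0)"
  shows "d\<pi> A v = w"
  using limit_unique[OF deriv_limit[OF assms(1,2)] assms(3)] by simp

lemma deriv_in [simp]: "A \<in> \<gg> \<Longrightarrow> v \<in> V \<Longrightarrow> d\<pi> A v \<in> V"
  by (rule limitin_topspace[OF deriv_limit])

lemma deriv_add:
  assumes "A \<in> \<gg>" "v \<in> V" "w \<in> V"
  shows "d\<pi> A (v + w) = d\<pi> A v + d\<pi> A w"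
proof (rule deriv_eqI)
  show "limitin T (\<lambda>t. complex_of_real (1 / t) *\<^sub>C (\<pi> (matrix_exp (t *\<^sub>R A)) (v + w) - (v + w)))
      (d\<pi> A v + d\<pi> A w) (at 0)"
    using limit_add[OF deriv_limit[OF assms(1,2)] deriv_limit[OF assms(1,3)]]
    by (rule limit_cong, intro always_eventually allI) (simp add: act_add exp_in_G assms scaleC_add_right
        complex_vector.scale_right_diff_distrib)
qed (use assms in auto)

lemma deriv_scale:
  assumes "A \<in> \<gg>" "v \<in> V"
  shows "d\<pi> A (c *\<^sub>C v) = c *\<^sub>C d\<pi> A v"
proof (rule deriv_eqI)
  show "limitin T (\<lambda>t. complex_of_real (1 / t) *\<^sub>C (\<pi> (matrix_exp (t *\<^sub>R A)) (c *\<^sub>C v) - c *\<^sub>C v))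
      (c *\<^sub>C d\<pi> A v) (at 0)"
    using limit_scale[OF tendsto_const deriv_limit[OF assms], of c]
    by (rule limit_cong, intro always_eventually allI) (simp add: act_scale exp_in_G assms scaleC_scaleC mult.commute
        complex_vector.scale_right_diff_distrib)
qed (use assms in auto)

lemma deriv_diff:
  assumes "A \<in> \<gg>" "v \<in> V" "w \<in> V"
  shows "d\<pi> A (v - w) = d\<pi> A v - d\<pi> A w"
  using deriv_add[of A v "- w"] deriv_scale[of A w "-1"] assms by simp

lemma deriv_continuous:
  assumes "A \<in> \<gg>" "limitin T f v F"
  shows "limitin T (\<lambda>x. d\<pi> A (f x)) (d\<pi> A v) F"
proof -
  have "continuous_map T T (d\<pi> A)"
    using smooth assms(1) by (simp add: smooth_rep_def)
  from continuous_map_limit[OF this assms(2)] show ?thesis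
    by (simp add: o_def)
qed

lemma deriv_scaleR:
  assumes "A \<in> \<gg>" "v \<in> V"
  shows "d\<pi> (r *\<^sub>R A) v = of_real r *\<^sub>C d\<pi> A v"
proof (cases "r = 0")
  case True
  then show ?thesis
    using assms by (intro deriv_eqI) (simp_all add: lie_algebra_0)
next
  case False
  have "filterlim (\<lambda>t::real. t * r) (at 0) (at 0)"
    using False by (auto simp: filterlim_at eventually_at_filter intro!: tendsto_eq_intros)
  then have "limitin T (\<lambda>t. complex_of_real (1 / (t * r)) *\<^sub>C (\<pi> (matrix_exp ((t * r) *\<^sub>R A)) v - v)) (d\<pi> A v) (at 0)"
    by (rule limitin_filterlim[OF deriv_limit[OF assms]])
  then have "limitin T (\<lambda>t. of_real r *\<^sub>C complex_of_real (1 / (t * r)) *\<^sub>C (\<pi> (matrix_exp ((t * r) *\<^sub>R A)) v - v)) (of_real r *\<^sub>C d\<pi> A v) (at 0)"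
    by (rule limit_scale[OF tendsto_const])
  note lim = this
  show ?thesis
  proof (rule deriv_eqI)
    show "limitin T (\<lambda>t. complex_of_real (1 / t) *\<^sub>C (\<pi> (matrix_exp (t *\<^sub>R r *\<^sub>R A)) v - v))
        (of_real r *\<^sub>C d\<pi> A v) (at 0)"
      using lim by (rule limit_cong, intro always_eventually allI) (use False in \<open>simp add: scaleC_scaleC\<close>)
  qed (use assms in \<open>auto simp: lie_algebra_scaleR\<close>)
qed

end

context smooth_representation
begin

lemma mpow_in_G: "g \<in> G \<Longrightarrow> mpow g k \<in> G"
  by (induction k) (auto simp: mpow_Suc one_in_G mult_in_G)

text \<open>Joint continuity of the action at \<open>(1, 0)\<close>.\<close>

lemma act_equicontinuous:
  assumes "0 < e"
  obtains d N \<eta> where "0 < d" "0 < \<eta>"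
    "\<And>g x. g \<in> G \<Longrightarrow> dist g (mat 1) < d \<Longrightarrow> x \<in> V \<Longrightarrow> (\<And>k. k \<le> N \<Longrightarrow> p k x < \<eta>) \<Longrightarrow> p n (\<pi> g x) < e"
proof -
  define W where "W = {x \<in> topspace (prod_topology (top_of_set G) T). (case x of (g, v) \<Rightarrow> \<pi> g v) \<in> {y \<in> V. p n (y - 0) < e}}"
  have "openin (prod_topology (top_of_set G) T) W"
    unfolding W_def by (rule openin_continuous_map_preimage[OF act_continuous openin_ball]) (use assms in auto)
  moreover have "(mat 1, 0) \<in> W"
    using assms by (simp add: W_def one_in_G)
  ultimately obtain U U' where U: "openin (top_of_set G) U" "mat 1 \<in> U" and U': "openin T U'" "0 \<in> U'"
    and UW: "U \<times> U' \<subseteq> W"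
    unfolding openin_prod_topology_alt by metis
  obtain d where d: "d > 0" "\<And>g. g \<in> G \<Longrightarrow> dist g (mat 1) < d \<Longrightarrow> g \<in> U"
    using U unfolding openin_euclidean_subtopology_iff by metis
  obtain N \<eta> where \<eta>: "\<eta> > 0" "\<And>y. y \<in> V \<Longrightarrow> (\<forall>n\<le>N. p n (y - 0) < \<eta>) \<Longrightarrow> y \<in> U'"
    using U' unfolding openin_iff by metis
  show thesis
  proof (rule that[OF d(1) \<eta>(1)])
    fix g x
    assume "g \<in> G" "dist g (mat 1) < d" "x \<in> V" "\<And>k. k \<le> N \<Longrightarrow> p k x < \<eta>"
    then have "(g, x) \<in> W"
      using d(2)[of g] \<eta>(2)[of x] UW by auto
    then show "p n (\<pi> g x) < e"
      by (simp add: W_def)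
  qed
qed

lemma act_near_one:
  assumes "0 < e" "w \<in> V"
  obtains d where "0 < d" "\<And>g. g \<in> G \<Longrightarrow> dist g (mat 1) < d \<Longrightarrow> p n (\<pi> g w - w) < e"
proof -
  have "limitin T (\<lambda>g. \<pi> g w) (\<pi> (mat 1) w) (at (mat 1) within G)"
  proof (rule act_limit)
    show "limitin T (\<lambda>g. w) w (at (mat 1) within G)"
      using assms by (simp add: limitin_const_iff)
    show "\<forall>\<^sub>F g in at (mat 1) within G. g \<in> G"
      by (simp add: eventually_at_filter)
  qed (use one_in_G tendsto_ident_at in auto)
  then have "((\<lambda>g. p n (\<pi> g w - w)) \<longlongrightarrow> 0) (at (mat 1) within G)"
    using assms by (simp add: limitin_iff)
  then have "\<forall>\<^sub>F g in at (mat 1) within G. p n (\<pi> g w - w) < e"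
    using assms by (intro order_tendstoD(2)) auto
  then obtain d where d: "d > 0" "\<And>g. g \<in> G \<Longrightarrow> g \<noteq> mat 1 \<Longrightarrow> dist g (mat 1) < d \<Longrightarrow> p n (\<pi> g w - w) < e"
    unfolding eventually_at by metis
  have "p n (\<pi> g w - w) < e" if "g \<in> G" "dist g (mat 1) < d" for g
    using d(2)[of g] that assms by (cases "g = mat 1") auto
  with d(1) show thesis by (rule that)
qed

text \<open>
  Split \<open>\<pi> (gh) v - v\<close> as \<open>\<pi> g (\<pi> h v - v) + (\<pi> g v - v)\<close>.
\<close>

lemma product_derivative:
  assumes "A \<in> \<gg>" "B \<in> \<gg>" "v \<in> V"
  shows "limitin T (\<lambda>t. complex_of_real (1 / t) *\<^sub>C
    (\<pi> (matrix_exp (t *\<^sub>R A) ** matrix_exp (t *\<^sub>R B)) v - v)) (d\<pi> A v + d\<pi> B v) (at 0)"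
proof -
  have "limitin T (\<lambda>t. \<pi> (matrix_exp (t *\<^sub>R A)) (complex_of_real (1 / t) *\<^sub>C (\<pi> (matrix_exp (t *\<^sub>R B)) v - v)))
      (\<pi> (mat 1) (d\<pi> B v)) (at 0)"
    using assms by (intro act_limit[OF exp_tendsto one_in_G _ deriv_limit]) (simp_all add: exp_in_G)
  then have "limitin T (\<lambda>t. complex_of_real (1 / t) *\<^sub>C (\<pi> (matrix_exp (t *\<^sub>R A)) v - v)
      + \<pi> (matrix_exp (t *\<^sub>R A)) (complex_of_real (1 / t) *\<^sub>C (\<pi> (matrix_exp (t *\<^sub>R B)) v - v)))
      (d\<pi> A v + d\<pi> B v) (at 0)"
    using assms by (intro limit_add deriv_limit) simp_all
  then show ?thesis
    by (rule limit_cong, intro always_eventually allI)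
      (simp add: assms exp_in_G act_scale act_diff act_mult complex_vector.scale_right_diff_distrib)
qed

text \<open>
  Telescoping along the powers of \<open>g\<close>: an approximate first-order identity for \<open>g\<close> is transported
  by the operators \<open>\<pi> (g ^ k)\<close> to one for \<open>g ^ j\<close>.
\<close>

lemma telescope_bound:
  assumes g: "g \<in> G" and v: "v \<in> V" and w: "w \<in> V" and m: "m > (0::nat)"
    and x: "x = complex_of_real (real m / t) *\<^sub>C (\<pi> g v - v) - w"
    and near: "\<And>k. k \<le> m \<Longrightarrow> p n (\<pi> (mpow g k) x) \<le> e" "\<And>k. k \<le> m \<Longrightarrow> p n (\<pi> (mpow g k) w - w) \<le> e"
    and j: "j \<le> m"
  shows "p n (complex_of_real (1 / t) *\<^sub>C (\<pi> (mpow g j) v - v) - complex_of_real (real j / m) *\<^sub>C w)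
     \<le> real j / m * (2 * e)"
  using j
proof (induction j)
  case 0
  then show ?case using v by simp
next
  case (Suc j)
  define a where "a = complex_of_real (1 / t) *\<^sub>C (\<pi> (mpow g j) v - v) - complex_of_real (real j / m) *\<^sub>C w"
  define b where "b = complex_of_real (1 / m) *\<^sub>C (\<pi> (mpow g j) x + (\<pi> (mpow g j) w - w))"
  have xV: "x \<in> V" and gj: "mpow g j \<in> G"
    using g v w by (auto simp: x mpow_in_G)
  have "complex_of_real (1 / m) *\<^sub>C (x + w) = complex_of_real (1 / t) *\<^sub>C (\<pi> g v - v)"
    using m by (simp add: x scaleC_scaleC)
  then have "\<pi> (mpow g j) (complex_of_real (1 / m) *\<^sub>C (x + w)) = \<pi> (mpow g j) (complex_of_real (1 / t) *\<^sub>C (\<pi> g v - v))"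
    by simp
  then have 1: "complex_of_real (1 / m) *\<^sub>C (\<pi> (mpow g j) x + \<pi> (mpow g j) w)
      = complex_of_real (1 / t) *\<^sub>C (\<pi> (mpow g (Suc j)) v - \<pi> (mpow g j) v)"
    using gj g v w xV by (simp add: act_scale act_add act_diff mpow_Suc act_mult)
  have "b = complex_of_real (1 / t) *\<^sub>C (\<pi> (mpow g (Suc j)) v - \<pi> (mpow g j) v) - complex_of_real (1 / m) *\<^sub>C w"
    unfolding b_def 1[symmetric] by (simp only: complex_vector.scale_right_diff_distrib scaleC_add_right) simp
  moreover have "complex_of_real (real (Suc j) / m) *\<^sub>C w = complex_of_real (real j / m) *\<^sub>C w + complex_of_real (1 / m) *\<^sub>C w"
    by (simp add: add_divide_distrib scaleC_add_left)
  ultimately have eq: "complex_of_real (1 / t) *\<^sub>C (\<pi> (mpow g (Suc j)) v - v) - complex_of_real (real (Suc j) / m) *\<^sub>C w = a + b"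
    unfolding a_def by (simp add: complex_vector.scale_right_diff_distrib)
  have abV: "a \<in> V" "b \<in> V"
    using gj g v w xV by (auto simp: a_def b_def)
  have "p n (\<pi> (mpow g j) x + (\<pi> (mpow g j) w - w)) \<le> 2 * e"
    using p_triangle[of "\<pi> (mpow g j) x" "\<pi> (mpow g j) w - w" n] near[of j] Suc.prems gj w xV by simp
  then have "p n b \<le> 1 / m * (2 * e)"
    using gj w xV m by (simp add: b_def p_scale divide_right_mono norm_divide)
  moreover have "p n a \<le> real j / m * (2 * e)"
    using Suc by (simp add: a_def)
  ultimately have "p n (a + b) \<le> real j / m * (2 * e) + 1 / m * (2 * e)"
    using p_triangle[OF abV, of n] by linarith
  also have "\<dots> = real (Suc j) / m * (2 * e)"
    by (simp add: add_divide_distrib algebra_simps)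
  finally show ?case
    unfolding eq .
qed

text \<open>
  Additivity in the Lie algebra element. Since \<open>exp (t (A + B))\<close> is the limit of the products
  \<open>(exp (tA/m) exp (tB/m)) ^ m\<close>, whose partial products stay in a neighbourhood of \<open>1\<close> on which \<open>\<pi>\<close>
  is equicontinuous, telescoping shows that \<open>\<pi> (exp (t (A + B))) v - v\<close> is
  \<open>t (d\<pi> A v + d\<pi> B v) + o(t)\<close>.
\<close>

lemma deriv_add_left:
  assumes A: "A \<in> \<gg>" and B: "B \<in> \<gg>" and v: "v \<in> V"
  shows "d\<pi> (A + B) v = d\<pi> A v + d\<pi> B v"
proof (rule deriv_eqI)
  define w where "w = d\<pi> A v + d\<pi> B v"
  have w: "w \<in> V"
    using assms by (simp add: w_def)
  have AB: "A + B \<in> \<gg>"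
    using A B by (rule lie_algebra_add)
  define E where "E t = matrix_exp (t *\<^sub>R (A + B))" for t
  define g where "g t m = matrix_exp ((t / real m) *\<^sub>R A) ** matrix_exp ((t / real m) *\<^sub>R B)" for t m
  have E: "E t \<in> G" for t
    using AB by (simp add: E_def exp_in_G)
  have g: "g t m \<in> G" for t m
    using A B by (simp add: g_def exp_in_G mult_in_G)
  have "((\<lambda>t. p n (complex_of_real (1 / t) *\<^sub>C (\<pi> (E t) v - v) - w)) \<longlongrightarrow> 0) (at 0)" for n
  proof (rule tendstoI)
    fix e :: real
    assume "e > 0"
    \<comment> \<open>The telescoping bound is \<open>2 e'\<close>, which has to be strictly below \<open>e\<close>.\<close>
    define e' where "e' = e / 4"
    have e': "e' > 0"
      using \<open>e > 0\<close> by (simp add: e'_def)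
    obtain d1 N \<eta> where d1: "d1 > 0" and \<eta>: "\<eta> > 0" and small: "\<And>g x. g \<in> G \<Longrightarrow> dist g (mat 1) < d1 \<Longrightarrow>
        x \<in> V \<Longrightarrow> (\<And>k. k \<le> N \<Longrightarrow> p k x < \<eta>) \<Longrightarrow> p n (\<pi> g x) < e'"
      using act_equicontinuous[OF e', of n] by metis
    obtain d2 where d2: "d2 > 0" and near: "\<And>g. g \<in> G \<Longrightarrow> dist g (mat 1) < d2 \<Longrightarrow> p n (\<pi> g w - w) < e'"
      using act_near_one[OF e' w, of n] by metis
    obtain d where d: "d > 0" and partial: "\<And>t n k. \<bar>t\<bar> < d \<Longrightarrow> k \<le> n \<Longrightarrow> dist (mpow (g t n) k) (mat 1) < min d1 d2"
      using trotter_partial_products_near_one[of "min d1 d2" A B] d1 d2 unfolding g_def by (metis min_less_iff_conj)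
    have bound: "p n (complex_of_real (1 / t) *\<^sub>C (\<pi> (E t) v - v) - w) \<le> 2 * e'" if t: "t \<noteq> 0" "\<bar>t\<bar> < d" for t
    proof -
      define x where "x m = complex_of_real (real m / t) *\<^sub>C (\<pi> (g t m) v - v) - w" for m
      have "filterlim (\<lambda>m. t / real m) (at 0) sequentially"
        using t(1) unfolding filterlim_at
        by (auto intro!: tendsto_divide_0[OF tendsto_const] filterlim_at_top_imp_at_infinity
            filterlim_real_sequentially eventually_sequentiallyI[of 1])
      from limitin_filterlim[OF product_derivative[OF A B v] this]
      have "limitin T (\<lambda>m. complex_of_real (real m / t) *\<^sub>C (\<pi> (g t m) v - v)) w sequentially"
        by (simp add: g_def w_def)
      then have "(\<lambda>m. p k (x m)) \<longlonglongrightarrow> 0" for k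
        by (simp add: limitin_iff x_def)
      then have "\<forall>\<^sub>F m in sequentially. p k (x m) < \<eta>" for k
        using \<eta> by (intro order_tendstoD(2)) auto
      then have ev: "\<forall>\<^sub>F m in sequentially. \<forall>k\<in>{..N}. p k (x m) < \<eta>"
        by (intro eventually_ball_finite) auto
      have step: "\<forall>\<^sub>F m in sequentially. p n (complex_of_real (1 / t) *\<^sub>C (\<pi> (mpow (g t m) m) v - v) - w) \<le> 2 * e'"
        using ev eventually_gt_at_top[of 0]
      proof eventually_elim
        fix m :: nat
        assume m: "\<forall>k\<in>{..N}. p k (x m) < \<eta>" "0 < m"
        have xV: "x m \<in> V"
          using g v w by (simp add: x_def)
        have "p n (complex_of_real (1 / t) *\<^sub>C (\<pi> (mpow (g t m) m) v - v) - complex_of_real (real m / m) *\<^sub>C w)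
            \<le> real m / m * (2 * e')"
        proof (rule telescope_bound[OF g v w m(2) x_def])
          fix k
          assume "k \<le> m"
          then have k: "mpow (g t m) k \<in> G" "dist (mpow (g t m) k) (mat 1) < d1" "dist (mpow (g t m) k) (mat 1) < d2"
            using partial[OF t(2), of k m] g by (auto simp: mpow_in_G)
          show "p n (\<pi> (mpow (g t m) k) (x m)) \<le> e'"
            using small[OF k(1,2) xV] m(1) by (auto intro: less_imp_le)
          show "p n (\<pi> (mpow (g t m) k) w - w) \<le> e'"
            using near[OF k(1,3)] by simp
        qed simp
        then show "p n (complex_of_real (1 / t) *\<^sub>C (\<pi> (mpow (g t m) m) v - v) - w) \<le> 2 * e'"
          using m(2) by (simp add: scaleC_one)
      qed
      have "(\<lambda>m. mpow (g t m) m) \<longlonglongrightarrow> E t"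
        using matrix_exp_trotter[of "t *\<^sub>R A" "t *\<^sub>R B"]
        by (simp add: g_def E_def scaleR_add_right divide_inverse mult.commute)
      then have lim: "limitin T (\<lambda>m. \<pi> (mpow (g t m) m) v) (\<pi> (E t) v) sequentially"
        by (rule act_limit) (use E g v in \<open>auto simp: mpow_in_G limitin_const_iff\<close>)
      then have "limitin T (\<lambda>m. complex_of_real (1 / t) *\<^sub>C (\<pi> (mpow (g t m) m) v - v) - w)
          (complex_of_real (1 / t) *\<^sub>C (\<pi> (E t) v - v) - w) sequentially"
        using v w by (intro limit_diff limit_scale tendsto_const) (simp_all add: limitin_const_iff)
      then have "(\<lambda>m. p n ((complex_of_real (1 / t) *\<^sub>C (\<pi> (mpow (g t m) m) v - v) - w)
           - (complex_of_real (1 / t) *\<^sub>C (\<pi> (E t) v - v) - w))) \<longlonglongrightarrow> 0"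
        by (simp add: limitin_iff)
      then have l2: "(\<lambda>m. 2 * e' + p n ((complex_of_real (1 / t) *\<^sub>C (\<pi> (mpow (g t m) m) v - v) - w)
           - (complex_of_real (1 / t) *\<^sub>C (\<pi> (E t) v - v) - w))) \<longlonglongrightarrow> 2 * e' + 0"
        by (intro tendsto_intros)
      have "\<forall>\<^sub>F m in sequentially. p n (complex_of_real (1 / t) *\<^sub>C (\<pi> (E t) v - v) - w)
          \<le> 2 * e' + p n ((complex_of_real (1 / t) *\<^sub>C (\<pi> (mpow (g t m) m) v - v) - w)
           - (complex_of_real (1 / t) *\<^sub>C (\<pi> (E t) v - v) - w))"
        using step
      proof eventually_elim
        fix m
        define a where "a = complex_of_real (1 / t) *\<^sub>C (\<pi> (mpow (g t m) m) v - v) - w"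
        define b where "b = complex_of_real (1 / t) *\<^sub>C (\<pi> (E t) v - v) - w"
        have ab: "a \<in> V" "b \<in> V"
          using E g v w by (auto simp: a_def b_def mpow_in_G)
        assume "p n (complex_of_real (1 / t) *\<^sub>C (\<pi> (mpow (g t m) m) v - v) - w) \<le> 2 * e'"
        then have "p n a \<le> 2 * e'"
          unfolding a_def .
        then have "p n b \<le> 2 * e' + p n (a - b)"
          using p_triangle[of a "b - a" n] p_minus_commute[of a b n] ab by simp
        then show "p n (complex_of_real (1 / t) *\<^sub>C (\<pi> (E t) v - v) - w)
          \<le> 2 * e' + p n ((complex_of_real (1 / t) *\<^sub>C (\<pi> (mpow (g t m) m) v - v) - w)
           - (complex_of_real (1 / t) *\<^sub>C (\<pi> (E t) v - v) - w))"
          unfolding a_def b_def .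
      qed
      from tendsto_le[OF sequentially_bot l2 tendsto_const this] show ?thesis
        by simp
    qed
    show "\<forall>\<^sub>F t in at 0. dist (p n (complex_of_real (1 / t) *\<^sub>C (\<pi> (E t) v - v) - w)) 0 < e"
      unfolding eventually_at
    proof (intro exI[of _ d] conjI ballI impI)
      fix t :: real
      assume t: "t \<noteq> 0 \<and> dist t 0 < d"
      have "0 \<le> p n (complex_of_real (1 / t) *\<^sub>C (\<pi> (E t) v - v) - w)"
        using E v w by simp
      with bound[of t] t \<open>e > 0\<close> show "dist (p n (complex_of_real (1 / t) *\<^sub>C (\<pi> (E t) v - v) - w)) 0 < e"
        by (simp add: e'_def)
    qed (rule d)
  qed
  then show "limitin T (\<lambda>t. complex_of_real (1 / t) *\<^sub>C (\<pi> (matrix_exp (t *\<^sub>R (A + B))) v - v)) (d\<pi> A v + d\<pi> B v) (at 0)"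
    using E v w unfolding limitin_iff by (simp add: E_def w_def)
qed (use assms lie_algebra_add in auto)

text \<open>Conjugate the one-parameter group of \<open>A\<close> by \<open>g\<close>.\<close>

lemma act_deriv:
  assumes "g \<in> G" "h \<in> G" "h ** g = mat 1" "A \<in> \<gg>" "v \<in> V"
  shows "\<pi> g (d\<pi> A v) = d\<pi> (g ** A ** h) (\<pi> g v)"
proof (rule sym, rule deriv_eqI)
  show "g ** A ** h \<in> \<gg>"
    using assms by (intro Ad_in_lie_algebra)
  have "limitin T (\<lambda>t. \<pi> g (complex_of_real (1 / t) *\<^sub>C (\<pi> (matrix_exp (t *\<^sub>R A)) v - v))) (\<pi> g (d\<pi> A v)) (at 0)"
    using assms by (intro act_limit[OF tendsto_const _ _ deriv_limit]) auto
  then show "limitin T (\<lambda>t. complex_of_real (1 / t) *\<^sub>C (\<pi> (matrix_exp (t *\<^sub>R (g ** A ** h))) (\<pi> g v) - \<pi> g v))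
      (\<pi> g (d\<pi> A v)) (at 0)"
  proof (rule limit_cong, intro always_eventually allI)
    fix t :: real
    have "matrix_exp (t *\<^sub>R (g ** A ** h)) = g ** matrix_exp (t *\<^sub>R A) ** h"
      unfolding matrix_exp_conjugate[OF assms(3)] by (simp add: scaleR_cmat_conv cmat_mult_linear)
    then have "matrix_exp (t *\<^sub>R (g ** A ** h)) ** g = g ** matrix_exp (t *\<^sub>R A)"
      by (simp add: assms(3) flip: matrix_mul_assoc)
    moreover have "matrix_exp (t *\<^sub>R (g ** A ** h)) \<in> G"
      using assms by (intro exp_in_G Ad_in_lie_algebra)
    ultimately have "\<pi> (matrix_exp (t *\<^sub>R (g ** A ** h))) (\<pi> g v) = \<pi> g (\<pi> (matrix_exp (t *\<^sub>R A)) v)"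
      using assms by (simp add: exp_in_G flip: act_mult)
    then show "\<pi> g (complex_of_real (1 / t) *\<^sub>C (\<pi> (matrix_exp (t *\<^sub>R A)) v - v))
        = complex_of_real (1 / t) *\<^sub>C (\<pi> (matrix_exp (t *\<^sub>R (g ** A ** h))) (\<pi> g v) - \<pi> g v)"
      using assms by (simp add: act_scale act_diff exp_in_G)
  qed
qed (use assms in auto)

text \<open>
  By uniqueness of limits the derivative of the orbit map at \<open>h\<close> in direction \<open>B\<close> is
  \<open>\<pi> h (d\<pi> B v)\<close>, so this is the joint continuity at \<open>(1, A)\<close>.
\<close>

lemma joint_deriv_limit:
  assumes v: "v \<in> V" and g: "(g \<longlongrightarrow> mat 1) F" "\<And>t. g t \<in> G"
    and C: "(C \<longlongrightarrow> A) F" "\<And>t. C t \<in> \<gg>" "A \<in> \<gg>"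
  shows "limitin T (\<lambda>t. \<pi> (g t) (d\<pi> (C t) v)) (d\<pi> A v) F"
proof -
  obtain D where D: "\<forall>A\<in>\<gg>. \<forall>g\<in>G. limitin T (\<lambda>t::real. complex_of_real (1 / t) *\<^sub>C
        (\<pi> (g ** matrix_exp (t *\<^sub>R A)) v - \<pi> g v)) (D A g) (at 0)"
      and c: "continuous_map (prod_topology (top_of_set G) (top_of_set \<gg>)) T (\<lambda>(g, A). D A g)"
    by (rule orbit_derivative[OF v]) (rule that)
  have eq: "D B h = \<pi> h (d\<pi> B v)" if "B \<in> \<gg>" "h \<in> G" for B h
  proof -
    have "limitin T (\<lambda>t. \<pi> h (complex_of_real (1 / t) *\<^sub>C (\<pi> (matrix_exp (t *\<^sub>R B)) v - v))) (\<pi> h (d\<pi> B v)) (at 0)"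
      using that v by (intro act_limit[OF tendsto_const _ _ deriv_limit]) auto
    then have "limitin T (\<lambda>t. complex_of_real (1 / t) *\<^sub>C (\<pi> (h ** matrix_exp (t *\<^sub>R B)) v - \<pi> h v)) (\<pi> h (d\<pi> B v)) (at 0)"
      by (rule limit_cong, intro always_eventually allI)
        (use that v in \<open>simp add: act_scale act_diff act_mult exp_in_G\<close>)
    then show ?thesis
      using limit_unique[OF bspec[OF bspec[OF D that(1)] that(2)]] by simp
  qed
  have "limitin (prod_topology (top_of_set G) (top_of_set \<gg>)) (\<lambda>t. (g t, C t)) (mat 1, A) F"
    unfolding limitin_pairwise using g C one_in_G by (simp add: limitin_subtopology o_def)
  from continuous_map_limit[OF c this]
  show ?thesis
    using g C v by (simp add: o_def eq one_in_G)
qed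

text \<open>
  The bracket relation comes from differentiating
  \<open>\<pi> g (d\<pi> B v) = d\<pi> (Ad g B) (\<pi> g v)\<close> along \<open>g = exp (tA)\<close>.
\<close>

lemma deriv_bracket:
  assumes A: "A \<in> \<gg>" and B: "B \<in> \<gg>" and v: "v \<in> V"
  shows "d\<pi> (lie_bracket A B) v = d\<pi> A (d\<pi> B v) - d\<pi> B (d\<pi> A v)"
proof -
  define g where "g t = matrix_exp (t *\<^sub>R A)" for t
  define h where "h t = matrix_exp ((- t) *\<^sub>R A)" for t
  define q where "q t = (1 / t) *\<^sub>R (g t ** B ** h t - B)" for t
  define C where "C t = (1 / t) *\<^sub>R (B - h t ** B ** g t)" for t
  have G: "g t \<in> G" "h t \<in> G" for t
    using exp_in_G[OF A] by (simp_all only: g_def h_def)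
  have gh: "g t ** h t = mat 1" "h t ** g t = mat 1" for t
    unfolding g_def h_def by (rule matrix_exp_minus)+
  have lie: "g t ** B ** h t \<in> \<gg>" "h t ** B ** g t \<in> \<gg>" "q t \<in> \<gg>" "C t \<in> \<gg>" for t
    unfolding q_def C_def using G gh B
    by (intro lie_algebra_scaleR lie_algebra_diff Ad_in_lie_algebra; blast)+
  have Cq: "C t = h t ** q t ** g t" for t
  proof -
    have "h t ** (g t ** B ** h t - B) ** g t = h t ** g t ** B ** (h t ** g t) - h t ** B ** g t"
      by (simp only: cmat_mult_linear matrix_mul_assoc)
    then show ?thesis
      by (simp add: C_def q_def gh scaleR_cmat_conv cmat_mult_linear)
  qed
  have key: "complex_of_real (1 / t) *\<^sub>C (\<pi> (g t) (d\<pi> B v) - d\<pi> B v)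
      = \<pi> (g t) (d\<pi> (C t) v) + d\<pi> B (complex_of_real (1 / t) *\<^sub>C (\<pi> (g t) v - v))" if "t \<noteq> 0" for t
  proof -
    have "g t ** C t ** h t = (g t ** h t) ** q t ** (g t ** h t)"
      unfolding Cq by (simp only: matrix_mul_assoc)
    then have "g t ** C t ** h t = q t"
      by (simp add: gh)
    then have 1: "\<pi> (g t) (d\<pi> (C t) v) = d\<pi> (q t) (\<pi> (g t) v)"
      using act_deriv[OF G(1) G(2) gh(2) lie(4) v] by simp
    have "g t ** B ** h t = t *\<^sub>R q t + B"
      using that by (simp add: q_def)
    then have "\<pi> (g t) (d\<pi> B v) = d\<pi> (t *\<^sub>R q t + B) (\<pi> (g t) v)"
      using act_deriv[OF G(1) G(2) gh(2) B v] by simp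
    also have "\<dots> = of_real t *\<^sub>C d\<pi> (q t) (\<pi> (g t) v) + d\<pi> B (\<pi> (g t) v)"
      using lie B v G by (simp add: deriv_add_left deriv_scaleR lie_algebra_scaleR)
    finally show ?thesis
      using 1 that B v G
      by (simp add: deriv_scale deriv_diff scaleC_add_right scaleC_scaleC
          complex_vector.scale_right_diff_distrib)
  qed
  have brac: "lie_bracket A B \<in> \<gg>"
    by (rule lie_bracket_in_lie_algebra[OF A B])
  have "(C \<longlongrightarrow> lie_bracket A B) (at 0)"
  proof -
    have "((\<lambda>t. - ((1 / t) *\<^sub>R (h t ** B ** g t - B))) \<longlongrightarrow> - lie_bracket (- A) B) (at 0)"
      using tendsto_minus[OF Ad_exp_quotient_limit[of "- A" B]] by (simp add: h_def g_def)
    moreover have "- lie_bracket (- A) B = lie_bracket A B"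
      by (simp add: lie_bracket_def cmat_mult_neg)
    ultimately show ?thesis
      unfolding C_def[abs_def] by (simp add: scaleR_diff_right)
  qed
  then have "limitin T (\<lambda>t. \<pi> (g t) (d\<pi> (C t) v)) (d\<pi> (lie_bracket A B) v) (at 0)"
    using v G lie brac exp_tendsto[of A] by (intro joint_deriv_limit) (simp_all add: g_def)
  moreover have "limitin T (\<lambda>t. d\<pi> B (complex_of_real (1 / t) *\<^sub>C (\<pi> (g t) v - v))) (d\<pi> B (d\<pi> A v)) (at 0)"
    unfolding g_def by (intro deriv_continuous deriv_limit A B v)
  ultimately have "limitin T (\<lambda>t. \<pi> (g t) (d\<pi> (C t) v) + d\<pi> B (complex_of_real (1 / t) *\<^sub>C (\<pi> (g t) v - v)))
      (d\<pi> (lie_bracket A B) v + d\<pi> B (d\<pi> A v)) (at 0)"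
    by (rule limit_add)
  then have "limitin T (\<lambda>t. complex_of_real (1 / t) *\<^sub>C (\<pi> (g t) (d\<pi> B v) - d\<pi> B v))
      (d\<pi> (lie_bracket A B) v + d\<pi> B (d\<pi> A v)) (at 0)"
    by (rule limit_cong) (use key in \<open>auto simp: eventually_at_filter\<close>)
  then have "d\<pi> A (d\<pi> B v) = d\<pi> (lie_bracket A B) v + d\<pi> B (d\<pi> A v)"
    using A B v unfolding g_def by (intro deriv_eqI) auto
  then show ?thesis
    by simp
qed

end

section \<open>The complexified derived representation\<close>

lemma lie_bracket_complex:
  "lie_bracket (A + \<i> *\<^sub>C B) (A' + \<i> *\<^sub>C B')
   = (lie_bracket A A' + (-1) *\<^sub>R lie_bracket B B') + \<i> *\<^sub>C (lie_bracket A B' + lie_bracket B A')"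
  unfolding lie_bracket_def scaleR_cmat_conv by (rule cmat_eqI; simp add: algebra_simps)

lemma cscale_complex:
  "c *\<^sub>C (A + \<i> *\<^sub>C B) = (Re c *\<^sub>R A + (- Im c) *\<^sub>R B) + \<i> *\<^sub>C (Im c *\<^sub>R A + Re c *\<^sub>R (B :: cmat))"
  unfolding scaleR_cmat_conv by (rule cmat_eqI; simp add: complex_eq_iff algebra_simps)

context smooth_representation
begin

abbreviation "d \<equiv> complex_deriv_act G R"

text \<open>
  The definite description is meaningful because a matrix has only one decomposition into a real and an
  imaginary part.
\<close>

lemma cderiv_eq:
  assumes "A \<in> \<gg>" "B \<in> \<gg>"
  shows "d (A + \<i> *\<^sub>C B) v = d\<pi> A v + \<i> *\<^sub>C d\<pi> B v"
  unfolding complex_deriv_act_def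
proof (rule the_equality)
  fix w
  assume "\<exists>A'\<in>\<gg>. \<exists>B'\<in>\<gg>. A + \<i> *\<^sub>C B = A' + \<i> *\<^sub>C B' \<and> w = d\<pi> A' v + \<i> *\<^sub>C d\<pi> B' v"
  then show "w = d\<pi> A v + \<i> *\<^sub>C d\<pi> B v"
    using complex_decomposition_unique[OF assms] by blast
qed (use assms in blast)

lemma cderiv_real: "A \<in> \<gg> \<Longrightarrow> d A v = d\<pi> A v" if "v \<in> V"
  using cderiv_eq[of A 0 v] deriv_scaleR[of A v 0] that by (simp add: lie_algebra_0)

lemma cderiv_in [simp]:
  assumes "Z \<in> sl2C" "v \<in> V" shows "d Z v \<in> V"
proof -
  obtain A B where "A \<in> \<gg>" "B \<in> \<gg>" "Z = A + \<i> *\<^sub>C B"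
    using complex_decomposition[OF assms(1)] .
  then show ?thesis
    using assms by (simp add: cderiv_eq)
qed

lemma cderiv_add:
  assumes "Z \<in> sl2C" "v \<in> V" "w \<in> V" shows "d Z (v + w) = d Z v + d Z w"
proof -
  obtain A B where "A \<in> \<gg>" "B \<in> \<gg>" "Z = A + \<i> *\<^sub>C B"
    using complex_decomposition[OF assms(1)] .
  then show ?thesis
    using assms by (simp add: cderiv_eq deriv_add scaleC_add_right)
qed

lemma cderiv_scale:
  assumes "Z \<in> sl2C" "v \<in> V" shows "d Z (c *\<^sub>C v) = c *\<^sub>C d Z v"
proof -
  obtain A B where "A \<in> \<gg>" "B \<in> \<gg>" "Z = A + \<i> *\<^sub>C B"
    using complex_decomposition[OF assms(1)] .
  then show ?thesis
    using assms by (simp add: cderiv_eq deriv_scale scaleC_add_right scaleC_scaleC mult.commute)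
qed

lemma cderiv_scale_left:
  assumes "Z \<in> sl2C" "v \<in> V" shows "d (c *\<^sub>C Z) v = c *\<^sub>C d Z v"
proof -
  obtain A B where Z: "A \<in> \<gg>" "B \<in> \<gg>" "Z = A + \<i> *\<^sub>C B"
    using complex_decomposition[OF assms(1)] .
  have "d (c *\<^sub>C Z) v = (of_real (Re c) *\<^sub>C d\<pi> A v + of_real (- Im c) *\<^sub>C d\<pi> B v)
      + \<i> *\<^sub>C (of_real (Im c) *\<^sub>C d\<pi> A v + of_real (Re c) *\<^sub>C d\<pi> B v)"
    unfolding Z(3) cscale_complex using Z(1,2) assms(2)
    by (simp only: cderiv_eq lie_algebra_add lie_algebra_scaleR deriv_add_left deriv_scaleR)
  also have "\<dots> = (of_real (Re c) + \<i> * of_real (Im c)) *\<^sub>C d\<pi> A v + (of_real (- Im c) + \<i> * of_real (Re c)) *\<^sub>C d\<pi> B v"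
    by (simp only: scaleC_add_left scaleC_add_right scaleC_scaleC add_ac)
  also have "of_real (Re c) + \<i> * of_real (Im c) = c"
    by (simp add: complex_eq_iff)
  also have "of_real (- Im c) + \<i> * of_real (Re c) = c * \<i>"
    by (simp add: complex_eq_iff)
  finally show ?thesis
    using Z by (simp add: cderiv_eq scaleC_add_right scaleC_scaleC)
qed

lemma cderiv_bracket:
  assumes "Z \<in> sl2C" "W \<in> sl2C" "v \<in> V"
  shows "d (lie_bracket Z W) v = d Z (d W v) - d W (d Z v)"
proof -
  obtain A B where Z: "A \<in> \<gg>" "B \<in> \<gg>" "Z = A + \<i> *\<^sub>C B"
    using complex_decomposition[OF assms(1)] .
  obtain A' B' where W: "A' \<in> \<gg>" "B' \<in> \<gg>" "W = A' + \<i> *\<^sub>C B'"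
    using complex_decomposition[OF assms(2)] .
  have "d (lie_bracket Z W) v = (d\<pi> (lie_bracket A A') v + of_real (-1) *\<^sub>C d\<pi> (lie_bracket B B') v)
      + \<i> *\<^sub>C (d\<pi> (lie_bracket A B') v + d\<pi> (lie_bracket B A') v)"
    unfolding Z(3) W(3) lie_bracket_complex using Z(1,2) W(1,2) assms(3)
    by (simp only: cderiv_eq lie_algebra_add lie_algebra_scaleR lie_bracket_in_lie_algebra
        deriv_add_left deriv_scaleR)
  then show ?thesis
    using Z W assms(3)
    by (simp add: cderiv_eq deriv_bracket deriv_add deriv_scale scaleC_add_right scaleC_scaleC
        complex_vector.scale_right_diff_distrib algebra_simps)
qed

text \<open>
  Rewrite rules that move \<open>Y\<close> to the left of \<open>X\<close> and of \<open>H\<close>, and \<open>X\<close> to the left of \<open>H\<close>.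
\<close>

lemma triple_relations:
  assumes "sl2_triple H X Y" "v \<in> V"
  shows "d H (d X v) = d X (d H v) + 2 *\<^sub>C d X v"
    and "d H (d Y v) = d Y (d H v) - 2 *\<^sub>C d Y v"
    and "d X (d Y v) = d Y (d X v) + d H v"
proof -
  have sl: "H \<in> sl2C" "X \<in> sl2C" "Y \<in> sl2C"
    and br: "lie_bracket H X = 2 *\<^sub>C X" "lie_bracket H Y = (-2) *\<^sub>C Y" "lie_bracket X Y = H"
    using assms(1) by (auto simp: sl2_triple_def)
  show "d H (d X v) = d X (d H v) + 2 *\<^sub>C d X v"
    using cderiv_bracket[OF sl(1,2) assms(2)] cderiv_scale_left[OF sl(2) assms(2), of 2]
    unfolding br by (simp add: algebra_simps)
  show "d H (d Y v) = d Y (d H v) - 2 *\<^sub>C d Y v"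
    using cderiv_bracket[OF sl(1,3) assms(2)] cderiv_scale_left[OF sl(3) assms(2), of "-2"]
    unfolding br by (simp add: algebra_simps)
  show "d X (d Y v) = d Y (d X v) + d H v"
    using cderiv_bracket[OF sl(2,3) assms(2)]
    unfolding br by (simp add: algebra_simps)
qed

end

section \<open>The tensor product with the natural representation\<close>

text \<open>
  A pair stands for \<open>v \<otimes> e\<^sub>1 + w \<otimes> e\<^sub>2\<close>; the \<open>i\<close>-th row of \<open>P\<close>, as a linear form on \<open>\<complex>\<^sup>2\<close>, is
  applied to the second tensor factor. For invertible \<open>P\<close> the two values are the coordinates of the
  pair with respect to another basis of \<open>\<complex>\<^sup>2\<close>.
\<close>

definition row_form :: "cmat \<Rightarrow> 2 \<Rightarrow> 'a::complex_vector \<times> 'a \<Rightarrow> 'a" where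
  "row_form P i x = P $ i $ 1 *\<^sub>C fst x + P $ i $ 2 *\<^sub>C snd x"

context smooth_representation
begin

text \<open>The product rule, for a pure tensor and one of its components.\<close>

lemma scaled_orbit_limit:
  assumes A: "A \<in> \<gg>" and u: "u \<in> V"
  shows "limitin T (\<lambda>t. complex_of_real (1 / t) *\<^sub>C
      (matrix_exp (t *\<^sub>R A) $ i $ j *\<^sub>C \<pi> (matrix_exp (t *\<^sub>R A)) u - mat 1 $ i $ j *\<^sub>C u))
    (mat 1 $ i $ j *\<^sub>C d\<pi> A u + A $ i $ j *\<^sub>C u) (at 0)"
proof -
  have lim: "limitin T (\<lambda>t. matrix_exp (t *\<^sub>R A) $ i $ j *\<^sub>C (complex_of_real (1 / t) *\<^sub>C (\<pi> (matrix_exp (t *\<^sub>R A)) u - u))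
     + (complex_of_real (1 / t) * (matrix_exp (t *\<^sub>R A) $ i $ j - mat 1 $ i $ j)) *\<^sub>C u)
    (mat 1 $ i $ j *\<^sub>C d\<pi> A u + A $ i $ j *\<^sub>C u) (at 0)"
    using u by (intro limit_add limit_scale exp_entry_limits deriv_limit A) (simp_all add: limitin_const_iff)
  have eq: "e *\<^sub>C (c *\<^sub>C (a - u)) + (c * (e - k)) *\<^sub>C u = c *\<^sub>C (e *\<^sub>C a - k *\<^sub>C u)" for c e k a
    by (simp only: complex_vector.scale_right_diff_distrib complex_vector.scale_left_diff_distrib
        right_diff_distrib scaleC_scaleC mult.commute) simp
  show ?thesis
    using lim unfolding eq .
qed

lemma tensor_component_limit:
  assumes A: "A \<in> \<gg>" and v: "v \<in> V" "w \<in> V"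
  shows "limitin T (\<lambda>t. complex_of_real (1 / t) *\<^sub>C
      (matrix_exp (t *\<^sub>R A) $ i $ 1 *\<^sub>C \<pi> (matrix_exp (t *\<^sub>R A)) v
       + matrix_exp (t *\<^sub>R A) $ i $ 2 *\<^sub>C \<pi> (matrix_exp (t *\<^sub>R A)) w
       - (mat 1 $ i $ 1 *\<^sub>C v + mat 1 $ i $ 2 *\<^sub>C w)))
    (mat 1 $ i $ 1 *\<^sub>C d\<pi> A v + A $ i $ 1 *\<^sub>C v + (mat 1 $ i $ 2 *\<^sub>C d\<pi> A w + A $ i $ 2 *\<^sub>C w)) (at 0)"
proof -
  have sum: "c *\<^sub>C (a - a') + c *\<^sub>C (b - b') = c *\<^sub>C (a + b - (a' + b'))" for c and a a' b b' :: 'v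
    by (simp only: scaleC_add_right complex_vector.scale_right_diff_distrib) simp
  show ?thesis
    using limit_add[OF scaled_orbit_limit[OF A v(1), of i 1] scaled_orbit_limit[OF A v(2), of i 2]]
    unfolding sum .
qed

lemma tensor_deriv:
  assumes A: "A \<in> \<gg>" and v: "v \<in> V" "w \<in> V"
  shows "deriv_act (tensor_C2 R) A (v, w)
    = (d\<pi> A v + (A $ 1 $ 1 *\<^sub>C v + A $ 1 $ 2 *\<^sub>C w), d\<pi> A w + (A $ 2 $ 1 *\<^sub>C v + A $ 2 $ 2 *\<^sub>C w))"
    (is "_ = ?D")
proof -
  let ?q = "\<lambda>t. complex_of_real (1 / t) *\<^sub>C (rep_act (tensor_C2 R) (matrix_exp (t *\<^sub>R A)) (v, w) - (v, w))"
  have lim: "limitin (prod_topology T T) ?q ?D (at 0)"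
    unfolding limitin_pairwise
    using tensor_component_limit[OF assms, of 1] tensor_component_limit[OF assms, of 2]
    by (simp add: o_def tensor_C2_def scaleC_prod_def mat_entry scaleC_one add_ac)
  show ?thesis
    unfolding deriv_act_def[of "tensor_C2 R"]
  proof (rule the_equality)
    show "limitin (rep_top (tensor_C2 R)) ?q ?D (at 0)"
      using lim by (simp add: tensor_C2_def)
  next
    fix u
    assume "limitin (rep_top (tensor_C2 R)) ?q u (at 0)"
    then have "limitin (prod_topology T T) ?q u (at 0)"
      by (simp add: tensor_C2_def)
    with lim show "u = ?D"
      unfolding limitin_pairwise by (auto intro!: prod_eqI dest: limit_unique)
  qed
qed

abbreviation "dt \<equiv> complex_deriv_act G (tensor_C2 R)"

lemma tensor_cderiv:
  assumes Z: "Z \<in> sl2C" and v: "v \<in> V" "w \<in> V"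
  shows "dt Z (v, w)
    = (d Z v + (Z $ 1 $ 1 *\<^sub>C v + Z $ 1 $ 2 *\<^sub>C w), d Z w + (Z $ 2 $ 1 *\<^sub>C v + Z $ 2 $ 2 *\<^sub>C w))"
proof -
  obtain A B where AB: "A \<in> \<gg>" "B \<in> \<gg>" "Z = A + \<i> *\<^sub>C B"
    using complex_decomposition[OF Z] .
  have "dt (A + \<i> *\<^sub>C B) (v, w) = deriv_act (tensor_C2 R) A (v, w) + \<i> *\<^sub>C deriv_act (tensor_C2 R) B (v, w)"
    unfolding complex_deriv_act_def
  proof (rule the_equality)
    fix u
    assume "\<exists>A'\<in>\<gg>. \<exists>B'\<in>\<gg>. A + \<i> *\<^sub>C B = A' + \<i> *\<^sub>C B' \<and>
      u = deriv_act (tensor_C2 R) A' (v, w) + \<i> *\<^sub>C deriv_act (tensor_C2 R) B' (v, w)"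
    then show "u = deriv_act (tensor_C2 R) A (v, w) + \<i> *\<^sub>C deriv_act (tensor_C2 R) B (v, w)"
      using complex_decomposition_unique[OF AB(1,2)] by blast
  qed (use AB in blast)
  then show ?thesis
    using AB v by (simp add: tensor_deriv cderiv_eq scaleC_prod_def scaleC_add_right scaleC_add_left
        scaleC_scaleC add_ac)
qed

lemma row_form_cderiv:
  assumes Z: "Z \<in> sl2C" and x: "x \<in> V \<times> V"
  shows "row_form P i (dt Z x) = d Z (row_form P i x) + row_form (P ** Z) i x"
  using assms by (cases x) (simp add: row_form_def tensor_cderiv cderiv_add cderiv_scale
      scaleC_add_right scaleC_add_left scaleC_scaleC add_ac)

lemma tensor_cderiv_in: "Z \<in> sl2C \<Longrightarrow> x \<in> V \<times> V \<Longrightarrow> dt Z x \<in> V \<times> V"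
  by (cases x) (auto simp: tensor_cderiv)

lemma row_form_in: "x \<in> V \<times> V \<Longrightarrow> row_form P i x \<in> V"
  by (auto simp: row_form_def)

end

lemma row_form_add: "row_form P i (x + y) = row_form P i x + row_form P i y"
  and row_form_scale: "row_form P i (c *\<^sub>C x) = c *\<^sub>C row_form P i x"
  by (simp_all add: row_form_def scaleC_add_right scaleC_add_left scaleC_prod_def scaleC_scaleC mult.commute add_ac)

text \<open>
  How the standard triple acts on the coordinates: the first one has weight \<open>1\<close>, the second one has
  weight \<open>-1\<close>, and \<open>X\<close> and \<open>Y\<close> exchange them.
\<close>

lemma row_form_standard:
  "row_form (D2 ** P) 1 x = row_form P 1 x" "row_form (D2 ** P) 2 x = - row_form P 2 x"
  "row_form (X2 ** P) 1 x = row_form P 2 x" "row_form (X2 ** P) 2 x = 0"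
  "row_form (Y2 ** P) 1 x = 0" "row_form (Y2 ** P) 2 x = row_form P 1 x"
  by (simp_all add: row_form_def)

lemma row_form_eqI:
  assumes "Q ** P = mat 1" "row_form P 1 x = row_form P 1 y" "row_form P 2 x = row_form P 2 y"
  shows "x = y"
proof -
  have e: "row_form (Q ** P) i z = Q $ i $ 1 *\<^sub>C row_form P 1 z + Q $ i $ 2 *\<^sub>C row_form P 2 z" for i and z :: "'a \<times> 'a"
    by (simp add: row_form_def scaleC_add_right scaleC_add_left scaleC_scaleC add_ac)
  have "row_form (mat 1) i x = row_form (mat 1) i y" for i
    unfolding assms(1)[symmetric] e assms(2,3) ..
  from this[of 1] this[of 2] show ?thesis
    by (simp add: row_form_def mat_entry scaleC_one prod_eq_iff)
qed

lemma row_form_surj: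
  assumes "P ** Q = mat 1"
  shows "row_form P 1 (row_form Q 1 (a, b), row_form Q 2 (a, b)) = a"
    "row_form P 2 (row_form Q 1 (a, b), row_form Q 2 (a, b)) = b"
proof -
  have e: "row_form P i (row_form Q 1 (a, b), row_form Q 2 (a, b)) = row_form (P ** Q) i (a, b)" for i
    by (simp add: row_form_def scaleC_add_right scaleC_add_left scaleC_scaleC add_ac)
  show "row_form P 1 (row_form Q 1 (a, b), row_form Q 2 (a, b)) = a"
    "row_form P 2 (row_form Q 1 (a, b), row_form Q 2 (a, b)) = b"
    unfolding e assms by (simp_all add: row_form_def mat_entry scaleC_one)
qed

text \<open>
  Expanding numerals into sums turns identities between linear combinations into identities in an
  abelian group, which the simplifier decides.
\<close>

lemma scaleC_numerals:
  "(2 * c) *\<^sub>C u = c *\<^sub>C u + c *\<^sub>C u" "2 *\<^sub>C u = u + u" "3 *\<^sub>C u = u + u + u" "4 *\<^sub>C u = u + u + u + u"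
  using scaleC_add_left[of c c u] scaleC_add_left[of 1 1 u] scaleC_add_left[of 2 1 u] scaleC_add_left[of 2 2 u]
  by (simp_all add: scaleC_one)

lemmas scaleC_expand = scaleC_add_right scaleC_add_left complex_vector.scale_right_diff_distrib
  complex_vector.scale_left_diff_distrib scaleC_one scaleC_numerals

context smooth_representation
begin

lemma cderiv_diff:
  assumes "Z \<in> sl2C" "v \<in> V" "w \<in> V" shows "d Z (v - w) = d Z v - d Z w"
  using cderiv_add[of Z v "- w"] cderiv_scale[of Z w "-1"] assms by simp

lemma casimir_expand:
  assumes tri: "sl2_triple H X Y" and v: "v \<in> V"
    and cas: "has_infinitesimal_character G H X Y R \<mu>"
  shows "d H (d H v) + 4 *\<^sub>C d Y (d X v) + 2 *\<^sub>C d H v = (\<mu>\<^sup>2 - 1) *\<^sub>C v"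
proof -
  have "4 *\<^sub>C u = 2 *\<^sub>C u + 2 *\<^sub>C u" for u :: 'v
    by (simp flip: scaleC_add_left)
  moreover have "d H (d H v) + 2 *\<^sub>C (d X (d Y v) + d Y (d X v)) = (\<mu>\<^sup>2 - 1) *\<^sub>C v"
    using cas v by (simp add: has_infinitesimal_character_def casimir_act_def Let_def)
  ultimately show ?thesis
    using triple_relations(3)[OF tri v] by (simp add: scaleC_add_right algebra_simps)
qed

text \<open>
  In the coordinates \<open>a\<close> and \<open>b\<close> the mixed terms of the Casimir operator are twice the operator
  \<open>M (a, b) = (Ha + 2Yb, 2Xa - Hb)\<close>, and the two equations say that \<open>(a, b)\<close> is an eigenvector of \<open>M\<close>
  for the eigenvalue \<open>\<mu> - 1\<close>.
\<close>

lemma tensor_casimir: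
  assumes tri: "sl2_triple H X Y" and PQ: "P ** Q = mat 1" "Q ** P = mat 1"
    and PH: "P ** H = D2 ** P" and PX: "P ** X = X2 ** P" and PY: "P ** Y = Y2 ** P"
    and cas: "has_infinitesimal_character G H X Y R \<mu>"
    and x: "x \<in> V \<times> V" and a: "a = row_form P 1 x" and b: "b = row_form P 2 x"
    and a': "d H a + 2 *\<^sub>C d Y b = (\<mu> - 1) *\<^sub>C a"
    and b': "2 *\<^sub>C d X a - d H b = (\<mu> - 1) *\<^sub>C b"
  shows "casimir_act G H X Y (tensor_C2 R) x = ((\<mu> + 1)\<^sup>2 - 1) *\<^sub>C x"
proof -
  have sl: "H \<in> sl2C" "X \<in> sl2C" "Y \<in> sl2C"
    using tri by (auto simp: sl2_triple_def)
  have V: "a \<in> V" "b \<in> V"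
    using x by (auto simp: a b row_form_in)
  have rH: "row_form P 1 (dt H y) = d H (row_form P 1 y) + row_form P 1 y"
      "row_form P 2 (dt H y) = d H (row_form P 2 y) - row_form P 2 y"
    and rX: "row_form P 1 (dt X y) = d X (row_form P 1 y) + row_form P 2 y"
      "row_form P 2 (dt X y) = d X (row_form P 2 y)"
    and rY: "row_form P 1 (dt Y y) = d Y (row_form P 1 y)"
      "row_form P 2 (dt Y y) = d Y (row_form P 2 y) + row_form P 1 y"
    if "y \<in> V \<times> V" for y
    using that by (simp_all add: row_form_cderiv sl PH PX PY row_form_standard)
  note simps = rH rX rY tensor_cderiv_in sl x V row_form_add row_form_scale cderiv_add cderiv_diff
    a[symmetric] b[symmetric]
  have casimir: "d H (d H v) + 2 *\<^sub>C (d X (d Y v) + d Y (d X v)) = (\<mu>\<^sup>2 - 1) *\<^sub>C v" if "v \<in> V" for v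
    using cas that by (simp add: has_infinitesimal_character_def casimir_act_def Let_def)
  have "row_form P 1 (casimir_act G H X Y (tensor_C2 R) x)
      = (d H (d H a) + 2 *\<^sub>C (d X (d Y a) + d Y (d X a))) + 2 *\<^sub>C (d H a + 2 *\<^sub>C d Y b) + 3 *\<^sub>C a"
    by (simp add: casimir_act_def Let_def simps scaleC_expand)
  also have "\<dots> = ((\<mu> + 1)\<^sup>2 - 1) *\<^sub>C a"
    unfolding casimir[OF V(1)] a' scaleC_scaleC scaleC_add_left[symmetric]
    by (simp add: power2_eq_square algebra_simps)
  finally have 1: "row_form P 1 (casimir_act G H X Y (tensor_C2 R) x) = ((\<mu> + 1)\<^sup>2 - 1) *\<^sub>C a" .
  have "row_form P 2 (casimir_act G H X Y (tensor_C2 R) x)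
      = (d H (d H b) + 2 *\<^sub>C (d X (d Y b) + d Y (d X b))) + 2 *\<^sub>C (2 *\<^sub>C d X a - d H b) + 3 *\<^sub>C b"
    by (simp add: casimir_act_def Let_def simps scaleC_expand)
  also have "\<dots> = ((\<mu> + 1)\<^sup>2 - 1) *\<^sub>C b"
    unfolding casimir[OF V(2)] b' scaleC_scaleC scaleC_add_left[symmetric]
    by (simp add: power2_eq_square algebra_simps)
  finally have 2: "row_form P 2 (casimir_act G H X Y (tensor_C2 R) x) = ((\<mu> + 1)\<^sup>2 - 1) *\<^sub>C b" .
  show ?thesis
    by (rule row_form_eqI[OF PQ(2)]) (simp_all add: 1 2 row_form_scale a b)
qed

lemma primary_componentI:
  assumes "x \<in> V \<times> V" "casimir_act G H X Y (tensor_C2 R) x = ((\<mu> + 1)\<^sup>2 - 1) *\<^sub>C x" "\<tau>\<^sup>2 = (\<mu> + 1)\<^sup>2"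
  shows "x \<in> rep_space (primary_component G H X Y \<tau> (tensor_C2 R))"
  using assms by (auto simp: primary_component_def subrep_def tensor_C2_def intro!: exI[of _ 1])

text \<open>
  These are the vectors \<open>(M + 1 + \<mu>) (v, 0)\<close> and \<open>(M + 1 + \<mu>) (0, v)\<close>, which \<open>M + 1 - \<mu>\<close>
  annihilates because \<open>(M + 1)\<^sup>2 = \<mu>\<^sup>2\<close>. Only the coordinate that the translated functional evaluates
  is recorded.
\<close>

lemma primary_component_vectors:
  assumes tri: "sl2_triple H X Y" and PQ: "P ** Q = mat 1" "Q ** P = mat 1"
    and PH: "P ** H = D2 ** P" and PX: "P ** X = X2 ** P" and PY: "P ** Y = Y2 ** P"
    and cas: "has_infinitesimal_character G H X Y R \<mu>"
    and \<tau>: "\<tau>\<^sup>2 = (\<mu> + 1)\<^sup>2" and v: "v \<in> V"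
  shows "\<exists>x \<in> rep_space (primary_component G H X Y \<tau> (tensor_C2 R)). x \<in> V \<times> V \<and>
      row_form P 1 x = d H v + (1 + \<mu>) *\<^sub>C v" (is ?A)
    and "\<exists>x \<in> rep_space (primary_component G H X Y \<tau> (tensor_C2 R)). x \<in> V \<times> V \<and>
      row_form P 2 x = (1 + \<mu>) *\<^sub>C v - d H v" (is ?B)
proof -
  have sl: "H \<in> sl2C" "X \<in> sl2C" "Y \<in> sl2C"
    using tri by (auto simp: sl2_triple_def)
  define mk where "mk a b = (row_form Q 1 (a, b), row_form Q 2 (a, b))" for a b :: 'v
  have mk: "mk a b \<in> V \<times> V" if "a \<in> V" "b \<in> V" for a b
    using that by (auto simp: mk_def row_form_in)
  have rows: "row_form P 1 (mk a b) = a" "row_form P 2 (mk a b) = b" for a b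
    unfolding mk_def by (rule row_form_surj[OF PQ(1)])+
  have mem: "mk a b \<in> rep_space (primary_component G H X Y \<tau> (tensor_C2 R))"
    if "a \<in> V" "b \<in> V" "d H a + 2 *\<^sub>C d Y b = (\<mu> - 1) *\<^sub>C a" "2 *\<^sub>C d X a - d H b = (\<mu> - 1) *\<^sub>C b" for a b
    by (rule primary_componentI[OF mk[OF that(1,2)] tensor_casimir[OF tri PQ PH PX PY cas mk[OF that(1,2)] refl refl] \<tau>])
      (simp_all add: rows that)
  note rel = triple_relations[OF tri v]
  note lin = cderiv_add cderiv_diff cderiv_scale sl v
  show ?A
  proof (intro bexI conjI)
    define a where "a = d H v + (1 + \<mu>) *\<^sub>C v"
    define b where "b = 2 *\<^sub>C d X v"
    have ab: "a \<in> V" "b \<in> V"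
      using sl v by (auto simp: a_def b_def)
    show "row_form P 1 (mk a b) = d H v + (1 + \<mu>) *\<^sub>C v"
      by (simp add: rows a_def)
    show "mk a b \<in> V \<times> V"
      by (rule mk[OF ab])
    show "mk a b \<in> rep_space (primary_component G H X Y \<tau> (tensor_C2 R))"
    proof (rule mem[OF ab])
      have "d H a + 2 *\<^sub>C d Y b = (d H (d H v) + 4 *\<^sub>C d Y (d X v) + 2 *\<^sub>C d H v) + (\<mu> - 1) *\<^sub>C d H v"
        by (simp add: a_def b_def lin rel(1) scaleC_expand)
      then show "d H a + 2 *\<^sub>C d Y b = (\<mu> - 1) *\<^sub>C a"
        unfolding casimir_expand[OF tri v cas] a_def
        by (simp add: scaleC_add_right scaleC_scaleC power2_eq_square algebra_simps)
      show "2 *\<^sub>C d X a - d H b = (\<mu> - 1) *\<^sub>C b"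
        by (simp add: a_def b_def lin rel(1) scaleC_expand)
    qed
  qed
  show ?B
  proof (intro bexI conjI)
    define a where "a = 2 *\<^sub>C d Y v"
    define b where "b = (1 + \<mu>) *\<^sub>C v - d H v"
    have ab: "a \<in> V" "b \<in> V"
      using sl v by (auto simp: a_def b_def)
    show "row_form P 2 (mk a b) = (1 + \<mu>) *\<^sub>C v - d H v"
      by (simp add: rows b_def)
    show "mk a b \<in> V \<times> V"
      by (rule mk[OF ab])
    show "mk a b \<in> rep_space (primary_component G H X Y \<tau> (tensor_C2 R))"
    proof (rule mem[OF ab])
      show "d H a + 2 *\<^sub>C d Y b = (\<mu> - 1) *\<^sub>C a"
        by (simp add: a_def b_def lin rel(2) scaleC_expand)
      show "2 *\<^sub>C d X a - d H b = (\<mu> - 1) *\<^sub>C b"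
        using casimir_expand[OF tri v cas] by (simp add: a_def b_def lin rel(3) scaleC_expand power2_eq_square algebra_simps)
    qed
  qed
qed

end

section \<open>Dimensions and multiplicities\<close>

lemma clinear_on_sum:
  assumes "clinear_on A F" "complex_vector.subspace A" "finite S" "S \<subseteq> A"
  shows "(\<Sum>b\<in>S. u b *\<^sub>C b) \<in> A \<and> F (\<Sum>b\<in>S. u b *\<^sub>C b) = (\<Sum>b\<in>S. u b *\<^sub>C F b)"
  using assms(3,4)
proof (induction S)
  case empty
  have "F (0 *\<^sub>C 0) = 0 *\<^sub>C F 0"
    using assms(1) complex_vector.subspace_0[OF assms(2)] unfolding clinear_on_def by blast
  then show ?case
    using complex_vector.subspace_0[OF assms(2)] by simp
next
  case (insert b S)
  then show ?case
    using assms(1,2) unfolding clinear_on_def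
    by (simp add: complex_vector.subspace_add complex_vector.subspace_scale)
qed

text \<open>
  The map \<open>F\<close> carries a basis of \<open>A\<close> to an independent subset of \<open>B\<close>. It is linear only on \<open>A\<close>, so the
  independence is checked on explicit linear combinations.
\<close>

lemma cdim_le_if_injective:
  assumes lin: "clinear_on A F" and sub: "complex_vector.subspace A" and into: "F ` A \<subseteq> B"
    and inj: "\<And>f. f \<in> A \<Longrightarrow> F f = 0 \<Longrightarrow> f = 0"
  shows "cdim A \<le> cdim B"
proof (cases "\<exists>C. finite C \<and> B \<subseteq> complex_vector.span C")
  case False
  then have "cdim B = \<infinity>"
    unfolding cdim_def by (rule if_not_P)
  then show ?thesis by simp
next
  case True
  then obtain C where C: "finite C" "B \<subseteq> complex_vector.span C"
    by blast
  obtain D where D: "D \<subseteq> B" "complex_vector.independent D" "B \<subseteq> complex_vector.span D" "card D = complex_vector.dim B"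
    using complex_vector.basis_exists[of B] by metis
  have finD: "finite D"
    using complex_vector.independent_span_bound[OF C(1) D(2)] D(1) C(2) by blast
  obtain E where E: "E \<subseteq> A" "complex_vector.independent E" "A \<subseteq> complex_vector.span E" "card E = complex_vector.dim A"
    using complex_vector.basis_exists[of A] by metis
  have diff: "x - y \<in> A \<and> F (x - y) = F x - F y" if "x \<in> A" "y \<in> A" for x y
  proof -
    have y: "(-1) *\<^sub>C y \<in> A"
      using sub that by (intro complex_vector.subspace_scale)
    then have "F (x + (-1) *\<^sub>C y) = F x + (-1) *\<^sub>C F y"
      using lin that unfolding clinear_on_def by metis
    then show ?thesis
      using complex_vector.subspace_diff[OF sub that] by simp
  qed
  have injE: "inj_on F E"
    by (rule inj_onI) (metis E(1) diff eq_iff_diff_eq_0 inj subsetD)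
  have "complex_vector.independent (F ` E)"
    unfolding complex_vector.dependent_explicit
  proof safe
    fix S u y
    assume S: "finite S" "S \<subseteq> F ` E" and z: "(\<Sum>v\<in>S. u v *\<^sub>C v) = 0" and y: "y \<in> S" "u y \<noteq> 0"
    obtain S' where S': "S' \<subseteq> E" "finite S'" "S = F ` S'"
      using finite_subset_image[OF S] by metis
    have inj': "inj_on F S'"
      using injE S'(1) by (rule inj_on_subset)
    have mem: "(\<Sum>b\<in>S'. u (F b) *\<^sub>C b) \<in> A" and "F (\<Sum>b\<in>S'. u (F b) *\<^sub>C b) = (\<Sum>b\<in>S'. u (F b) *\<^sub>C F b)"
      using clinear_on_sum[OF lin sub S'(2), of "\<lambda>b. u (F b)"] S'(1) E(1) by auto
    moreover have "(\<Sum>b\<in>S'. u (F b) *\<^sub>C F b) = 0"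
      using z unfolding S'(3) by (simp add: sum.reindex[OF inj'])
    ultimately have "F (\<Sum>b\<in>S'. u (F b) *\<^sub>C b) = 0"
      by simp
    then have "(\<Sum>b\<in>S'. u (F b) *\<^sub>C b) = 0"
      by (rule inj[OF mem])
    moreover obtain b where "b \<in> S'" "u (F b) \<noteq> 0"
      using y S'(3) by blast
    ultimately show False
      using E(2) S'(1,2) unfolding complex_vector.dependent_explicit by metis
  qed
  moreover have "F ` E \<subseteq> complex_vector.span D"
    using E(1) into D(3) by blast
  ultimately have b: "finite (F ` E) \<and> card (F ` E) \<le> card D"
    by (rule complex_vector.independent_span_bound[OF finD])
  then have "finite E"
    using injE finite_image_iff by blast
  then have "cdim A = enat (complex_vector.dim A)"
    using E(3) by (auto simp: cdim_def)
  moreover have "cdim B = enat (complex_vector.dim B)"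
    using True by (simp add: cdim_def)
  ultimately show ?thesis
    using b E(4) D(4) by (simp add: card_image[OF injE])
qed

lemma intertwiners_characterD:
  assumes "f \<in> intertwiners K R (character_rep \<psi>)"
  shows "v \<in> rep_space R \<Longrightarrow> w \<in> rep_space R \<Longrightarrow> f (v + w) = f v + f w"
    and "v \<in> rep_space R \<Longrightarrow> f (c *\<^sub>C v) = c * f v"
    and "continuous_map (rep_top R) euclidean f"
    and "g \<in> K \<Longrightarrow> v \<in> rep_space R \<Longrightarrow> f (rep_act R g v) = \<psi> g * f v"
    and "v \<notin> rep_space R \<Longrightarrow> f v = 0"
  using assms by (auto simp: intertwiners_def clinear_on_def character_rep_def scaleC_complex_def)

lemma intertwiners_characterI:
  assumes "\<And>v w. v \<in> rep_space R \<Longrightarrow> w \<in> rep_space R \<Longrightarrow> f (v + w) = f v + f w"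
    and "\<And>c v. v \<in> rep_space R \<Longrightarrow> f (c *\<^sub>C v) = c * f v"
    and "continuous_map (rep_top R) euclidean f"
    and "\<And>g v. g \<in> K \<Longrightarrow> v \<in> rep_space R \<Longrightarrow> f (rep_act R g v) = \<psi> g * f v"
    and "\<And>v. v \<notin> rep_space R \<Longrightarrow> f v = 0"
  shows "f \<in> intertwiners K R (character_rep \<psi>)"
  using assms by (auto simp: intertwiners_def clinear_on_def character_rep_def scaleC_complex_def)

lemma continuous_map_cmult:
  fixes f :: "'a \<Rightarrow> complex"
  shows "continuous_map X euclidean f \<Longrightarrow> continuous_map X euclidean (\<lambda>x. c * f x)"
  using continuous_map_compose[of X euclidean f euclidean "\<lambda>z. c * z"]
  by (auto simp: o_def intro!: continuous_intros)

lemma subspace_intertwiners_character: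
  "complex_vector.subspace (intertwiners K R (character_rep \<psi>))"
proof (rule complex_vector.subspaceI)
  show "0 \<in> intertwiners K R (character_rep \<psi>)"
    by (rule intertwiners_characterI) (auto simp: zero_fun_def)
  fix f f' and c :: complex
  assume f: "f \<in> intertwiners K R (character_rep \<psi>)"
  show "c *\<^sub>C f \<in> intertwiners K R (character_rep \<psi>)"
    by (rule intertwiners_characterI)
      (auto simp: scaleC_fun_def scaleC_complex_def intertwiners_characterD[OF f] algebra_simps
        intro!: continuous_map_cmult)
  assume f': "f' \<in> intertwiners K R (character_rep \<psi>)"
  show "f + f' \<in> intertwiners K R (character_rep \<psi>)"
    by (rule intertwiners_characterI)
      (auto simp: plus_fun_def intertwiners_characterD[OF f] intertwiners_characterD[OF f'] algebra_simps
        intro!: continuous_map_add)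
qed

context smooth_representation
begin

text \<open>
  Differentiate the equivariance along the one-parameter group of \<open>cH\<close>.
\<close>

lemma intertwiner_weight:
  assumes f: "f \<in> intertwiners G' R (character_rep \<psi>)" and ch: "is_character G' H \<nu> \<psi>"
    and c: "c \<noteq> 0" "c *\<^sub>C H \<in> lie_algebra G'" and G': "G' \<subseteq> G" and H: "H \<in> sl2C" and v: "v \<in> V"
  shows "f (d H v) = \<nu> * f v"
proof -
  note f = intertwiners_characterD[OF f]
  let ?g = "\<lambda>t::real. matrix_exp (t *\<^sub>R (c *\<^sub>C H))"
  have g: "?g t \<in> G'" for t
    using c by (simp add: lie_algebra_def)
  have cH: "c *\<^sub>C H \<in> \<gg>"
    using c G' by (auto simp: lie_algebra_def)
  have "limitin euclidean (f \<circ> (\<lambda>t. complex_of_real (1 / t) *\<^sub>C (\<pi> (?g t) v - v))) (f (d\<pi> (c *\<^sub>C H) v)) (at 0)"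
    by (rule continuous_map_limit[OF f(3) deriv_limit[OF cH v]])
  moreover have "f (complex_of_real (1 / t) *\<^sub>C (\<pi> (?g t) v - v)) = (1 / t) *\<^sub>R (\<psi> (?g t) - \<psi> (?g 0)) * f v" for t
  proof -
    have gG: "?g t \<in> G"
      using g G' by blast
    have "mat 1 \<in> G'"
      using g[of 0] by simp
    then have "\<psi> (mat 1) * f v = f v"
      using f(4)[of "mat 1" v] v by simp
    moreover have "f (\<pi> (?g t) v - v) = \<psi> (?g t) * f v - f v"
      using gG v f(1)[of "\<pi> (?g t) v" "- v"] f(2)[of v "-1"] f(4)[OF g v] by simp
    ultimately have "f (\<pi> (?g t) v - v) = (\<psi> (?g t) - \<psi> (?g 0)) * f v"
      by (simp add: left_diff_distrib)
    moreover have "f (complex_of_real (1 / t) *\<^sub>C (\<pi> (?g t) v - v)) = complex_of_real (1 / t) * f (\<pi> (?g t) v - v)"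
      using gG v by (intro f(2)) simp
    ultimately show ?thesis
      by (simp only: scaleR_conv_of_real mult.assoc)
  qed
  ultimately have "((\<lambda>t. (1 / t) *\<^sub>R (\<psi> (?g t) - \<psi> (?g 0)) * f v) \<longlongrightarrow> f (d\<pi> (c *\<^sub>C H) v)) (at 0)"
    by (simp add: o_def)
  moreover have "((\<lambda>t. (1 / t) *\<^sub>R (\<psi> (?g t) - \<psi> (?g 0)) * f v) \<longlongrightarrow> \<nu> * c * f v) (at 0)"
    using ch c by (intro tendsto_mult_right difference_quotient_limit) (simp add: is_character_def)
  ultimately have "f (d\<pi> (c *\<^sub>C H) v) = \<nu> * c * f v"
    using tendsto_unique[OF at_neq_bot] by blast
  moreover have "d\<pi> (c *\<^sub>C H) v = c *\<^sub>C d H v"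
    using cderiv_real[OF v cH] cderiv_scale_left[OF H v] by simp
  ultimately have "c * f (d H v) = c * (\<nu> * f v)"
    using f(2)[of "d H v" c] H v by (simp add: mult_ac)
  then show ?thesis
    using c(1) by simp
qed

lemma row_form_tensor_act:
  assumes "g \<in> G" "x \<in> V \<times> V"
  shows "row_form P i (rep_act (tensor_C2 R) g x) = \<pi> g (row_form (P ** g) i x)"
  using assms by (cases x) (simp add: row_form_def tensor_C2_def act_add act_scale
      scaleC_add_right scaleC_add_left scaleC_scaleC add_ac)

text \<open>
  The closure of \<open>W\<close> under addition, scaling and \<open>G\<close> comes from the isomorphism \<open>\<Phi>\<close> itself, which satisfies the homomorphism identities for all vectors of \<open>W\<close> and
  vanishes outside \<open>W\<close>: if, say, \<open>gx\<close> were not in \<open>W\<close>, then \<open>g (\<Phi> x) = \<Phi> (gx) = 0\<close>, hence \<open>x = 0\<close>, and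
  \<open>gx = 0 \<in> W\<close> after all.
\<close>

lemma isomorphism_inverse:
  assumes W0: "0 \<in> W"
    and top: "rep_space A = W" and act: "rep_act A = rep_act (tensor_C2 R)"
    and S: "frechet_rep G S" and iso: "rep_iso G A S"
  obtains \<Psi> where "continuous_map (rep_top S) (rep_top A) \<Psi>" "\<forall>y\<in>rep_space S. \<Psi> y \<in> W"
    "\<forall>x\<in>W. \<exists>y\<in>rep_space S. \<Psi> y = x"
    "\<forall>y\<in>rep_space S. \<forall>z\<in>rep_space S. \<Psi> (y + z) = \<Psi> y + \<Psi> z"
    "\<forall>c. \<forall>y\<in>rep_space S. \<Psi> (c *\<^sub>C y) = c *\<^sub>C \<Psi> y"
    "\<forall>g\<in>G. \<forall>y\<in>rep_space S. \<Psi> (rep_act S g y) = rep_act (tensor_C2 R) g (\<Psi> y)"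
proof -
  obtain \<Phi> where \<Phi>: "\<Phi> \<in> intertwiners G A S" and homeo: "homeomorphic_map (rep_top A) (rep_top S) \<Phi>"
    using iso unfolding rep_iso_def by blast
  have add: "\<Phi> (x + y) = \<Phi> x + \<Phi> y" and scale: "\<Phi> (c *\<^sub>C x) = c *\<^sub>C \<Phi> x" if "x \<in> W" "y \<in> W" for x y c
    using \<Phi> that by (auto simp: intertwiners_def clinear_on_def top)
  have equi: "\<Phi> (rep_act (tensor_C2 R) g x) = rep_act S g (\<Phi> x)" if "x \<in> W" "g \<in> G" for x g
    using \<Phi> that by (auto simp: intertwiners_def top act)
  have out: "\<Phi> x = 0" if "x \<notin> W" for x
    using \<Phi> that by (cases x) (simp add: intertwiners_def top)
  obtain \<Psi> where \<Psi>: "homeomorphic_maps (rep_top A) (rep_top S) \<Phi> \<Psi>"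
    using homeo homeomorphic_map_maps by blast
  have cont: "continuous_map (rep_top S) (rep_top A) \<Psi>" and \<Psi>\<Phi>: "\<And>x. x \<in> W \<Longrightarrow> \<Psi> (\<Phi> x) = x"
    and \<Phi>\<Psi>: "\<And>y. y \<in> rep_space S \<Longrightarrow> \<Phi> (\<Psi> y) = y" and c\<Phi>: "continuous_map (rep_top A) (rep_top S) \<Phi>"
    using \<Psi> by (auto simp: homeomorphic_maps_def top)
  have in_W: "\<Psi> y \<in> W" if "y \<in> rep_space S" for y
    using cont that top by (auto simp: continuous_map_def)
  have in_S: "\<Phi> x \<in> rep_space S" if "x \<in> W" for x
    using c\<Phi> that top by (auto simp: continuous_map_def)
  have \<Phi>0: "\<Phi> 0 = 0"
    using scale[OF W0 W0, of 0] by simp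
  have ker: "x = 0" if "x \<in> W" "\<Phi> x = 0" for x
    using \<Psi>\<Phi>[OF that(1)] \<Psi>\<Phi>[OF W0] \<Phi>0 that(2) by simp
  have scale_W: "c *\<^sub>C x \<in> W" if x: "x \<in> W" for c x
  proof (rule ccontr)
    assume n: "c *\<^sub>C x \<notin> W"
    then have "c *\<^sub>C \<Phi> x = 0"
      using scale[OF x x, of c] out by simp
    then have "c = 0 \<or> x = 0"
      using ker[OF x] by auto
    then show False
      using n W0 by auto
  qed
  have add_W: "x + y \<in> W" if x: "x \<in> W" and y: "y \<in> W" for x y
  proof (rule ccontr)
    assume n: "x + y \<notin> W"
    have m: "(-1) *\<^sub>C x \<in> W"
      by (rule scale_W[OF x])
    have "\<Phi> x + \<Phi> y = 0"
      using add[OF x y] out[OF n] by simp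
    then have "\<Phi> y = - \<Phi> x"
      by (simp add: eq_neg_iff_add_eq_0 add.commute)
    also have "- \<Phi> x = \<Phi> ((-1) *\<^sub>C x)"
      using scale[OF x x, of "-1"] by simp
    finally have "\<Phi> y = \<Phi> ((-1) *\<^sub>C x)" .
    then have "y = (-1) *\<^sub>C x"
      using \<Psi>\<Phi>[OF y] \<Psi>\<Phi>[OF m] by metis
    then show False
      using n W0 by simp
  qed
  have S': "rep_act S g (c *\<^sub>C y) = c *\<^sub>C rep_act S g y" "rep_act S g (rep_act S h y) = rep_act S (g ** h) y"
    "rep_act S (mat 1) y = y" "rep_act S g y \<in> rep_space S"
    if "g \<in> G" "h \<in> G" "y \<in> rep_space S" for g h c y
    using S that by (auto simp: frechet_rep_def clinear_on_def Pi_iff)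
  have act_W: "rep_act (tensor_C2 R) g x \<in> W" if x: "x \<in> W" and g: "g \<in> G" for x g
  proof (rule ccontr)
    assume n: "rep_act (tensor_C2 R) g x \<notin> W"
    have inv: "matrix_inv g \<in> G" "matrix_inv g ** g = mat 1"
      using inv_in_G[OF g] SL2C_inverse[of g] g by (auto simp: G_iff SL2C_def)
    have "rep_act S g (\<Phi> x) = 0"
      using equi[OF x g] out[OF n] by simp
    then have "\<Phi> x = rep_act S (matrix_inv g) 0"
      using S'(2)[OF inv(1) g in_S[OF x]] S'(3)[OF g g in_S[OF x]] inv(2) by simp
    also have "0 = 0 *\<^sub>C \<Phi> x"
      by simp
    also have "rep_act S (matrix_inv g) (0 *\<^sub>C \<Phi> x) = 0"
      using S'(1)[OF inv(1) g in_S[OF x], of 0] by simp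
    finally have "x = 0"
      using ker[OF x] by simp
    moreover have "rep_act (tensor_C2 R) g 0 = 0"
      using g act_0 by (simp add: tensor_C2_def zero_prod_def)
    ultimately show False
      using n W0 by simp
  qed
  show thesis
  proof (rule that[OF cont]; intro ballI allI)
    show "\<Psi> y \<in> W" if "y \<in> rep_space S" for y
      by (rule in_W[OF that])
    show "\<exists>y\<in>rep_space S. \<Psi> y = x" if "x \<in> W" for x
      using in_S[OF that] \<Psi>\<Phi>[OF that] by blast
    show "\<Psi> (y + z) = \<Psi> y + \<Psi> z" if "y \<in> rep_space S" "z \<in> rep_space S" for y z
    proof -
      have "\<Phi> (\<Psi> y + \<Psi> z) = y + z"
        using that by (simp add: add in_W \<Phi>\<Psi>)
      then show ?thesis
        using \<Psi>\<Phi>[OF add_W[OF in_W[OF that(1)] in_W[OF that(2)]]] by simp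
    qed
    show "\<Psi> (c *\<^sub>C y) = c *\<^sub>C \<Psi> y" if "y \<in> rep_space S" for c y
    proof -
      have "\<Phi> (c *\<^sub>C \<Psi> y) = c *\<^sub>C y"
        using scale[OF in_W[OF that] in_W[OF that], of c] that by (simp add: \<Phi>\<Psi>)
      then show ?thesis
        using \<Psi>\<Phi>[OF scale_W[OF in_W[OF that]]] by metis
    qed
    show "\<Psi> (rep_act S g y) = rep_act (tensor_C2 R) g (\<Psi> y)" if "g \<in> G" "y \<in> rep_space S" for g y
    proof -
      have "\<Phi> (rep_act (tensor_C2 R) g (\<Psi> y)) = rep_act S g y"
        using equi[OF in_W[OF that(2)] that(1)] that by (simp add: \<Phi>\<Psi>)
      then show ?thesis
        using \<Psi>\<Phi>[OF act_W[OF in_W[OF that(2)] that(1)]] by metis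
    qed
  qed
qed

text \<open>
  The comparison map sends \<open>f\<close> to the functional \<open>f \<otimes> \<alpha>\<close> on the primary component, transported to
  \<open>S\<close>. Here \<open>\<alpha>\<close> is the coordinate of weight \<open>\<nu>' - \<nu>\<close>. If the result is zero, evaluating it on the
  vectors of \<open>primary_component_vectors\<close> shows that \<open>(\<mu> + 1 \<plusminus> \<nu>) f v = 0\<close> for all \<open>v\<close>.
\<close>

lemma translation_multiplicity_le:
  assumes tri: "sl2_triple H X Y" and G': "G' \<subseteq> G"
    and c: "c \<noteq> 0" "c *\<^sub>C H \<in> lie_algebra G'"
    and one: "\<forall>g\<in>G'. \<exists>t::real. g = matrix_exp ((complex_of_real t * c) *\<^sub>C H)"
    and ch: "is_character G' H \<nu> \<psi>" and ch': "is_character G' H \<nu>' \<psi>'"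
    and cas: "has_infinitesimal_character G H X Y R \<mu>"
    and \<tau>: "\<tau>\<^sup>2 = (\<mu> + 1)\<^sup>2" and S: "frechet_rep G S"
    and iso: "rep_iso G (primary_component G H X Y \<tau> (tensor_C2 R)) S"
    and weight: "\<nu>' = \<nu> + 1 \<and> \<mu> + 1 + \<nu> \<noteq> 0 \<or> \<nu>' = \<nu> - 1 \<and> \<mu> + 1 - \<nu> \<noteq> 0"
  shows "multiplicity_of G' R \<psi> \<le> multiplicity_of G' S \<psi>'"
proof -
  obtain P Q where PQ: "P ** Q = mat 1" "Q ** P = mat 1"
    and PH: "P ** H = D2 ** P" and PX: "P ** X = X2 ** P" and PY: "P ** Y = Y2 ** P"
    using sl2_triple_diagonalize[OF tri] .
  have H: "H \<in> sl2C"
    using tri by (simp add: sl2_triple_def)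
  \<comment> \<open>The weight coordinate of weight \<open>\<nu>' - \<nu>\<close>.\<close>
  define i :: 2 where "i = (if \<nu>' = \<nu> + 1 \<and> \<mu> + 1 + \<nu> \<noteq> 0 then 1 else 2)"
  define A where "A = primary_component G H X Y \<tau> (tensor_C2 R)"
  define W where "W = rep_space A"
  have WV: "x \<in> V \<times> V" if "x \<in> W" for x
    using that unfolding W_def A_def primary_component_def subrep_def tensor_C2_def by auto
  have W0: "0 \<in> W"
    unfolding W_def A_def primary_component_def subrep_def tensor_C2_def
    by (auto simp: zero_prod_def intro: exI[of _ 0])
  have top: "rep_top A = subtopology (prod_topology T T) W"
  proof -
    obtain Z where "rep_top A = subtopology (prod_topology T T) Z"
      by (simp add: A_def primary_component_def subrep_def tensor_C2_def)
    then show ?thesis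
      by (simp add: W_def subtopology_restrict flip: topspace_prod_topology)
  qed
  have act: "rep_act A = rep_act (tensor_C2 R)"
    by (simp add: A_def primary_component_def subrep_def)
  obtain \<Psi> where \<Psi>: "continuous_map (rep_top S) (rep_top A) \<Psi>" "\<forall>y\<in>rep_space S. \<Psi> y \<in> W"
    and onto: "\<forall>x\<in>W. \<exists>y\<in>rep_space S. \<Psi> y = x"
    and add: "\<forall>y\<in>rep_space S. \<forall>z\<in>rep_space S. \<Psi> (y + z) = \<Psi> y + \<Psi> z"
    and scale: "\<forall>c. \<forall>y\<in>rep_space S. \<Psi> (c *\<^sub>C y) = c *\<^sub>C \<Psi> y"
    and act_\<Psi>: "\<forall>g\<in>G. \<forall>y\<in>rep_space S. \<Psi> (rep_act S g y) = rep_act (tensor_C2 R) g (\<Psi> y)"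
    by (rule isomorphism_inverse[OF W0 W_def[symmetric] act S iso[folded A_def]]) (rule that)
  note \<Psi>_add = add[rule_format] and \<Psi>_scale = scale[rule_format] and \<Psi>_act = act_\<Psi>[rule_format]
    and \<Psi>_in = \<Psi>(2)[rule_format]
  have S_closed: "y + z \<in> rep_space S" "k *\<^sub>C y \<in> rep_space S" "g \<in> G \<Longrightarrow> rep_act S g y \<in> rep_space S"
    if "y \<in> rep_space S" "z \<in> rep_space S" for y z k g
    using S that unfolding frechet_rep_def frechet_space_def
    by (auto simp: complex_vector.subspace_add complex_vector.subspace_scale)
  have cont_pair: "continuous_map (rep_top S) (prod_topology T T) \<Psi>"
    using \<Psi>(1) unfolding top by (rule continuous_map_into_fulltopology)
  define F where "F f = (\<lambda>y. if y \<in> rep_space S then f (row_form P i (\<Psi> y)) else 0)" for f :: "'v \<Rightarrow> complex"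
  have row_act: "f (row_form P i (rep_act (tensor_C2 R) g x)) = \<psi>' g * f (row_form P i x)"
    if f: "f \<in> intertwiners G' R (character_rep \<psi>)" and g: "g \<in> G'" and x: "x \<in> V \<times> V" for f g x
  proof -
    obtain t :: real where t: "g = matrix_exp ((complex_of_real t * c) *\<^sub>C H)"
      using bspec[OF one g] by blast
    let ?z = "complex_of_real t * c"
    define e where "e = (if i = 1 then exp ?z else exp (- ?z))"
    have "P ** g = matrix_exp (?z *\<^sub>C D2) ** P"
      unfolding t by (rule exp_triple_conjugate[OF PQ PH])
    then have "row_form (P ** g) i x = e *\<^sub>C row_form P i x"
      using exhaust_2[of i] by (auto simp: row_form_def exp_D2 e_def scaleC_add_right scaleC_scaleC)
    moreover have "\<psi>' g = \<psi> g * e"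
      unfolding t character_one_parameter[OF ch c(2)] character_one_parameter[OF ch' c(2)]
      using weight by (auto simp: e_def i_def algebra_simps simp flip: exp_add)
    ultimately show ?thesis
      using f g x G' row_form_in[OF x, of P i]
      by (simp add: row_form_tensor_act subsetD intertwiners_characterD[OF f] act_scale)
  qed
  have "cdim (intertwiners G' R (character_rep \<psi>)) \<le> cdim (intertwiners G' S (character_rep \<psi>'))"
  proof (rule cdim_le_if_injective[OF _ subspace_intertwiners_character])
    show "clinear_on (intertwiners G' R (character_rep \<psi>)) F"
      by (auto simp: clinear_on_def F_def fun_eq_iff scaleC_fun_def scaleC_complex_def)
    show "F ` intertwiners G' R (character_rep \<psi>) \<subseteq> intertwiners G' S (character_rep \<psi>')"
    proof safe
      fix f
      assume f: "f \<in> intertwiners G' R (character_rep \<psi>)"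
      note fD = intertwiners_characterD[OF f]
      show "F f \<in> intertwiners G' S (character_rep \<psi>')"
      proof (rule intertwiners_characterI)
        show "F f (y + z) = F f y + F f z" if "y \<in> rep_space S" "z \<in> rep_space S" for y z
          using that S_closed[OF that] WV[OF \<Psi>_in[OF that(1)]] WV[OF \<Psi>_in[OF that(2)]]
          by (simp add: F_def \<Psi>_add row_form_add fD row_form_in)
        show "F f (k *\<^sub>C y) = k * F f y" if "y \<in> rep_space S" for k y
          using that S_closed[OF that that] WV[OF \<Psi>_in[OF that]]
          by (simp add: F_def \<Psi>_scale row_form_scale fD row_form_in)
        show "F f (rep_act S g y) = \<psi>' g * F f y" if "g \<in> G'" "y \<in> rep_space S" for g y
          using that S_closed[OF that(2) that(2)] WV[OF \<Psi>_in[OF that(2)]] G'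
          by (simp add: F_def \<Psi>_act subsetD row_act[OF f])
        show "F f y = 0" if "y \<notin> rep_space S" for y
          using that by (simp add: F_def)
        have "continuous_map (rep_top S) euclidean (\<lambda>y. P $ i $ 1 * f (fst (\<Psi> y)) + P $ i $ 2 * f (snd (\<Psi> y)))"
          using continuous_map_compose[OF continuous_map_compose[OF cont_pair continuous_map_fst] fD(3)]
            continuous_map_compose[OF continuous_map_compose[OF cont_pair continuous_map_snd] fD(3)]
          by (intro continuous_map_add continuous_map_cmult) (simp_all add: o_def)
        then show "continuous_map (rep_top S) euclidean (F f)"
        proof (rule continuous_map_eq)
          fix y
          assume y: "y \<in> rep_space S"
          then have "fst (\<Psi> y) \<in> V" "snd (\<Psi> y) \<in> V"
            using WV[OF \<Psi>_in[OF y]] by auto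
          then show "P $ i $ 1 * f (fst (\<Psi> y)) + P $ i $ 2 * f (snd (\<Psi> y)) = F f y"
            using y by (simp add: F_def row_form_def fD)
        qed
      qed
    qed
    fix f
    assume f: "f \<in> intertwiners G' R (character_rep \<psi>)" and F0: "F f = 0"
    note fD = intertwiners_characterD[OF f]
    have zero: "f (row_form P i x) = 0" if "x \<in> W" for x
    proof -
      obtain y where "y \<in> rep_space S" "\<Psi> y = x"
        using bspec[OF onto \<open>x \<in> W\<close>] by blast
      then show ?thesis
        using fun_cong[OF F0, of y] by (simp add: F_def)
    qed
    have "f v = 0" if v: "v \<in> V" for v
    proof -
      note vec = primary_component_vectors[OF tri PQ PH PX PY cas \<tau> v, folded A_def, folded W_def]
      have wt: "f (d H v) = \<nu> * f v"
        by (rule intertwiner_weight[OF f ch c G' H v])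
      have dH: "d H v \<in> V" "- d H v \<in> V"
        using H v by simp_all
      have neg: "f (- d H v) = - f (d H v)"
        using fD(2)[OF dH(1), of "-1"] by simp
      show ?thesis
      proof (cases "\<nu>' = \<nu> + 1 \<and> \<mu> + 1 + \<nu> \<noteq> 0")
        case True
        then obtain x where "x \<in> W" "row_form P i x = d H v + (1 + \<mu>) *\<^sub>C v"
          using vec(1) by (auto simp: i_def)
        then have "f (d H v + (1 + \<mu>) *\<^sub>C v) = 0"
          using zero by metis
        then have "(\<mu> + 1 + \<nu>) * f v = 0"
          using v dH by (simp add: fD wt algebra_simps)
        then show ?thesis
          using True by simp
      next
        case False
        then obtain x where "x \<in> W" "row_form P i x = (1 + \<mu>) *\<^sub>C v - d H v"
          using vec(2) by (auto simp: i_def)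
        then have "f ((1 + \<mu>) *\<^sub>C v + - d H v) = 0"
          using zero by (metis diff_conv_add_uminus)
        then have "(\<mu> + 1 - \<nu>) * f v = 0"
          unfolding fD(1)[OF V_simps(4)[OF v] dH(2)] neg wt fD(2)[OF v] by (simp add: algebra_simps)
        then show ?thesis
          using False weight by auto
      qed
    qed
    then show "f = 0"
      using fD(5) by (auto simp: fun_eq_iff)
  qed
  then show ?thesis
    by (simp add: multiplicity_of_def)
qed

end

section \<open>Regions of constancy\<close>

text \<open>The two moves generate the lattice of pairs with even difference.\<close>

lemma diagonal_moves_parity:
  fixes f :: "int \<Rightarrow> int \<Rightarrow> 'a"
  assumes 1: "\<And>n k. f n k = f (n + 1) (k + 1)" and 2: "\<And>n k. f n k = f (n + 1) (k - 1)"
  shows "f n k = f 0 (if even (n - k) then 0 else 1)"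
proof -
  have a: "f n k = f 0 (k - n)" for n k
  proof (induction n arbitrary: k rule: int_induct[of _ 0])
    case (step1 i)
    show ?case using step1(2)[of "k - 1"] 1[of i "k - 1"] by (simp add: algebra_simps)
  next
    case (step2 i)
    show ?case using step2(2)[of "k + 1"] 1[of "i - 1" k] by (simp add: algebra_simps)
  qed simp
  have b: "f 0 (k + 2) = f 0 k" for k
    using 1[of 0 k] 2[of 0 "k + 2"] by (simp add: algebra_simps)
  have c: "f 0 (2 * j + k) = f 0 k" for j k
  proof (induction j rule: int_induct[of _ 0])
    case (step1 i)
    then show ?case using b[of "2 * i + k"] by (simp add: algebra_simps)
  next
    case (step2 i)
    then show ?case using b[of "2 * (i - 1) + k"] by (simp add: algebra_simps)
  qed simp
  show ?thesis
  proof (cases "even (n - k)")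
    case True
    then obtain j where "k - n = 2 * j + 0"
      by (metis add.right_neutral dvd_def dvd_minus_iff minus_diff_eq)
    then show ?thesis using True a[of n k] c[of j 0] by simp
  next
    case False
    then obtain j where "k - n = 2 * j + 1"
      by (metis even_minus minus_diff_eq oddE)
    then show ?thesis using False a[of n k] c[of j 1] by simp
  qed
qed

text \<open>
  The excluded moves are those between the points \<open>(l, - l - 1)\<close> and \<open>(l + 1, - l)\<close>, and between
  \<open>(l, l + 1)\<close> and \<open>(l + 1, l)\<close>: they lead from the lower, respectively the upper, odd region to the right
  one. No move between points of the even region is excluded, since \<open>l + 1 \<plusminus> k\<close> is odd there.
\<close>

locale half_plane_moves =
  fixes f :: "int \<Rightarrow> int \<Rightarrow> 'a"
  assumes up: "\<And>l k. 1 \<le> l \<Longrightarrow> l + 1 + k \<noteq> 0 \<Longrightarrow> f l k = f (l + 1) (k + 1)"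
    and down: "\<And>l k. 1 \<le> l \<Longrightarrow> l + 1 - k \<noteq> 0 \<Longrightarrow> f l k = f (l + 1) (k - 1)"
begin

lemma reflected: "half_plane_moves (\<lambda>l k. f l (- k))"
proof
  fix l k :: int
  assume l: "1 \<le> l"
  show "l + 1 + k \<noteq> 0 \<Longrightarrow> f l (- k) = f (l + 1) (- (k + 1))"
    using down[OF l, of "- k"] by simp
  show "l + 1 - k \<noteq> 0 \<Longrightarrow> f l (- k) = f (l + 1) (- (k - 1))"
    using up[OF l, of "- k"] by (simp add: algebra_simps)
qed

text \<open>
  A detour through the second line, \<open>(1, k)\<close>, \<open>(2, k + 1)\<close>, \<open>(1, k + 2)\<close>. For even \<open>k\<close> the two
  exceptions separate the three odd regions on the first line.
\<close>

lemma first_line: "k \<noteq> 0 \<Longrightarrow> k \<noteq> -2 \<Longrightarrow> f 1 (k + 2) = f 1 k"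
  using up[of 1 k] down[of 1 "k + 2"] by (simp add: add.commute)

lemma first_line_from: "1 \<le> k \<Longrightarrow> f 1 (k + 2 * int n) = f 1 k"
proof (induction n)
  case (Suc n)
  then show ?case
    using first_line[of "k + 2 * int n"] by (simp add: algebra_simps)
qed simp

lemma even_region_step: "1 \<le> l \<Longrightarrow> even (l - k) \<Longrightarrow> f l k = f 1 (k - l + 1)"
proof (induction l arbitrary: k rule: int_ge_induct)
  case (step l)
  have "l + 1 + (k - 1) \<noteq> 0"
    using step(3) by presburger
  then have "f (l + 1) k = f l (k - 1)"
    using up[OF step(1), of "k - 1"] by simp
  also have "\<dots> = f 1 (k - 1 - l + 1)"
    by (intro step(2)) (use step(3) in presburger)
  finally show ?case by (simp add: algebra_simps)
qed simp

lemma odd_first_line: "odd k \<Longrightarrow> f 1 k = f 1 1"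
proof (cases "1 \<le> k")
  case True
  assume "odd k"
  then obtain j where "k = 2 * j + 1" by (rule oddE)
  then have "k = 1 + 2 * int (nat j)" using True by simp
  then show ?thesis using first_line_from[of 1 "nat j"] by simp
next
  case False
  assume "odd k"
  interpret r: half_plane_moves "\<lambda>l k. f l (- k)" by (rule reflected)
  obtain j where "- k = 2 * j + 1" using \<open>odd k\<close> by (metis even_minus oddE)
  then have "k = - (1 + 2 * int (nat j))" using False by simp
  then have "f 1 k = f 1 (- 1)" using r.first_line_from[of 1 "nat j"] by simp
  then show ?thesis using first_line[of "-1"] by simp
qed

lemma even_region: "1 \<le> l \<Longrightarrow> even (l - k) \<Longrightarrow> f l k = f 1 1"
  using even_region_step[of l k] odd_first_line[of "k - l + 1"] by simp

lemma up_region: "1 \<le> l \<Longrightarrow> odd (l - k) \<Longrightarrow> l + 1 \<le> k \<Longrightarrow> f l k = f 1 2"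
proof -
  have a: "f l k = f 1 (k + l - 1)" if "1 \<le> l" "l + 1 \<le> k" for l k
    using that
  proof (induction l arbitrary: k rule: int_ge_induct)
    case (step l)
    have "f (l + 1) k = f l (k + 1)"
      using down[OF step(1), of "k + 1"] step by simp
    also have "\<dots> = f 1 (k + 1 + l - 1)"
      using step by (intro step(2)) simp
    finally show ?case by (simp add: algebra_simps)
  qed simp
  assume *: "1 \<le> l" "odd (l - k)" "l + 1 \<le> k"
  then have "even (k + l - 1)" "2 \<le> k + l - 1"
    by presburger+
  then obtain j where "k + l - 1 = 2 * j" "2 \<le> 2 * j"
    by (metis evenE)
  then have "k + l - 1 = 2 + 2 * int (nat (j - 1))"
    by simp
  then show ?thesis
    using a[OF *(1,3)] first_line_from[of 2 "nat (j - 1)"] by simp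
qed

lemma down_region: "1 \<le> l \<Longrightarrow> odd (l - k) \<Longrightarrow> k \<le> - l - 1 \<Longrightarrow> f l k = f 1 (- 2)"
proof -
  interpret r: half_plane_moves "\<lambda>l k. f l (- k)" by (rule reflected)
  show "1 \<le> l \<Longrightarrow> odd (l - k) \<Longrightarrow> k \<le> - l - 1 \<Longrightarrow> f l k = f 1 (- 2)"
    using r.up_region[of l "- k"] by simp
qed

text \<open>
  Descend to the tip \<open>(1, 0)\<close> of the region along the diagonal that leads towards the axis \<open>k = 0\<close>;
  on the axis either diagonal stays in the region.
\<close>

lemma right_region: "1 \<le> l \<Longrightarrow> odd (l - k) \<Longrightarrow> \<bar>k\<bar> + 1 \<le> l \<Longrightarrow> f l k = f 1 0"
proof (induction l arbitrary: k rule: int_ge_induct)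
  case (step l)
  consider "k \<ge> 1" | "k \<le> -1" | "k = 0" by linarith
  then show ?case
  proof cases
    case 1
    then have "f (l + 1) k = f l (k - 1)"
      using up[OF step(1), of "k - 1"] step by simp
    also have "\<dots> = f 1 0"
      using step 1 by (intro step(2)) auto
    finally show ?thesis .
  next
    case 2
    then have "f (l + 1) k = f l (k + 1)"
      using down[OF step(1), of "k + 1"] step by simp
    also have "\<dots> = f 1 0"
      using step 2 by (intro step(2)) auto
    finally show ?thesis .
  next
    case 3
    then have "f (l + 1) k = f l (k + 1)"
      using down[OF step(1), of "k + 1"] step by simp
    moreover have "even l"
      using step(3) 3 by simp
    moreover from this have "2 \<le> l"
      using step(1) by presburger
    ultimately have "f (l + 1) k = f l (k + 1) \<and> f l (k + 1) = f 1 0"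
      using 3 by (intro conjI step(2)) simp_all
    then show ?thesis by simp
  qed
qed auto

end

lemma has_infinitesimal_character_cong:
  "\<tau>\<^sup>2 = \<mu>\<^sup>2 \<Longrightarrow> has_infinitesimal_character G H X Y R \<tau> = has_infinitesimal_character G H X Y R \<mu>" for \<tau> :: complex
  by (simp add: has_infinitesimal_character_def)

text \<open>
  Both diagonal moves, in both directions: translating from \<open>l\<close> to \<open>l + 1\<close> uses \<open>\<mu> = l\<close>, and
  translating back uses \<open>\<mu> = - (l + 1)\<close>; the weight condition is the same.
\<close>

lemma coherent_family_moves:
  assumes G: "real_form_SL2C G" and tri: "sl2_triple H X Y" and G': "G' \<subseteq> G"
    and c: "c \<noteq> 0" "c *\<^sub>C H \<in> lie_algebra G'"
    and one: "\<forall>g\<in>G'. \<exists>t::real. g = matrix_exp ((complex_of_real t * c) *\<^sub>C H)"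
    and ch: "\<And>\<nu>. is_character G' H (of_int \<nu>) (\<psi> \<nu>)"
    and fam: "reduced_coherent_family G H X Y \<xi> R P"
    and l: "l \<in> Lambda \<xi>" "l + 1 \<in> Lambda \<xi>"
  shows "l + 1 + of_int \<nu> \<noteq> 0 \<Longrightarrow>
      multiplicity_of G' (P l) (\<psi> \<nu>) = multiplicity_of G' (P (l + 1)) (\<psi> (\<nu> + 1))"
    and "l + 1 - of_int \<nu> \<noteq> 0 \<Longrightarrow>
      multiplicity_of G' (P l) (\<psi> \<nu>) = multiplicity_of G' (P (l + 1)) (\<psi> (\<nu> - 1))"
proof -
  have P: "smooth_rep G (P k)" "has_infinitesimal_character G H X Y (P k) k" if "k \<in> Lambda \<xi>" for k
    using fam that by (auto simp: reduced_coherent_family_def category_M_def)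
  have iso: "rep_iso G (primary_component G H X Y (l + 1) (tensor_C2 (P l))) (P (l + 1))"
    "rep_iso G (primary_component G H X Y l (tensor_C2 (P (l + 1)))) (P l)"
    using fam l by (auto simp: reduced_coherent_family_def)
  interpret L: smooth_representation G "P l"
    using G P l by unfold_locales auto
  interpret L1: smooth_representation G "P (l + 1)"
    using G P l by unfold_locales auto
  have cas: "has_infinitesimal_character G H X Y (P (l + 1)) (- (l + 1))"
    using P(2)[OF l(2)] has_infinitesimal_character_cong[OF power2_minus[of "l + 1"]] by blast
  note fwd = L.translation_multiplicity_le[OF tri G' c one ch ch P(2)[OF l(1)] refl L1.frechet_rep iso(1)]
  have "l\<^sup>2 = (- (l + 1) + 1)\<^sup>2"
    by (simp add: power2_eq_square algebra_simps)
  note bwd = L1.translation_multiplicity_le[OF tri G' c one ch ch cas this L.frechet_rep iso(2)]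
  show "multiplicity_of G' (P l) (\<psi> \<nu>) = multiplicity_of G' (P (l + 1)) (\<psi> (\<nu> + 1))"
    if ne: "l + 1 + of_int \<nu> \<noteq> 0"
  proof (rule antisym)
    show "multiplicity_of G' (P l) (\<psi> \<nu>) \<le> multiplicity_of G' (P (l + 1)) (\<psi> (\<nu> + 1))"
      by (rule fwd) (use ne in auto)
    have "- (l + 1) + 1 - of_int (\<nu> + 1) \<noteq> 0"
      using ne by (simp add: algebra_simps add_eq_0_iff2)
    then show "multiplicity_of G' (P (l + 1)) (\<psi> (\<nu> + 1)) \<le> multiplicity_of G' (P l) (\<psi> \<nu>)"
      by (intro bwd) auto
  qed
  show "multiplicity_of G' (P l) (\<psi> \<nu>) = multiplicity_of G' (P (l + 1)) (\<psi> (\<nu> - 1))"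
    if ne: "l + 1 - of_int \<nu> \<noteq> 0"
  proof (rule antisym)
    show "multiplicity_of G' (P l) (\<psi> \<nu>) \<le> multiplicity_of G' (P (l + 1)) (\<psi> (\<nu> - 1))"
      by (rule fwd) (use ne in auto)
    have "- (l + 1) + 1 + of_int (\<nu> - 1) \<noteq> 0"
      using ne by (simp add: algebra_simps)
    then show "multiplicity_of G' (P (l + 1)) (\<psi> (\<nu> - 1)) \<le> multiplicity_of G' (P l) (\<psi> \<nu>)"
      by (intro bwd) auto
  qed
qed

lemma regions_decompose:
  "N_plus \<times> UNIV = Xi_even \<union> Xi_odd" "Xi_even \<inter> Xi_odd = {}"
  "Xi_odd = Xi_odd_up \<union> Xi_odd_right \<union> Xi_odd_down"
  "Xi_odd_up \<inter> Xi_odd_right = {}" "Xi_odd_up \<inter> Xi_odd_down = {}" "Xi_odd_right \<inter> Xi_odd_down = {}"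
proof -
  have parity: "l mod 2 = \<nu> mod 2 \<or> l mod 2 = (\<nu> + 1) mod 2"
      "l mod 2 = \<nu> mod 2 \<Longrightarrow> l mod 2 = (\<nu> + 1) mod 2 \<Longrightarrow> False" for l \<nu> :: int
    by presburger+
  show "N_plus \<times> UNIV = Xi_even \<union> Xi_odd"
    unfolding N_plus_def Xi_even_def Xi_odd_def using parity(1) by blast
  show "Xi_even \<inter> Xi_odd = {}"
    using parity(2) by (fastforce simp: Xi_even_def Xi_odd_def)
  have tri: "\<nu> \<ge> l + 1 \<or> l \<ge> \<bar>\<nu>\<bar> + 1 \<or> \<nu> \<le> - l - 1" if "l mod 2 = (\<nu> + 1) mod 2" for l \<nu> :: int
    using that by presburger
  show "Xi_odd = Xi_odd_up \<union> Xi_odd_right \<union> Xi_odd_down"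
  proof (intro antisym subsetI)
    fix x
    assume x: "x \<in> Xi_odd"
    then obtain l \<nu> where l: "x = (of_int l, \<nu>)" "l mod 2 = (\<nu> + 1) mod 2"
      unfolding Xi_odd_def by blast
    show "x \<in> Xi_odd_up \<union> Xi_odd_right \<union> Xi_odd_down"
      using tri[OF l(2)] x unfolding l(1) Xi_odd_up_def Xi_odd_right_def Xi_odd_down_def by blast
  next
    fix x
    assume "x \<in> Xi_odd_up \<union> Xi_odd_right \<union> Xi_odd_down"
    then show "x \<in> Xi_odd"
      unfolding Xi_odd_up_def Xi_odd_right_def Xi_odd_down_def by blast
  qed
  have pos: "1 \<le> l" if "(of_int l :: complex, \<nu>) \<in> Xi_odd" for l \<nu>
    using that unfolding Xi_odd_def by auto
  have up: "\<exists>l. fst x = of_int l \<and> 1 \<le> l \<and> l + 1 \<le> snd x" if "x \<in> Xi_odd_up" for x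
    using that pos unfolding Xi_odd_up_def by force
  have right: "\<exists>l. fst x = of_int l \<and> \<bar>snd x\<bar> + 1 \<le> l" if "x \<in> Xi_odd_right" for x
    using that unfolding Xi_odd_right_def by force
  have down: "\<exists>l. fst x = of_int l \<and> 1 \<le> l \<and> snd x \<le> - l - 1" if "x \<in> Xi_odd_down" for x
    using that pos unfolding Xi_odd_down_def by force
  have "False" if x: "x \<in> Xi_odd_up" "x \<in> Xi_odd_right" for x
  proof -
    obtain l l' where l: "fst x = of_int l" "1 \<le> l \<and> l + 1 \<le> snd x" and l': "fst x = of_int l'" "\<bar>snd x\<bar> + 1 \<le> l'"
      using up[OF x(1)] right[OF x(2)] by blast
    have "l = l'"
      using l(1) l'(1) by simp
    then show False
      using l(2) l'(2) by linarith
  qed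
  then show "Xi_odd_up \<inter> Xi_odd_right = {}"
    by blast
  have "False" if x: "x \<in> Xi_odd_up" "x \<in> Xi_odd_down" for x
  proof -
    obtain l l' where l: "fst x = of_int l" "1 \<le> l \<and> l + 1 \<le> snd x" and l': "fst x = of_int l'" "1 \<le> l' \<and> snd x \<le> - l' - 1"
      using up[OF x(1)] down[OF x(2)] by blast
    have "l = l'"
      using l(1) l'(1) by simp
    then show False
      using l(2) l'(2) by linarith
  qed
  then show "Xi_odd_up \<inter> Xi_odd_down = {}"
    by blast
  have "False" if x: "x \<in> Xi_odd_right" "x \<in> Xi_odd_down" for x
  proof -
    obtain l l' where l: "fst x = of_int l" "\<bar>snd x\<bar> + 1 \<le> l" and l': "fst x = of_int l'" "1 \<le> l' \<and> snd x \<le> - l' - 1"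
      using right[OF x(1)] down[OF x(2)] by blast
    have "l = l'"
      using l(1) l'(1) by simp
    then show False
      using l(2) l'(2) by linarith
  qed
  then show "Xi_odd_right \<inter> Xi_odd_down = {}"
    by blast
qed

theorem theorem2p11:
  fixes G G' :: "cmat set" and H X Y :: cmat
    and \<xi> :: complex
    and \<pi> :: "'v::complex_vector rep" and P :: "complex \<Rightarrow> 'v rep"
    and \<psi> :: "int \<Rightarrow> cmat \<Rightarrow> complex"
  assumes "real_form_SL2C G"
    and "subgroup_of G' G" and "closed G'" and "connected G'"
    and "sl2_triple H X Y"
    and "complexification (lie_algebra G') = {c *\<^sub>C H | c. True}"
    and "\<And>\<nu>. is_character G' H (of_int \<nu>) (\<psi> \<nu>)"
    and "\<pi> \<in> category_M G"
    and "\<xi> \<noteq> 0"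
    and "has_infinitesimal_character G H X Y \<pi> \<xi>"
    and "reduced_coherent_family G H X Y \<xi> \<pi> P"
  shows
    "(\<xi> \<notin> \<int> \<longrightarrow>
       (\<exists>m :: bool \<Rightarrow> enat. \<forall>(l, \<nu>) \<in> Lambda \<xi> \<times> UNIV.
         \<exists>k :: int. l - \<xi> - of_int \<nu> = of_int k \<and> multiplicity_of G' (P l) (\<psi> \<nu>) = m (even k))) \<and>
     (\<xi> \<in> N_plus \<longrightarrow>
       Lambda \<xi> \<times> UNIV = Xi_even \<union> Xi_odd \<and> Xi_even \<inter> Xi_odd = {} \<and>
       Xi_odd = Xi_odd_up \<union> Xi_odd_right \<union> Xi_odd_down \<and>
       Xi_odd_up \<inter> Xi_odd_right = {} \<and> Xi_odd_up \<inter> Xi_odd_down = {} \<and>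
       Xi_odd_right \<inter> Xi_odd_down = {} \<and>
       (\<forall>S \<in> {Xi_even, Xi_odd_up, Xi_odd_right, Xi_odd_down}.
          (\<lambda>(l, \<nu>). multiplicity_of G' (P l) (\<psi> \<nu>)) constant_on S))"
proof -
  interpret real_form G
    using assms(1) by unfold_locales
  obtain c where c: "c \<noteq> 0" "c *\<^sub>C H \<in> lie_algebra G'"
    and one: "\<forall>g\<in>G'. \<exists>t::real. g = matrix_exp ((complex_of_real t * c) *\<^sub>C H)"
    using connected_subgroup_one_parameter[OF assms(2,4,5,6)] by blast
  have G': "G' \<subseteq> G"
    using assms(2) by (simp add: subgroup_of_def)
  note moves = coherent_family_moves[OF assms(1,5) G' c one assms(7,11)]
  define m where "m l \<nu> = multiplicity_of G' (P l) (\<psi> \<nu>)" for l \<nu>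
  have part1: "\<exists>m :: bool \<Rightarrow> enat. \<forall>(l, \<nu>) \<in> Lambda \<xi> \<times> UNIV.
      \<exists>k :: int. l - \<xi> - of_int \<nu> = of_int k \<and> multiplicity_of G' (P l) (\<psi> \<nu>) = m (even k)"
    if \<xi>: "\<xi> \<notin> \<int>"
  proof -
    have L: "Lambda \<xi> = {of_int n + \<xi> | n. True}"
      using \<xi> by (simp add: Lambda_def)
    have mem: "of_int n + \<xi> \<in> Lambda \<xi>" "of_int n + \<xi> + 1 \<in> Lambda \<xi>" for n
      unfolding L by (auto intro: exI[of _ "n + 1"])
    have ne: "of_int n + \<xi> + 1 + of_int k \<noteq> 0" for n k
    proof
      assume "of_int n + \<xi> + 1 + of_int k = 0"
      then have "\<xi> + (of_int n + 1 + of_int k) = 0"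
        by (simp add: add_ac)
      then have "\<xi> = - (of_int n + 1 + of_int k)"
        by (rule eq_neg_iff_add_eq_0[THEN iffD2])
      also have "\<dots> = of_int (- (n + 1 + k))"
        by simp
      finally have "\<xi> = of_int (- (n + 1 + k))" .
      with \<xi> show False by simp
    qed
    define f where "f n \<nu> = m (of_int n + \<xi>) \<nu>" for n \<nu>
    have shift: "of_int (n + 1) + \<xi> = of_int n + \<xi> + 1" for n
      by simp
    have ne': "of_int n + \<xi> + 1 - of_int k \<noteq> 0" for n k
      using ne[of n "- k"] by simp
    have "f n \<nu> = f (n + 1) (\<nu> + 1)" "f n \<nu> = f (n + 1) (\<nu> - 1)" for n \<nu>
      unfolding f_def m_def shift by (rule moves[OF mem], rule ne ne')+
    then have f: "f n \<nu> = f 0 (if even (n - \<nu>) then 0 else 1)" for n \<nu>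
      by (rule diagonal_moves_parity)
    show ?thesis
    proof (intro exI[of _ "\<lambda>b. f 0 (if b then 0 else 1)"] ballI, clarify)
      fix l \<nu>
      assume "l \<in> Lambda \<xi>"
      then obtain n where n: "l = of_int n + \<xi>"
        by (auto simp: L)
      show "\<exists>k :: int. l - \<xi> - of_int \<nu> = of_int k \<and>
          multiplicity_of G' (P l) (\<psi> \<nu>) = f 0 (if even k then 0 else 1)"
        using f[of n \<nu>] by (intro exI[of _ "n - \<nu>"]) (simp add: n f_def m_def)
    qed
  qed
  have part2: "Lambda \<xi> = N_plus \<and> (\<forall>S \<in> {Xi_even, Xi_odd_up, Xi_odd_right, Xi_odd_down}.
      (\<lambda>(l, \<nu>). multiplicity_of G' (P l) (\<psi> \<nu>)) constant_on S)" if \<xi>: "\<xi> \<in> N_plus"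
  proof -
    have L: "Lambda \<xi> = N_plus"
      using \<xi> by (auto simp: Lambda_def N_plus_def)
    define f where "f n \<nu> = m (of_int n) \<nu>" for n \<nu>
    have mem: "of_int n \<in> Lambda \<xi>" "of_int n + 1 \<in> Lambda \<xi>" if "1 \<le> n" for n
      using that unfolding L N_plus_def by (auto intro: exI[of _ "n + 1"])
    interpret half_plane_moves f
    proof
      fix n k :: int
      assume n: "1 \<le> n"
      have cast: "of_int n + 1 + of_int k = (of_int (n + 1 + k) :: complex)"
        "of_int n + 1 - of_int k = (of_int (n + 1 - k) :: complex)"
        by simp_all
      show "n + 1 + k \<noteq> 0 \<Longrightarrow> f n k = f (n + 1) (k + 1)" "n + 1 - k \<noteq> 0 \<Longrightarrow> f n k = f (n + 1) (k - 1)"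
        using moves[OF mem[OF n], of k] unfolding cast of_int_eq_0_iff by (simp_all add: f_def m_def)
    qed
    have "(\<lambda>(l, \<nu>). multiplicity_of G' (P l) (\<psi> \<nu>)) constant_on Xi_even"
      unfolding constant_on_def
    proof (intro exI ballI)
      fix x assume "x \<in> Xi_even"
      then obtain l \<nu> where "x = (of_int l, \<nu>)" "1 \<le> l" "even (l - \<nu>)"
        by (auto simp: Xi_even_def mod_eq_dvd_iff)
      then show "(case x of (l, \<nu>) \<Rightarrow> multiplicity_of G' (P l) (\<psi> \<nu>)) = f 1 1"
        using even_region[of l \<nu>] by (simp add: f_def m_def)
    qed
    moreover have odd: "(\<lambda>(l, \<nu>). multiplicity_of G' (P l) (\<psi> \<nu>)) constant_on
        {(of_int l, \<nu>) | l \<nu>. (of_int l, \<nu>) \<in> Xi_odd \<and> Q l \<nu>}"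
      if w: "\<And>l \<nu>. 1 \<le> l \<Longrightarrow> odd (l - \<nu>) \<Longrightarrow> Q l \<nu> \<Longrightarrow> f l \<nu> = w" for Q w
      unfolding constant_on_def
    proof (intro exI ballI)
      fix x :: "complex \<times> int"
      assume "x \<in> {(of_int l, \<nu>) | l \<nu>. (of_int l, \<nu>) \<in> Xi_odd \<and> Q l \<nu>}"
      then obtain l \<nu> where x: "x = (of_int l, \<nu>)" "(of_int l :: complex, \<nu>) \<in> Xi_odd" "Q l \<nu>"
        by blast
      then have "1 \<le> l" "l mod 2 = (\<nu> + 1) mod 2"
        by (auto simp: Xi_odd_def)
      moreover from this have "odd (l - \<nu>)"
        by presburger
      ultimately have "f l \<nu> = w"
        using x(3) by (intro w)
      then show "(case x of (l, \<nu>) \<Rightarrow> multiplicity_of G' (P l) (\<psi> \<nu>)) = w"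
        by (simp add: x(1) f_def m_def)
    qed
    have "(\<lambda>(l, \<nu>). multiplicity_of G' (P l) (\<psi> \<nu>)) constant_on Xi_odd_up"
      unfolding Xi_odd_up_def by (rule odd[OF up_region])
    moreover have "(\<lambda>(l, \<nu>). multiplicity_of G' (P l) (\<psi> \<nu>)) constant_on Xi_odd_right"
      unfolding Xi_odd_right_def by (rule odd[OF right_region])
    moreover have "(\<lambda>(l, \<nu>). multiplicity_of G' (P l) (\<psi> \<nu>)) constant_on Xi_odd_down"
      unfolding Xi_odd_down_def by (rule odd[OF down_region])
    ultimately show ?thesis
      using L by blast
  qed
  show ?thesis
    using part1 part2 regions_decompose by simp
qed

end
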